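(* Let $p\ge5$ be a prime and let $G$ be a group of order $p^5$ in $\Phi_7\cup\Phi_8\cup\Phi_{10}$. For a non-trivial $\mu\in\mathrm{Irr}(Z(G))$ let $\chi_\mu\in\mathrm{Irr}(G)$ be the irreducible character of degree $p^2$ with $\chi_\mu(g)=p^2\mu(g)$ for $g\in Z(G)$ and $\chi_\mu(g)=0$ otherwise. Below, $\psi_\mu$ denotes the linear character of $H$ with the given values on generators. (1) If $G\in\Phi_7$, then the following pair $(H,\psi_\mu)$ is a required pair for $\Omega(\chi_\mu)$ (in all cases $Z(G)=\langle\alpha_3\rangle$): - $\Phi_7(2111)a=\langle\alpha,\alpha_1,\alpha_2,\alpha_3,\beta:[\alpha_i,\alpha]=\alpha_{i+1},[\alpha_1,\beta]=\alpha_3=\alpha^p,\ \alpha_1^p=\alpha_{i+1}^p=\beta^p=1\ (i=1,2)\rangle$: $H=\langle\alpha_2,\alpha_3,\beta\rangle$, $\psi_\mu(\alpha_2)=1$, $\psi_\mu(\alpha_3)=\mu(\alpha_3)$, $\psi_\mu(\beta)=1$. - $\Phi_7(2111)b_r=\langle\alpha,\alpha_1,\alpha_2,\alpha_3,\beta:[\alpha_i,\alpha]=\alpha_{i+1},[\alpha_1,\beta]^r=\alpha_3^r=\alpha_1^p,\ \alpha^p=\alpha_{i+1}^p=\beta^p=1\ (i=1,2)\rangle$ for $r=1$ or $\nu$: $H=\langle\alpha_2,\alpha_3,\beta\rangle$, $\psi_\mu(\alpha_2)=1$, $\psi_\mu(\alpha_3)=\mu(\alpha_3)$, $\psi_\mu(\beta)=1$.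 - $\Phi_7(2111)c=\langle\alpha,\alpha_1,\alpha_2,\alpha_3,\beta:[\alpha_i,\alpha]=\alpha_{i+1},[\alpha_1,\beta]=\alpha_3=\beta^p,\ \alpha^p=\alpha_1^p=\alpha_{i+1}^p=1\ (i=1,2)\rangle$: $H=\langle\alpha_1,\alpha_2,\alpha_3\rangle$, $\psi_\mu(\alpha_1)=\psi_\mu(\alpha_2)=1$, $\psi_\mu(\alpha_3)=\mu(\alpha_3)$. - $\Phi_7(1^5)=\langle\alpha,\alpha_1,\alpha_2,\alpha_3,\beta:[\alpha_i,\alpha]=\alpha_{i+1},[\alpha_1,\beta]=\alpha_3,\ \alpha^p=\alpha_1^p=\alpha_{i+1}^p=\beta^p=1\ (i=1,2)\rangle$: $H=\langle\alpha_2,\alpha_3,\beta\rangle$, $\psi_\mu(\alpha_2)=1$, $\psi_\mu(\alpha_3)=\mu(\alpha_3)$, $\psi_\mu(\beta)=1$. (2) If $G\in\Phi_8$, i.e. $G=\Phi_8(32)=\langle\alpha_1,\alpha_2,\beta:[\alpha_1,\alpha_2]=\beta=\alpha_1^p,\ \beta^{p^2}=\alpha_2^{p^2}=1\rangle$, then $Z(G)=\langle\alpha_1^{p^2}\rangle$ and $(H,\psi_\mu)$ with $H=\langle\alpha_1^{p^2},\alpha_2\rangle$, $\psi_\mu(\alpha_1^{p^2})=\mu(\alpha_1^{p^2})$, $\psi_\mu(\alpha_2)=1$ is a required pair for $\Omega(\chi_\mu)$. (3) If $G\in\Phi_{10}$, then $(G',\psi_\mu)$ is a required pair for $\Omega(\chi_\mu)$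 for $\psi_\mu\in\mathrm{Irr}(G'|Z(G))$ with $\psi_\mu\downarrow_{Z(G)}=\mu$.
   Context: For a finite group $G$: $\mathrm{Irr}(G)$ is the set of irreducible complex characters; for $N\trianglelefteq G$, $\mathrm{Irr}(G|N)=\{\chi\in\mathrm{Irr}(G):N\nsubseteq\ker\chi\}$; $\mathbb{Q}(\chi)$ is the field generated over $\mathbb{Q}$ by the values of $\chi$; $\psi^G$ denotes induction, $\psi\downarrow_H$ restriction. $\Omega(\chi)=m_{\mathbb{Q}}(\chi)\sum_{\sigma\in\mathrm{Gal}(\mathbb{Q}(\chi)/\mathbb{Q})}\chi^\sigma$, with $m_{\mathbb{Q}}(\chi)$ the Schur index. Required pair: for a finite $p$-group $G$ ($p$ odd) and $\chi\in\mathrm{Irr}(G)$, a required pair for (an irreducible rational matrix representation of $G$ affording) $\Omega(\chi)$ is a pair $(H,\psi)$ with $H\le G$, $\psi$ a linear character of $H$, $\psi^G=\chi$ and $\mathbb{Q}(\psi)=\mathbb{Q}(\chi)$. Two groups $G,H$ are isoclinic if there are isomorphisms $G/Z(G)\to H/Z(H)$ and $G'\to H'$ compatible with the commutator maps. $\Phi_7,\Phi_8,\Phi_{10}$ are isoclinism families from R. James' classification. For $p\ge5$: the order-$p^5$ groups in $\Phi_7$ are those listed in (1) ($\nu$ is the smallest positive integer that is a quadratic non-residue mod $p$); the only order-$p^5$ group in $\Phi_8$ is $\Phi_8(32)$; $\Phi_{10}$ is the isoclinism family of the order-$p^5$ group $\Phi_{10}(1^5)=\langle\alpha,\alpha_1,\dots,\alpha_4:[\alpha_i,\alpha]=\alpha_{i+1}\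 (i=1,2,3),\ [\alpha_1,\alpha_2]=\alpha_4,\ \alpha^p=\alpha_1^p=\cdots=\alpha_4^p=1\rangle$. Presentations are understood among finite $p$-groups and define groups of order $p^5$; $[x,y]=x^{-1}y^{-1}xy$; relations $[x,y]=1$ between generators whose commutator is not listed are omitted. For all these groups $Z(G)\cong C_p$, and the characters $\chi_\mu$ ($\mu$ non-trivial) are exactly the irreducible characters of degree $p^2$. *)

theory Defs
  imports
    "HOL-Algebra.Generated_Groups"
    "HOL-Algebra.Generated_Fields"
    "HOL-Number_Theory.Residues"
    "Jordan_Normal_Form.VS_Connect"
begin

definition commutator :: "('a, 'b) monoid_scheme \<Rightarrow> 'a \<Rightarrow> 'a \<Rightarrow> 'a" where
  "commutator G x y = inv\<^bsub>G\<^esub> x \<otimes>\<^bsub>G\<^esub> inv\<^bsub>G\<^esub> y \<otimes>\<^bsub>G\<^esub> x \<otimes>\<^bsub>G\<^esub> y"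

definition center :: "('a, 'b) monoid_scheme \<Rightarrow> 'a set" where
  "center G = {z \<in> carrier G. \<forall>x \<in> carrier G. z \<otimes>\<^bsub>G\<^esub> x = x \<otimes>\<^bsub>G\<^esub> z}"

abbreviation derived_subgroup :: "('a, 'b) monoid_scheme \<Rightarrow> 'a set" where
  "derived_subgroup G \<equiv> derived G (carrier G)"

definition isoclinic :: "('a, 'b) monoid_scheme \<Rightarrow> ('c, 'd) monoid_scheme \<Rightarrow> bool" where
  "isoclinic G K \<longleftrightarrow>
    (\<exists>\<theta> \<in> iso (G Mod center G) (K Mod center K).
     \<exists>\<phi> \<in> iso (G\<lparr>carrier := derived_subgroup G\<rparr>) (K\<lparr>carrier := derived_subgroup K\<rparr>).
       \<forall>g1 \<in> carrier G. \<forall>g2 \<in> carrier G. \<forall>k1 \<in> carrier K. \<forall>k2 \<in> carrier K.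
         \<theta> (center G #>\<^bsub>G\<^esub> g1) = center K #>\<^bsub>K\<^esub> k1 \<and>
         \<theta> (center G #>\<^bsub>G\<^esub> g2) = center K #>\<^bsub>K\<^esub> k2 \<longrightarrow>
         \<phi> (commutator G g1 g2) = commutator K k1 k2)"

definition matrix_rep :: "('a, 'b) monoid_scheme \<Rightarrow> nat \<Rightarrow> ('a \<Rightarrow> complex mat) \<Rightarrow> bool" where
  "matrix_rep G n \<rho> \<longleftrightarrow> \<rho> \<in> hom G (units_of (ring_mat TYPE(complex) n ()))"

definition irreducible_rep :: "('a, 'b) monoid_scheme \<Rightarrow> nat \<Rightarrow> ('a \<Rightarrow> complex mat) \<Rightarrow> bool" where
  "irreducible_rep G n \<rho> \<longleftrightarrow> matrix_rep G n \<rho> \<and> n > 0 \<and>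
    (\<forall>W. VectorSpace.subspace class_ring W (module_vec TYPE(complex) n) \<and>
         (\<forall>g \<in> carrier G. \<forall>w \<in> W. \<rho> g *\<^sub>v w \<in> W) \<longrightarrow>
         W = {0\<^sub>v n} \<or> W = carrier_vec n)"

definition mat_trace :: "complex mat \<Rightarrow> complex" where
  "mat_trace A = (\<Sum>i < dim_row A. A $$ (i, i))"

text \<open>Characters, and class functions in general, are extensional functions on the carrier of
  their group, so that equality of characters is equality of functions.\<close>

definition character :: "('a, 'b) monoid_scheme \<Rightarrow> ('a \<Rightarrow> complex mat) \<Rightarrow> 'a \<Rightarrow> complex" where
  "character G \<rho> = (\<lambda>g \<in> carrier G. mat_trace (\<rho> g))"

definition Irr :: "('a, 'b) monoid_scheme \<Rightarrow> ('a \<Rightarrow> complex) set" where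
  "Irr G = {character G \<rho> | n \<rho>. irreducible_rep G n \<rho>}"

definition char_kernel :: "('a, 'b) monoid_scheme \<Rightarrow> ('a \<Rightarrow> complex) \<Rightarrow> 'a set" where
  "char_kernel G \<chi> = {g \<in> carrier G. \<chi> g = \<chi> \<one>\<^bsub>G\<^esub>}"

definition Irr_over :: "('a, 'b) monoid_scheme \<Rightarrow> 'a set \<Rightarrow> ('a \<Rightarrow> complex) set" where
  "Irr_over G N = {\<chi> \<in> Irr G. \<not> N \<subseteq> char_kernel G \<chi>}"

definition linear_character :: "('a, 'b) monoid_scheme \<Rightarrow> ('a \<Rightarrow> complex) \<Rightarrow> bool" where
  "linear_character G \<psi> \<longleftrightarrow> \<psi> \<in> Irr G \<and> \<psi> \<one>\<^bsub>G\<^esub> = 1"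

definition induced :: "('a, 'b) monoid_scheme \<Rightarrow> 'a set \<Rightarrow> ('a \<Rightarrow> complex) \<Rightarrow> 'a \<Rightarrow> complex" where
  "induced G H \<psi> = (\<lambda>g \<in> carrier G.
     (\<Sum>x | x \<in> carrier G \<and> inv\<^bsub>G\<^esub> x \<otimes>\<^bsub>G\<^esub> g \<otimes>\<^bsub>G\<^esub> x \<in> H. \<psi> (inv\<^bsub>G\<^esub> x \<otimes>\<^bsub>G\<^esub> g \<otimes>\<^bsub>G\<^esub> x))
       / of_nat (card H))"

text \<open>Here \<open>class_ring\<close> is the field of complex numbers as a ring record; every subfield
  contains the rational numbers.\<close>

definition character_field :: "('a, 'b) monoid_scheme \<Rightarrow> ('a \<Rightarrow> complex) \<Rightarrow> complex set" where
  "character_field G \<chi> = generate_field class_ring (\<chi> ` carrier G)"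

definition required_pair ::
  "('a, 'b) monoid_scheme \<Rightarrow> ('a \<Rightarrow> complex) \<Rightarrow> 'a set \<Rightarrow> ('a \<Rightarrow> complex) \<Rightarrow> bool" where
  "required_pair G \<chi> H \<psi> \<longleftrightarrow>
     \<chi> \<in> Irr G \<and> subgroup H G \<and> linear_character (G\<lparr>carrier := H\<rparr>) \<psi> \<and>
     induced G H \<psi> = \<chi> \<and>
     character_field (G\<lparr>carrier := H\<rparr>) \<psi> = character_field G \<chi>"

text \<open>There is exactly one linear character of \<open>H\<close> taking the values prescribed by the pairs
  \<open>(h, c)\<close> in \<open>V\<close>, and together with \<open>H\<close> it forms a required pair.\<close>

definition required_pair_by_values ::
  "('a, 'b) monoid_scheme \<Rightarrow> ('a \<Rightarrow> complex) \<Rightarrow> 'a set \<Rightarrow> ('a \<times> complex) set \<Rightarrow> bool" where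
  "required_pair_by_values G \<chi> H V \<longleftrightarrow>
     (\<exists>\<psi>. {\<phi>. linear_character (G\<lparr>carrier := H\<rparr>) \<phi> \<and> (\<forall>(h, c) \<in> V. \<phi> h = c)} = {\<psi>} \<and>
          required_pair G \<chi> H \<psi>)"

definition chi_mu :: "nat \<Rightarrow> ('a, 'b) monoid_scheme \<Rightarrow> ('a \<Rightarrow> complex) \<Rightarrow> 'a \<Rightarrow> complex" where
  "chi_mu p G \<mu> = (\<lambda>g \<in> carrier G. if g \<in> center G then of_nat (p ^ 2) * \<mu> g else 0)"

text \<open>A presentation that defines a group of order \<open>p ^ 5\<close> among finite \<open>p\<close>-groups is rendered by:
  \<open>G\<close> has order \<open>p ^ 5\<close> and is generated by elements satisfying the relations. Any such \<open>G\<close> is a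
  quotient of the presented group of the same order, hence isomorphic to it.  In the families
  below \<open>a, a1, \<dots>, b\<close> stand for \<open>\<alpha>, \<alpha>\<^sub>1, \<dots>, \<beta>\<close>, and \<open>commuting_pairs\<close> spells out the
  relations left implicit by the convention that unlisted commutators of generators are trivial.\<close>

definition generated_p5 :: "nat \<Rightarrow> ('a, 'b) monoid_scheme \<Rightarrow> 'a set \<Rightarrow> bool" where
  "generated_p5 p G S \<longleftrightarrow>
     group G \<and> Coset.order G = p ^ 5 \<and> S \<subseteq> carrier G \<and> generate G S = carrier G"

definition commuting_pairs :: "('a, 'b) monoid_scheme \<Rightarrow> ('a \<times> 'a) set \<Rightarrow> bool" where
  "commuting_pairs G P \<longleftrightarrow> (\<forall>(x, y) \<in> P. commutator G x y = \<one>\<^bsub>G\<^esub>)"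

definition nu :: "nat \<Rightarrow> nat" where
  "nu p = (LEAST n. 0 < n \<and> \<not> QuadRes (int p) (int n))"

text \<open>What the five presentations of \<open>\<Phi>\<^sub>7\<close> share; the commutator of \<open>a1\<close> and \<open>b\<close> and the
  \<open>p\<close>-th powers of \<open>a\<close>, \<open>a1\<close>, \<open>b\<close> are treated separately.\<close>

definition Phi7_common ::
  "nat \<Rightarrow> ('a, 'b) monoid_scheme \<Rightarrow> 'a \<Rightarrow> 'a \<Rightarrow> 'a \<Rightarrow> 'a \<Rightarrow> 'a \<Rightarrow> bool" where
  "Phi7_common p G a a1 a2 a3 b \<longleftrightarrow>
     generated_p5 p G {a, a1, a2, a3, b} \<and>
     commutator G a1 a = a2 \<and> commutator G a2 a = a3 \<and>
     commuting_pairs G {(a3, a), (a1, a2), (a1, a3), (a2, a3), (a, b), (a2, b), (a3, b)} \<and>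
     a2 [^]\<^bsub>G\<^esub> p = \<one>\<^bsub>G\<^esub> \<and> a3 [^]\<^bsub>G\<^esub> p = \<one>\<^bsub>G\<^esub>"

definition Phi7_2111a ::
  "nat \<Rightarrow> ('a, 'b) monoid_scheme \<Rightarrow> 'a \<Rightarrow> 'a \<Rightarrow> 'a \<Rightarrow> 'a \<Rightarrow> 'a \<Rightarrow> bool" where
  "Phi7_2111a p G a a1 a2 a3 b \<longleftrightarrow> Phi7_common p G a a1 a2 a3 b \<and>
     commutator G a1 b = a3 \<and> a3 = a [^]\<^bsub>G\<^esub> p \<and>
     a1 [^]\<^bsub>G\<^esub> p = \<one>\<^bsub>G\<^esub> \<and> b [^]\<^bsub>G\<^esub> p = \<one>\<^bsub>G\<^esub>"

definition Phi7_2111b ::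
  "nat \<Rightarrow> nat \<Rightarrow> ('a, 'b) monoid_scheme \<Rightarrow> 'a \<Rightarrow> 'a \<Rightarrow> 'a \<Rightarrow> 'a \<Rightarrow> 'a \<Rightarrow> bool" where
  "Phi7_2111b r p G a a1 a2 a3 b \<longleftrightarrow> Phi7_common p G a a1 a2 a3 b \<and>
     commutator G a1 b [^]\<^bsub>G\<^esub> r = a3 [^]\<^bsub>G\<^esub> r \<and> a3 [^]\<^bsub>G\<^esub> r = a1 [^]\<^bsub>G\<^esub> p \<and>
     a [^]\<^bsub>G\<^esub> p = \<one>\<^bsub>G\<^esub> \<and> b [^]\<^bsub>G\<^esub> p = \<one>\<^bsub>G\<^esub>"

definition Phi7_2111c ::
  "nat \<Rightarrow> ('a, 'b) monoid_scheme \<Rightarrow> 'a \<Rightarrow> 'a \<Rightarrow> 'a \<Rightarrow> 'a \<Rightarrow> 'a \<Rightarrow> bool" where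
  "Phi7_2111c p G a a1 a2 a3 b \<longleftrightarrow> Phi7_common p G a a1 a2 a3 b \<and>
     commutator G a1 b = a3 \<and> a3 = b [^]\<^bsub>G\<^esub> p \<and>
     a [^]\<^bsub>G\<^esub> p = \<one>\<^bsub>G\<^esub> \<and> a1 [^]\<^bsub>G\<^esub> p = \<one>\<^bsub>G\<^esub>"

definition Phi7_1_5 ::
  "nat \<Rightarrow> ('a, 'b) monoid_scheme \<Rightarrow> 'a \<Rightarrow> 'a \<Rightarrow> 'a \<Rightarrow> 'a \<Rightarrow> 'a \<Rightarrow> bool" where
  "Phi7_1_5 p G a a1 a2 a3 b \<longleftrightarrow> Phi7_common p G a a1 a2 a3 b \<and>
     commutator G a1 b = a3 \<and>
     a [^]\<^bsub>G\<^esub> p = \<one>\<^bsub>G\<^esub> \<and> a1 [^]\<^bsub>G\<^esub> p = \<one>\<^bsub>G\<^esub> \<and> b [^]\<^bsub>G\<^esub> p = \<one>\<^bsub>G\<^esub>"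

text \<open>Here \<open>b = a1 [^] p\<close> is merely an abbreviation, and the commutator of \<open>b\<close> and \<open>a2\<close> is
  determined by the first relation; it equals \<open>b [^] p\<close> and is not trivial. The convention
  that unlisted commutators are trivial must not be applied to this pair.\<close>

definition Phi8_32 ::
  "nat \<Rightarrow> ('a, 'b) monoid_scheme \<Rightarrow> 'a \<Rightarrow> 'a \<Rightarrow> 'a \<Rightarrow> bool" where
  "Phi8_32 p G a1 a2 b \<longleftrightarrow> generated_p5 p G {a1, a2, b} \<and>
     commutator G a1 a2 = b \<and> b = a1 [^]\<^bsub>G\<^esub> p \<and>
     b [^]\<^bsub>G\<^esub> (p ^ 2) = \<one>\<^bsub>G\<^esub> \<and> a2 [^]\<^bsub>G\<^esub> (p ^ 2) = \<one>\<^bsub>G\<^esub>"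

definition Phi10_1_5 ::
  "nat \<Rightarrow> ('a, 'b) monoid_scheme \<Rightarrow> 'a \<Rightarrow> 'a \<Rightarrow> 'a \<Rightarrow> 'a \<Rightarrow> 'a \<Rightarrow> bool" where
  "Phi10_1_5 p G a a1 a2 a3 a4 \<longleftrightarrow> generated_p5 p G {a, a1, a2, a3, a4} \<and>
     commutator G a1 a = a2 \<and> commutator G a2 a = a3 \<and> commutator G a3 a = a4 \<and>
     commutator G a1 a2 = a4 \<and>
     commuting_pairs G {(a4, a), (a1, a3), (a1, a4), (a2, a3), (a2, a4), (a3, a4)} \<and>
     a [^]\<^bsub>G\<^esub> p = \<one>\<^bsub>G\<^esub> \<and> a1 [^]\<^bsub>G\<^esub> p = \<one>\<^bsub>G\<^esub> \<and> a2 [^]\<^bsub>G\<^esub> p = \<one>\<^bsub>G\<^esub> \<and>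
     a3 [^]\<^bsub>G\<^esub> p = \<one>\<^bsub>G\<^esub> \<and> a4 [^]\<^bsub>G\<^esub> p = \<one>\<^bsub>G\<^esub>"

text \<open>For \<open>p \<ge> 5\<close>, membership in \<open>\<Phi>\<^sub>7\<close> and \<open>\<Phi>\<^sub>8\<close> is given by James' list.\<close>

definition in_Phi7 :: "nat \<Rightarrow> ('a, 'b) monoid_scheme \<Rightarrow> bool" where
  "in_Phi7 p G \<longleftrightarrow> (\<exists>a a1 a2 a3 b.
     Phi7_2111a p G a a1 a2 a3 b \<or> Phi7_2111b 1 p G a a1 a2 a3 b \<or>
     Phi7_2111b (nu p) p G a a1 a2 a3 b \<or> Phi7_2111c p G a a1 a2 a3 b \<or>
     Phi7_1_5 p G a a1 a2 a3 b)"

definition in_Phi8 :: "nat \<Rightarrow> ('a, 'b) monoid_scheme \<Rightarrow> bool" where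
  "in_Phi8 p G \<longleftrightarrow> (\<exists>a1 a2 b. Phi8_32 p G a1 a2 b)"

text \<open>Placing the model group \<open>K\<close> on the element type of \<open>G\<close> is no restriction: groups
  of order \<open>p ^ 5\<close> can be transported to the carrier of \<open>G\<close>.\<close>

definition in_Phi10 :: "nat \<Rightarrow> ('a, 'b) monoid_scheme \<Rightarrow> bool" where
  "in_Phi10 p G \<longleftrightarrow> group G \<and> Coset.order G = p ^ 5 \<and>
     (\<exists>K :: 'a monoid. (\<exists>a a1 a2 a3 a4. Phi10_1_5 p K a a1 a2 a3 a4) \<and> isoclinic G K)"

end

theory Submission
  imports Defs "Jordan_Normal_Form.Char_Poly" "HOL-Computational_Algebra.Fundamental_Theorem_Algebra"
begin

text \<open>Let \<open>H\<close> be one of the listed subgroups, of index \<open>p\<^sup>2\<close>. Every noncentral \<open>h \<in> H\<close> is conjugate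
  to \<open>h z\<close> for some central \<open>z \<noteq> 1\<close>. Since \<open>\<mu> z \<noteq> 1\<close>, a character induced from a linear character
  of \<open>H\<close> that extends \<open>\<mu>\<close> vanishes at \<open>h\<close>, so it vanishes off the centre and equals \<open>\<chi>\<^sub>\<mu>\<close>.
  As \<open>\<chi>\<^sub>\<mu>(1)\<^sup>2\<close> is the index of the centre, this makes it irreducible. In (1) and (2) the
  prescribed \<open>\<psi>\<^sub>\<mu>\<close> is trivial on a complement of the centre in \<open>H\<close>, and in (3) \<open>H = G'\<close> has
  exponent \<open>p\<close>; either way \<open>\<psi>\<^sub>\<mu>\<close> takes the same values as \<open>\<mu>\<close>.

  In the groups given by presentations, adjoining the generators in a suitable order multiplies
  the order of the subgroup by at most the exponent needed to fall back into it; since the total is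
  \<open>p\<^sup>5\<close>, all these bounds are attained, which yields normal forms and the centre. For \<open>\<Phi>\<^sub>1\<^sub>0\<close>
  the condition on \<open>H = G'\<close> is about commutators only and is carried over by the isoclinism.\<close>

section \<open>Matrix representations\<close>

text \<open>The choice of \<open>H\<close> is dictated by fields. The values of
  \<open>chi_mu\<close> are 0 and p^2 times those of \<mu>, so its field is generated by a primitive
  p-th root of unity. An element of \<open>H\<close> whose p-th power is central and nontrivial
  would force a value of order p^2 on \<psi>; hence \<open>b\<close> has to stay out of
  \<open>H\<close> in \<open>Phi7_2111c\<close>, and \<open>a1\<close> in \<open>Phi7_2111b\<close>.
  A complement \<open>N\<close> of the centre in \<open>H\<close> excludes such elements.
  Irreducibility concerns \<open>chi_mu\<close> alone and not a particular \<psi>, so a single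
  extension of \<mu> is enough for it, and \<open>N\<close> provides one explicitly. The vanishing
  criterion asks for one conjugating element and a central commutator. This form only speaks of
  commutators and centrality, which an isoclinism respects; powers of elements outside the derived
  subgroup are not respected, so nothing in the transfer may depend on them.\<close>

lemma matrix_repI:
  assumes "group G"
    and "\<And>g. g \<in> carrier G \<Longrightarrow> \<rho> g \<in> carrier_mat n n"
    and "\<And>g h. g \<in> carrier G \<Longrightarrow> h \<in> carrier G \<Longrightarrow> \<rho> (g \<otimes>\<^bsub>G\<^esub> h) = \<rho> g * \<rho> h"
    and "\<rho> \<one>\<^bsub>G\<^esub> = 1\<^sub>m n"
  shows "matrix_rep G n \<rho>"
proof -
  interpret group G by fact
  have "\<rho> g \<in> Units (ring_mat TYPE(complex) n ())" if g: "g \<in> carrier G" for g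
  proof -
    have "\<rho> g * \<rho> (inv\<^bsub>G\<^esub> g) = 1\<^sub>m n" "\<rho> (inv\<^bsub>G\<^esub> g) * \<rho> g = 1\<^sub>m n"
      using assms(3)[of g "inv\<^bsub>G\<^esub> g"] assms(3)[of "inv\<^bsub>G\<^esub> g" g] assms(4) g by simp_all
    then show ?thesis
      using assms(2) g unfolding Units_def ring_mat_simps by auto
  qed
  then show ?thesis
    unfolding matrix_rep_def hom_def
    using assms(3) by (auto simp: units_of_def ring_mat_simps)
qed

lemma matrix_repD:
  assumes "group G" "matrix_rep G n \<rho>"
  shows "g \<in> carrier G \<Longrightarrow> \<rho> g \<in> carrier_mat n n"
    and "g \<in> carrier G \<Longrightarrow> h \<in> carrier G \<Longrightarrow> \<rho> (g \<otimes>\<^bsub>G\<^esub> h) = \<rho> g * \<rho> h"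
    and "\<rho> \<one>\<^bsub>G\<^esub> = 1\<^sub>m n"
proof -
  interpret R: ring "ring_mat TYPE(complex) n ()" by (rule ring_mat)
  have "group (units_of (ring_mat TYPE(complex) n ()))" by (rule R.units_group)
  then show "\<rho> \<one>\<^bsub>G\<^esub> = 1\<^sub>m n"
    using hom_one[of \<rho> G "units_of (ring_mat TYPE(complex) n ())"] assms
    by (simp add: matrix_rep_def units_of_def ring_mat_simps)
  show "g \<in> carrier G \<Longrightarrow> \<rho> g \<in> carrier_mat n n"
    using assms(2) hom_in_carrier[of \<rho> G "units_of (ring_mat TYPE(complex) n ())" g]
    by (auto simp: matrix_rep_def units_of_def Units_def ring_mat_simps)
  show "g \<in> carrier G \<Longrightarrow> h \<in> carrier G \<Longrightarrow> \<rho> (g \<otimes>\<^bsub>G\<^esub> h) = \<rho> g * \<rho> h"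
    using assms(2) hom_mult[of \<rho> G "units_of (ring_mat TYPE(complex) n ())" g h]
    by (simp add: matrix_rep_def units_of_def ring_mat_simps)
qed

lemma subspace_vecI:
  fixes W :: "complex vec set"
  assumes "W \<subseteq> carrier_vec n" "0\<^sub>v n \<in> W"
    and "\<And>v w. v \<in> W \<Longrightarrow> w \<in> W \<Longrightarrow> v + w \<in> W"
    and "\<And>c v. v \<in> W \<Longrightarrow> c \<cdot>\<^sub>v v \<in> W"
  shows "VectorSpace.subspace class_ring W (module_vec TYPE(complex) n)"
proof -
  interpret vec_space "TYPE(complex)" n .
  show ?thesis
    unfolding VectorSpace.subspace_def submodule_def
    using assms by (auto simp: class_ring_simps module_vec_simps intro: vec_vs module_axioms)
qed

lemma subspace_vecD:
  fixes W :: "complex vec set"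
  assumes "VectorSpace.subspace class_ring W (module_vec TYPE(complex) n)"
  shows "W \<subseteq> carrier_vec n" "0\<^sub>v n \<in> W"
    and "v \<in> W \<Longrightarrow> w \<in> W \<Longrightarrow> v + w \<in> W"
    and "v \<in> W \<Longrightarrow> c \<cdot>\<^sub>v v \<in> W"
  using assms unfolding VectorSpace.subspace_def submodule_def
  by (auto simp: class_ring_simps module_vec_simps)

lemma subspace_vec_sum:
  fixes W :: "complex vec set" and m :: nat
  assumes W: "VectorSpace.subspace class_ring W (module_vec TYPE(complex) n)"
    and "\<And>t. t < m \<Longrightarrow> f t \<in> W"
  shows "vec n (\<lambda>i. \<Sum>t<m. c t * f t $ i) \<in> W"
  using assms(2)
proof (induction m)
  case 0
  have "vec n (\<lambda>i. 0 :: complex) = 0\<^sub>v n" by auto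
  then show ?case using subspace_vecD(2)[OF W] by simp
next
  case (Suc m)
  have "f m \<in> carrier_vec n" using Suc.prems subspace_vecD(1)[OF W] by auto
  then have "vec n (\<lambda>i. \<Sum>t<Suc m. c t * f t $ i) = vec n (\<lambda>i. \<Sum>t<m. c t * f t $ i) + c m \<cdot>\<^sub>v f m"
    by auto
  then show ?case
    using Suc subspace_vecD(3,4)[OF W] by simp
qed

text \<open>Cosets are avoided in the conclusion: uniqueness is phrased by membership of
  \<open>g \<otimes> inv (y i)\<close>, the form in which matrix entries and traces ask for it
  later.\<close>

lemma (in group) transversal:
  assumes "subgroup H G" "finite (carrier G)" "Coset.order G = m * card H"
  obtains y :: "nat \<Rightarrow> 'a"
  where "\<And>i. i < m \<Longrightarrow> y i \<in> carrier G"
    and "\<And>g. g \<in> carrier G \<Longrightarrow> \<exists>!i. i < m \<and> g \<otimes> inv (y i) \<in> H"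
proof -
  have "finite H" using assms subgroup.subset finite_subset by blast
  then have "card H > 0" using assms(1) subgroup.one_closed card_gt_0_iff by blast
  then have "card (rcosets H) = m"
    using lagrange[OF assms(1)] assms(3) by simp
  moreover have "finite (rcosets H)"
    using rcosets_part_G[OF assms(1)] assms(2) finite_UnionD by metis
  ultimately obtain f where f: "bij_betw f {..<m} (rcosets H)"
    using ex_bij_betw_nat_finite[of "rcosets H"] by (auto simp: atLeast0LessThan)
  have "\<exists>y\<in>carrier G. f i = H #> y" if "i < m" for i
  proof -
    have "f i \<in> rcosets H" using bij_betwE[OF f] that by blast
    then show ?thesis unfolding RCOSETS_def by blast
  qed
  then obtain y where y: "\<And>i. i < m \<Longrightarrow> y i \<in> carrier G \<and> f i = H #> y i" by metis
  have "\<exists>!i. i < m \<and> g \<otimes> inv (y i) \<in> H" if g: "g \<in> carrier G" for g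
  proof -
    have iff: "g \<otimes> inv (y i) \<in> H \<longleftrightarrow> H #> g = f i" if "i < m" for i
    proof -
      have y': "y i \<in> carrier G" "f i = H #> y i" using y[OF that] by auto
      have "g \<otimes> inv (y i) \<in> H \<longleftrightarrow> g \<in> H #> y i"
        using subgroup.rcos_module[OF assms(1) is_group y'(1) g] by simp
      also have "\<dots> \<longleftrightarrow> H #> g = H #> y i"
        using repr_independence[OF _ y'(1) assms(1)] rcos_self[OF g assms(1)] by metis
      finally show ?thesis using y'(2) by simp
    qed
    have "H #> g \<in> rcosets H" using g assms(1) rcosetsI subgroup.subset by blast
    then obtain i where "i < m" "f i = H #> g"
      using bij_betw_imp_surj_on[OF f] by (metis imageE lessThan_iff)
    then have "\<exists>!i. i < m \<and> f i = H #> g"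
      using bij_betw_imp_inj_on[OF f] by (intro ex1I[of _ i]) (auto simp: inj_on_def)
    then show ?thesis using iff by metis
  qed
  then show ?thesis using that y by blast
qed

text \<open>Matrices of size n are flattened row by row into vectors of length n^2, position
  \<open>k\<close> standing for row \<open>k div n\<close> and column
  \<open>k mod n\<close>.\<close>

lemma sum_div_mod:
  fixes f :: "nat \<Rightarrow> nat \<Rightarrow> 'b::comm_monoid_add"
  shows "(\<Sum>k<n * n. f (k div n) (k mod n)) = (\<Sum>i<n. \<Sum>j<n. f i j)"
proof -
  have index_bound: "i * n + j < n * n" if "i < n" "j < n" for i j
  proof -
    have "i * n + j < Suc i * n" using that by simp
    also have "\<dots> \<le> n * n" using that by (intro mult_le_mono) auto
    finally show ?thesis .
  qed
  have mod_bound: "k mod n < n" if "k < n * n" for k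
    using that by (cases "n = 0") auto
  have "(\<Sum>k<n * n. f (k div n) (k mod n)) = (\<Sum>(i, j)\<in>{..<n} \<times> {..<n}. f i j)"
    by (rule sum.reindex_bij_witness[where i = "\<lambda>(i, j). i * n + j" and j = "\<lambda>k. (k div n, k mod n)"])
      (auto simp: less_mult_imp_div_less index_bound mod_bound)
  then show ?thesis by (simp add: sum.cartesian_product)
qed

text \<open>The images of a transversal of \<open>Z\<close> are linearly independent because the trace form separates
  them, so they span the matrix algebra; expressing matrix units through them moves any nonzero
  vector to any other one.\<close>

lemma (in group) irreducible_rep_if_vanishing:
  assumes rep: "matrix_rep G n \<rho>" and "n > 0" and fin: "finite (carrier G)"
    and Z: "subgroup Z G" "Coset.order G = n * n * card Z"
    and vanish: "\<And>g. g \<in> carrier G \<Longrightarrow> g \<notin> Z \<Longrightarrow> mat_trace (\<rho> g) = 0"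
  shows "irreducible_rep G n \<rho>"
proof -
  note repD = matrix_repD[OF is_group rep]
  obtain y where y: "\<And>t. t < n * n \<Longrightarrow> y t \<in> carrier G"
    and y_unique: "\<And>g. g \<in> carrier G \<Longrightarrow> \<exists>!t. t < n * n \<and> g \<otimes> inv (y t) \<in> Z"
    using transversal[OF Z(1) fin Z(2)] by blast
  define m where "m = n * n"
  \<comment> \<open>Row \<open>t\<close> of \<open>R\<close> is \<open>\<rho> (y t)\<close>
    flattened; column \<open>s\<close> of \<open>S\<close> is the flattened transpose of
    \<open>\<rho> (inv (y s))\<close>, scaled by 1/n. Their product is the table of traces at
    \<open>y t \<otimes> inv (y s)\<close>, divided by n.\<close>
  define R where "R = mat m m (\<lambda>(t, k). \<rho> (y t) $$ (k div n, k mod n))"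
  define S where "S = mat m m (\<lambda>(k, s). \<rho> (inv (y s)) $$ (k mod n, k div n) / of_nat n)"
  have trace: "(\<Sum>i<n. \<Sum>j<n. \<rho> g $$ (i, j) * \<rho> h $$ (j, i)) = mat_trace (\<rho> (g \<otimes> h))"
    if "g \<in> carrier G" "h \<in> carrier G" for g h
    unfolding repD(2)[OF that] mat_trace_def
    using repD(1)[OF that(1)] repD(1)[OF that(2)]
    by (auto simp: scalar_prod_def atLeast0LessThan intro!: sum.cong)
  have "R * S = 1\<^sub>m m"
  proof (rule eq_matI)
    fix t s assume ts: "t < dim_row (1\<^sub>m m)" "s < dim_col (1\<^sub>m m)"
    then have ts: "t < m" "s < m" by auto
    then have yts: "y t \<in> carrier G" "y s \<in> carrier G" using y by (auto simp: m_def)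
    have "(R * S) $$ (t, s) = (\<Sum>k<m. \<rho> (y t) $$ (k div n, k mod n) * \<rho> (inv (y s)) $$ (k mod n, k
        div n)) / of_nat n"
      using ts by (auto simp: R_def S_def scalar_prod_def atLeast0LessThan sum_divide_distrib
          intro!: sum.cong)
    also have "\<dots> = mat_trace (\<rho> (y t \<otimes> inv (y s))) / of_nat n"
      unfolding m_def sum_div_mod[of "\<lambda>i j. \<rho> (y t) $$ (i, j) * \<rho> (inv (y s)) $$ (j, i)"]
      using trace yts by simp
    also have "\<dots> = (if t = s then 1 else 0)"
    proof (cases "t = s")
      case True
      then show ?thesis using yts repD(3) \<open>n > 0\<close> by (simp add: mat_trace_def)
    next
      case False
      have "y t \<otimes> inv (y t) \<in> Z" using yts subgroup.one_closed[OF Z(1)] by simp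
      then have "y t \<otimes> inv (y s) \<notin> Z" using y_unique[OF yts(1)] ts False by (auto simp: m_def)
      then show ?thesis using vanish yts False by simp
    qed
    finally show "(R * S) $$ (t, s) = 1\<^sub>m m $$ (t, s)" using ts by auto
  qed (auto simp: R_def S_def)
  \<comment> \<open>\<open>R\<close> is square because there are exactly n^2 cosets, so a right
    inverse is a left inverse. Entrywise, this writes each matrix unit as a combination of the
    \<open>\<rho> (y t)\<close>.\<close>
  then have SR: "S * R = 1\<^sub>m m"
    by (intro mat_mult_left_right_inverse[of R]) (auto simp: R_def S_def)
  have orth: "(\<Sum>t<m. \<rho> (inv (y t)) $$ (j, i) / of_nat n * \<rho> (y t) $$ (i', j')) = (if i = i' \<and> j = j'
      then 1 else 0)"
    if "i < n" "j < n" "i' < n" "j' < n" for i j i' j'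
  proof -
    have bound: "a * n + b < m" if "a < n" "b < n" for a b
    proof -
      have "a * n + b < Suc a * n" using that by simp
      also have "\<dots> \<le> m" unfolding m_def using that by (intro mult_le_mono) auto
      finally show ?thesis .
    qed
    have "(\<Sum>t<m. \<rho> (inv (y t)) $$ (j, i) / of_nat n * \<rho> (y t) $$ (i', j')) = (S * R) $$ (i * n + j,
        i' * n + j')"
      using that bound by (auto simp: R_def S_def scalar_prod_def atLeast0LessThan intro!: sum.cong)
    also have "\<dots> = (if i * n + j = i' * n + j' then 1 else 0)"
      using that bound by (simp add: SR)
    also have "i * n + j = i' * n + j' \<longleftrightarrow> i = i' \<and> j = j'"
    proof
      assume eq: "i * n + j = i' * n + j'"
      then have "(i * n + j) div n = (i' * n + j') div n" "(i * n + j) mod n = (i' * n + j') mod n"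
        by simp_all
      then show "i = i' \<and> j = j'" using that by simp
    qed simp
    finally show ?thesis .
  qed
  have "W = carrier_vec n"
    if W: "VectorSpace.subspace class_ring W (module_vec TYPE(complex) n)"
      and inv: "\<forall>g \<in> carrier G. \<forall>w \<in> W. \<rho> g *\<^sub>v w \<in> W" and "W \<noteq> {0\<^sub>v n}" for W
  proof -
    obtain w where w: "w \<in> W" "w \<noteq> 0\<^sub>v n" using subspace_vecD(2)[OF W] \<open>W \<noteq> {0\<^sub>v n}\<close> by blast
    then have wc: "w \<in> carrier_vec n" using subspace_vecD(1)[OF W] by blast
    then obtain l where l: "l < n" "w $ l \<noteq> 0" using w(2) by (metis carrier_vecD eq_vecI index_zero_vec)
    have "u \<in> W" if u: "u \<in> carrier_vec n" for u
    proof -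
      \<comment> \<open>The matrix whose column \<open>l\<close> is \<open>u\<close> divided by
        \<open>w $ l\<close>, and which is zero elsewhere, sends \<open>w\<close> to
        \<open>u\<close>. The \<open>c t\<close> are its coefficients with respect to the
        \<open>\<rho> (y t)\<close>, as given by \<open>orth\<close>.\<close>
      define c where "c t = (\<Sum>i<n. u $ i / w $ l * (\<rho> (inv (y t)) $$ (l, i) / of_nat n))" for t
      have "vec n (\<lambda>i. \<Sum>t<m. c t * (\<rho> (y t) *\<^sub>v w) $ i) \<in> W"
        using inv w y by (intro subspace_vec_sum[OF W]) (auto simp: m_def)
      also have "vec n (\<lambda>i. \<Sum>t<m. c t * (\<rho> (y t) *\<^sub>v w) $ i) = u"
      proof (rule eq_vecI)
        fix i' assume "i' < dim_vec u"
        then have i': "i' < n" using u by auto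
        have "(\<Sum>t<m. c t * (\<rho> (y t) *\<^sub>v w) $ i')
          = (\<Sum>t<m. \<Sum>i<n. \<Sum>j'<n. u $ i / w $ l * w $ j' * (\<rho> (inv (y t)) $$ (l, i) / of_nat n * \<rho> (y
              t) $$ (i', j')))"
        proof (rule sum.cong[OF refl])
          fix t assume "t \<in> {..<m}"
          then have "\<rho> (y t) \<in> carrier_mat n n" using y repD(1) by (auto simp: m_def)
          then have "(\<rho> (y t) *\<^sub>v w) $ i' = (\<Sum>j'<n. \<rho> (y t) $$ (i', j') * w $ j')"
            using i' wc by (auto simp: scalar_prod_def atLeast0LessThan intro!: sum.cong)
          then show "c t * (\<rho> (y t) *\<^sub>v w) $ i' = (\<Sum>i<n. \<Sum>j'<n. u $ i / w $ l * w $ j' * (\<rho> (inv (y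
              t)) $$ (l, i) / of_nat n * \<rho> (y t) $$ (i', j')))"
            unfolding c_def sum_product by (auto simp: sum_product intro!: sum.cong)
        qed
        also have "\<dots> = (\<Sum>i<n. \<Sum>j'<n. u $ i / w $ l * w $ j' * (\<Sum>t<m. \<rho> (inv (y t)) $$ (l, i) /
            of_nat n * \<rho> (y t) $$ (i', j')))"
          unfolding sum_distrib_left
          by (subst sum.swap, intro sum.cong[OF refl], subst sum.swap, rule refl)
        also have "\<dots> = (\<Sum>i<n. \<Sum>j'<n.
            if j' = l then (if i = i' then u $ i / w $ l * w $ j' else 0) else 0)"
          by (intro sum.cong[OF refl], subst orth) (use l i' in auto)
        also have "\<dots> = u $ i'" using l i' by (simp add: sum.delta)
        finally show "vec n (\<lambda>i. \<Sum>t<m. c t * (\<rho> (y t) *\<^sub>v w) $ i) $ i' = u $ i'" using i' by simp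
      qed (use u in auto)
      finally show ?thesis .
    qed
    then show ?thesis using subspace_vecD(1)[OF W] by blast
  qed
  then show ?thesis unfolding irreducible_rep_def using rep \<open>n > 0\<close> by blast
qed

section \<open>Induced representations and linear characters\<close>

text \<open>\<open>\<psi>\<close> is extended by zero outside \<open>H\<close>. With right coset representatives \<open>y i\<close> the induced
  representation has the entries \<open>\<psi> (y i \<otimes> g \<otimes> inv (y j))\<close>.\<close>

lemma (in group) induced_rep:
  fixes \<psi> :: "'a \<Rightarrow> complex"
  assumes fin: "finite (carrier G)" and H: "subgroup H G" and ord: "Coset.order G = n * card H"
    and mult: "\<And>x y. x \<in> H \<Longrightarrow> y \<in> H \<Longrightarrow> \<psi> (x \<otimes> y) = \<psi> x * \<psi> y" and one: "\<psi> \<one> = 1"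
  shows "\<exists>\<rho>. matrix_rep G n \<rho> \<and> character G \<rho> = induced G H \<psi>"
proof -
  obtain y where y: "\<And>i. i < n \<Longrightarrow> y i \<in> carrier G"
    and y_unique: "\<And>g. g \<in> carrier G \<Longrightarrow> \<exists>!i. i < n \<and> g \<otimes> inv (y i) \<in> H"
    using transversal[OF H fin ord] by blast
  define f where "f x = (if x \<in> H then \<psi> x else 0)" for x
  have HG: "h \<in> carrier G" if "h \<in> H" for h using that subgroup.mem_carrier[OF H] by blast
  have finH: "finite H" using fin H subgroup.subset finite_subset by blast
  \<comment> \<open>The extension by zero stays multiplicative as long as one factor lies in
    \<open>H\<close>, since such a factor does not change membership in \<open>H\<close>.\<close>
  have f_mult: "f (x \<otimes> h) = f x * \<psi> h" "f (h \<otimes> x) = \<psi> h * f x" if "x \<in> carrier G" "h \<in> H" for x h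
  proof -
    have ih: "inv h \<in> H" "h \<in> carrier G" using that subgroup.m_inv_closed[OF H] HG by auto
    have "x = (x \<otimes> h) \<otimes> inv h" "x = inv h \<otimes> (h \<otimes> x)"
      using that ih by (simp add: m_assoc, simp add: m_assoc[symmetric])
    then have "x \<otimes> h \<in> H \<longleftrightarrow> x \<in> H" "h \<otimes> x \<in> H \<longleftrightarrow> x \<in> H"
      using that(2) ih(1) subgroup.m_closed[OF H] by metis+
    then show "f (x \<otimes> h) = f x * \<psi> h" "f (h \<otimes> x) = \<psi> h * f x"
      using that mult by (auto simp: f_def)
  qed
  define \<rho> where "\<rho> g = mat n n (\<lambda>(i, j). f (y i \<otimes> g \<otimes> inv (y j)))" for g
  have rho_mult: "\<rho> (g \<otimes> h) = \<rho> g * \<rho> h" if gh: "g \<in> carrier G" "h \<in> carrier G" for g h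
  proof (rule eq_matI)
    fix i k assume "i < dim_row (\<rho> g * \<rho> h)" "k < dim_col (\<rho> g * \<rho> h)"
    then have ik: "i < n" "k < n" by (auto simp: \<rho>_def)
    define u where "u = h \<otimes> inv (y k)"
    have u: "u \<in> carrier G" using gh ik y by (auto simp: u_def)
    have yi: "y i \<in> carrier G" "y k \<in> carrier G" using ik y by auto
    have entry: "y j \<otimes> u \<in> carrier G" "y i \<otimes> g \<otimes> inv (y j) \<otimes> (y j \<otimes> u) = y i \<otimes> g \<otimes> u" if "j < n" for j
    proof -
      have yj: "y j \<in> carrier G" using y that by auto
      then have "inv (y j) \<otimes> (y j \<otimes> u) = u" using u by (simp add: m_assoc[symmetric])
      then show "y i \<otimes> g \<otimes> inv (y j) \<otimes> (y j \<otimes> u) = y i \<otimes> g \<otimes> u"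
        using yi yj u gh by (simp add: m_assoc)
      show "y j \<otimes> u \<in> carrier G" using yj u by simp
    qed
    \<comment> \<open>Only one representative has \<open>y j \<otimes> u \<in> H\<close>, so the sum
      for a product entry collapses to one term. Uniqueness is available for right cosets, hence the
      passage to \<open>inv u\<close>.\<close>
    obtain l where l: "l < n" "inv u \<otimes> inv (y l) \<in> H"
        and l_unique: "\<And>j. j < n \<Longrightarrow> inv u \<otimes> inv (y j) \<in> H \<Longrightarrow> j = l"
      using y_unique[of "inv u"] u by blast
    have inv_mem: "y j \<otimes> u \<in> H \<longleftrightarrow> inv u \<otimes> inv (y j) \<in> H" if "j < n" for j
    proof -
      have "inv u \<otimes> inv (y j) = inv (y j \<otimes> u)" using that y u by (simp add: inv_mult_group)
      moreover have "inv (inv (y j \<otimes> u)) = y j \<otimes> u" using entry(1)[OF that] by simp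
      ultimately show ?thesis using subgroup.m_inv_closed[OF H] by metis
    qed
    have yu: "y j \<otimes> h \<otimes> inv (y k) = y j \<otimes> u" if "j < n" for j
      using that y gh yi by (simp add: u_def m_assoc)
    have "(\<rho> g * \<rho> h) $$ (i, k) = (\<Sum>j<n. f (y i \<otimes> g \<otimes> inv (y j)) * f (y j \<otimes> u))"
      using ik yu by (auto simp: \<rho>_def scalar_prod_def atLeast0LessThan intro!: sum.cong)
    also have "\<dots> = (\<Sum>j<n. if j = l then f (y i \<otimes> g \<otimes> inv (y j)) * f (y j \<otimes> u) else 0)"
    proof (rule sum.cong[OF refl])
      fix j assume "j \<in> {..<n}"
      then have "j = l \<or> y j \<otimes> u \<notin> H" using l_unique inv_mem by blast
      then show "f (y i \<otimes> g \<otimes> inv (y j)) * f (y j \<otimes> u)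
        = (if j = l then f (y i \<otimes> g \<otimes> inv (y j)) * f (y j \<otimes> u) else 0)"
        by (auto simp: f_def)
    qed
    also have "\<dots> = f (y i \<otimes> g \<otimes> inv (y l)) * f (y l \<otimes> u)" using l by simp
    also have "\<dots> = f (y i \<otimes> g \<otimes> u)"
    proof -
      have "y l \<otimes> u \<in> H" using l inv_mem by blast
      moreover have "y i \<otimes> g \<otimes> inv (y l) \<in> carrier G" using yi gh y l by simp
      ultimately show ?thesis
        using f_mult(1)[of "y i \<otimes> g \<otimes> inv (y l)" "y l \<otimes> u"] entry(2)[OF l(1)] by (simp add: f_def)
    qed
    finally show "\<rho> (g \<otimes> h) $$ (i, k) = (\<rho> g * \<rho> h) $$ (i, k)"
      using ik yi gh by (simp add: \<rho>_def u_def m_assoc)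
  qed (auto simp: \<rho>_def)
  have rho_one: "\<rho> \<one> = 1\<^sub>m n"
  proof (rule eq_matI)
    fix i j assume "i < dim_row (1\<^sub>m n)" "j < dim_col (1\<^sub>m n)"
    then have ij: "i < n" "j < n" by auto
    have "y i \<otimes> inv (y j) \<in> H \<longleftrightarrow> i = j"
      using y_unique[OF y[OF ij(1)]] ij r_inv[OF y[OF ij(1)]] subgroup.one_closed[OF H] by metis
    then show "\<rho> \<one> $$ (i, j) = 1\<^sub>m n $$ (i, j)"
      using ij y one by (auto simp: \<rho>_def f_def)
  qed (auto simp: \<rho>_def)
  have rep: "matrix_rep G n \<rho>"
    using is_group rho_mult rho_one by (intro matrix_repI) (auto simp: \<rho>_def)
  have trace: "mat_trace (\<rho> g) = induced G H \<psi> g" if g: "g \<in> carrier G" for g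
  proof -
    \<comment> \<open>Each group element is \<open>inv (y i) \<otimes> h\<close> for exactly one
      pair, and the factor \<open>h\<close> does not affect the summand. The average over the group
      in \<open>induced\<close> thus becomes a sum over representatives, which is the trace.\<close>
    have bij: "bij_betw (\<lambda>(h, i). inv (y i) \<otimes> h) (H \<times> {..<n}) (carrier G)"
    proof (rule bij_betw_imageI)
      have inv_yh: "inv (inv (y i) \<otimes> h) \<otimes> inv (y i) \<in> H" if hi: "h \<in> H" "i < n" for h i
      proof -
        have "h \<in> carrier G" "y i \<in> carrier G" using hi y HG by auto
        then have "inv (inv (y i) \<otimes> h) \<otimes> inv (y i) = inv h" by (simp add: inv_mult_group m_assoc)
        then show ?thesis using subgroup.m_inv_closed[OF H hi(1)] by simp
      qed
      show "inj_on (\<lambda>(h, i). inv (y i) \<otimes> h) (H \<times> {..<n})"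
      proof (rule inj_onI, clarify)
        fix h i h' j assume hi: "h \<in> H" "i < n" and hj: "h' \<in> H" "j < n"
          and eq: "inv (y i) \<otimes> h = inv (y j) \<otimes> h'"
        have carr: "h \<in> carrier G" "h' \<in> carrier G" "y i \<in> carrier G" using hi hj y HG by auto
        then have "inv (inv (y i) \<otimes> h) \<in> carrier G" by simp
        from y_unique[OF this] have "i = j"
          using inv_yh[OF hi] inv_yh[OF hj, folded eq] hi hj by blast
        then show "h = h' \<and> i = j" using eq carr by (auto simp: Units_eq Units_l_cancel)
      qed
      show "(\<lambda>(h, i). inv (y i) \<otimes> h) ` (H \<times> {..<n}) = carrier G"
      proof (intro subset_antisym subsetI)
        fix x assume x: "x \<in> carrier G"
        then obtain i where i: "i < n" "inv x \<otimes> inv (y i) \<in> H" using y_unique[of "inv x"] by auto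
        have yi: "y i \<in> carrier G" using y i(1) by blast
        have "y i \<otimes> x = inv (inv x \<otimes> inv (y i))" using x yi by (simp add: inv_mult_group)
        then have "y i \<otimes> x \<in> H" using subgroup.m_inv_closed[OF H i(2)] by simp
        moreover have "x = inv (y i) \<otimes> (y i \<otimes> x)" using x yi by (simp add: m_assoc[symmetric])
        ultimately show "x \<in> (\<lambda>(h, i). inv (y i) \<otimes> h) ` (H \<times> {..<n})"
          using i(1) by force
      qed (use y HG in auto)
    qed
    have summand: "f (inv (inv (y i) \<otimes> h) \<otimes> g \<otimes> (inv (y i) \<otimes> h)) = f (y i \<otimes> g \<otimes> inv (y i))"
      if "h \<in> H" "i < n" for h i
    proof -
      have yi: "y i \<in> carrier G" using y that by blast
      have hi: "inv h \<in> H" using that subgroup.m_inv_closed[OF H] by blast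
      have "inv (inv (y i) \<otimes> h) \<otimes> g \<otimes> (inv (y i) \<otimes> h) = inv h \<otimes> ((y i \<otimes> g \<otimes> inv (y i)) \<otimes> h)"
        using yi g HG[OF that(1)] by (simp add: inv_mult_group m_assoc)
      then have "f (inv (inv (y i) \<otimes> h) \<otimes> g \<otimes> (inv (y i) \<otimes> h)) = \<psi> (inv h) * (f (y i \<otimes> g \<otimes> inv (y
          i)) * \<psi> h)"
        using f_mult yi g that hi HG by simp
      moreover have "\<psi> (inv h) * \<psi> h = 1" using mult[OF hi that(1)] one HG[OF that(1)] by simp
      ultimately show ?thesis by (simp add: mult_ac)
    qed
    have "induced G H \<psi> g = (\<Sum>x\<in>carrier G. f (inv x \<otimes> g \<otimes> x)) / of_nat (card H)"
      using g fin by (simp add: induced_def f_def sum.If_cases Int_def)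
    also have "(\<Sum>x\<in>carrier G. f (inv x \<otimes> g \<otimes> x)) = (\<Sum>(h, i)\<in>H \<times> {..<n}. f (y i \<otimes> g \<otimes> inv (y i)))"
      by (subst sum.reindex_bij_betw[OF bij, symmetric]) (use summand in \<open>auto intro!: sum.cong\<close>)
    also have "\<dots> = of_nat (card H) * (\<Sum>i<n. f (y i \<otimes> g \<otimes> inv (y i)))"
      by (simp add: sum.cartesian_product[symmetric])
    also have "\<dots> / of_nat (card H) = (\<Sum>i<n. f (y i \<otimes> g \<otimes> inv (y i)))"
      using finH subgroup.one_closed[OF H] by (auto simp: card_eq_0_iff)
    also have "\<dots> = mat_trace (\<rho> g)" by (simp add: mat_trace_def \<rho>_def)
    finally show ?thesis by simp
  qed
  then have "character G \<rho> = induced G H \<psi>"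
    by (auto simp: character_def induced_def)
  then show ?thesis using rep by blast
qed

section \<open>Linear characters as multiplicative functions\<close>

lemma linear_characterD:
  assumes "group H" "linear_character H \<psi>"
  shows "\<psi> \<in> extensional (carrier H)" "\<psi> \<one>\<^bsub>H\<^esub> = 1"
    and "x \<in> carrier H \<Longrightarrow> y \<in> carrier H \<Longrightarrow> \<psi> (x \<otimes>\<^bsub>H\<^esub> y) = \<psi> x * \<psi> y"
proof -
  interpret group H by fact
  obtain n \<rho> where \<psi>: "\<psi> = character H \<rho>" "irreducible_rep H n \<rho>" "\<psi> \<one>\<^bsub>H\<^esub> = 1"
    using assms(2) unfolding linear_character_def Irr_def by auto
  then have rep: "matrix_rep H n \<rho>" by (simp add: irreducible_rep_def)
  note repD = matrix_repD[OF assms(1) rep]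
  \<comment> \<open>The value at the identity is the trace of an identity matrix, that is, the
    degree; for 1 by 1 matrices the trace is multiplicative.\<close>
  have "of_nat n = (1 :: complex)"
    using \<psi>(3) repD(3) by (simp add: \<psi>(1) character_def mat_trace_def)
  then have n: "n = 1" by (metis of_nat_1 of_nat_eq_iff)
  show "\<psi> \<in> extensional (carrier H)" "\<psi> \<one>\<^bsub>H\<^esub> = 1" using \<psi> by (auto simp: character_def)
  assume xy: "x \<in> carrier H" "y \<in> carrier H"
  then show "\<psi> (x \<otimes>\<^bsub>H\<^esub> y) = \<psi> x * \<psi> y"
    using repD(1)[OF xy(1)] repD(1)[OF xy(2)]
    by (simp add: \<psi>(1) character_def mat_trace_def repD(2) n scalar_prod_def)
qed

lemma linear_character_pow:
  assumes "group H" "linear_character H \<psi>" "x \<in> carrier H"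
  shows "\<psi> (x [^]\<^bsub>H\<^esub> (k :: nat)) = \<psi> x ^ k"
proof -
  interpret group H by fact
  show ?thesis
    by (induction k) (simp_all add: linear_characterD[OF assms(1,2)] assms(3) mult.commute)
qed

lemma linear_character_inv:
  assumes "group H" "linear_character H \<psi>" "x \<in> carrier H"
  shows "\<psi> (inv\<^bsub>H\<^esub> x) * \<psi> x = 1" "\<psi> x \<noteq> 0"
proof -
  interpret group H by fact
  show "\<psi> (inv\<^bsub>H\<^esub> x) * \<psi> x = 1"
    using linear_characterD(3)[OF assms(1,2), of "inv\<^bsub>H\<^esub> x" x] linear_characterD(2)[OF assms(1,2)]
        assms(3)
    by simp
  then show "\<psi> x \<noteq> 0" by auto
qed

lemma linear_characterI:
  assumes "group H" "finite (carrier H)" "\<psi> \<in> extensional (carrier H)" "\<psi> \<one>\<^bsub>H\<^esub> = 1"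
    and "\<And>x y. x \<in> carrier H \<Longrightarrow> y \<in> carrier H \<Longrightarrow> \<psi> (x \<otimes>\<^bsub>H\<^esub> y) = \<psi> x * \<psi> y"
  shows "linear_character H \<psi>"
proof -
  interpret group H by fact
  define \<rho> where "\<rho> x = mat 1 1 (\<lambda>_. \<psi> x)" for x
  have "matrix_rep H 1 \<rho>"
    using assms(1,4,5) by (intro matrix_repI) (auto simp: \<rho>_def scalar_prod_def intro!: eq_matI)
  \<comment> \<open>The criterion is applied with the whole group in place of \<open>Z\<close>: the
    index is 1 = 1 * 1 and the vanishing condition is void.\<close>
  then have "irreducible_rep H 1 \<rho>"
    using subgroup_self assms(2)
    by (intro irreducible_rep_if_vanishing[of 1 \<rho> "carrier H"]) (auto simp: Coset.order_def)
  moreover have "\<psi> = character H \<rho>"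
    using assms(3) by (auto simp: character_def \<rho>_def mat_trace_def extensional_def)
  ultimately show ?thesis using assms(4) unfolding linear_character_def Irr_def by blast
qed

lemma complex_eigenvalue_exists:
  fixes A :: "complex mat"
  assumes A: "A \<in> carrier_mat n n" and "n > 0"
  obtains k v where "v \<in> carrier_vec n" "v \<noteq> 0\<^sub>v n" "A *\<^sub>v v = k \<cdot>\<^sub>v v"
proof -
  have "degree (char_poly A) \<noteq> 0" using degree_monic_char_poly[OF A] \<open>n > 0\<close> by simp
  then have "\<not> constant (poly (char_poly A))" by (simp add: constant_degree)
  then obtain k where "poly (char_poly A) k = 0"
    using fundamental_theorem_of_algebra by blast
  then have "eigenvalue A k" using eigenvalue_root_char_poly[OF A] by simp
  then show ?thesis using that A unfolding eigenvalue_def eigenvector_def by auto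
qed

text \<open>Schur's lemma for commuting matrices: an eigenspace of \<open>\<rho> g\<close> is
  invariant under the group, hence everything, so each \<open>\<rho> g\<close> is scalar. Then every
  line is invariant and the dimension is 1.\<close>

lemma abelian_Irr_linear:
  assumes "group H" and comm: "\<And>x y. x \<in> carrier H \<Longrightarrow> y \<in> carrier H \<Longrightarrow> x \<otimes>\<^bsub>H\<^esub> y = y \<otimes>\<^bsub>H\<^esub> x"
    and "\<psi> \<in> Irr H"
  shows "linear_character H \<psi>"
proof -
  interpret group H by fact
  obtain n \<rho> where \<psi>: "\<psi> = character H \<rho>" "irreducible_rep H n \<rho>"
    using assms(3) unfolding Irr_def by auto
  then have rep: "matrix_rep H n \<rho>" and n: "n > 0"
    and irr: "\<And>W. VectorSpace.subspace class_ring W (module_vec TYPE(complex) n) \<Longrightarrow>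
      (\<And>g w. g \<in> carrier H \<Longrightarrow> w \<in> W \<Longrightarrow> \<rho> g *\<^sub>v w \<in> W) \<Longrightarrow> W \<noteq> {0\<^sub>v n} \<Longrightarrow> W = carrier_vec n"
    unfolding irreducible_rep_def by blast+
  note repD = matrix_repD[OF assms(1) rep]
  have scalar: "\<exists>k. \<forall>w\<in>carrier_vec n. \<rho> g *\<^sub>v w = k \<cdot>\<^sub>v w" if g: "g \<in> carrier H" for g
  proof -
    obtain k v where v: "v \<in> carrier_vec n" "v \<noteq> 0\<^sub>v n" "\<rho> g *\<^sub>v v = k \<cdot>\<^sub>v v"
      using complex_eigenvalue_exists[OF repD(1)[OF g] n] by blast
    define W where "W = {w \<in> carrier_vec n. \<rho> g *\<^sub>v w = k \<cdot>\<^sub>v w}"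
    have "VectorSpace.subspace class_ring W (module_vec TYPE(complex) n)"
      using repD(1)[OF g]
      by (intro subspace_vecI)
        (auto simp: W_def mult_add_distrib_mat_vec smult_add_distrib_vec mult_mat_vec
            smult_smult_assoc mult.commute)
    moreover have "\<rho> h *\<^sub>v w \<in> W" if h: "h \<in> carrier H" and w: "w \<in> W" for h w
    proof -
      have wc: "w \<in> carrier_vec n" "\<rho> g *\<^sub>v w = k \<cdot>\<^sub>v w" using w by (auto simp: W_def)
      have "\<rho> g *\<^sub>v (\<rho> h *\<^sub>v w) = \<rho> (g \<otimes>\<^bsub>H\<^esub> h) *\<^sub>v w"
        using repD(1)[OF g] repD(1)[OF h] wc(1) by (simp add: repD(2)[OF g h])
      also have "\<dots> = \<rho> h *\<^sub>v (\<rho> g *\<^sub>v w)"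
        using repD(1)[OF g] repD(1)[OF h] wc(1) by (simp add: comm[OF g h] repD(2)[OF h g])
      also have "\<dots> = k \<cdot>\<^sub>v (\<rho> h *\<^sub>v w)"
        using repD(1)[OF h] wc by (simp add: mult_mat_vec)
      finally show ?thesis using repD(1)[OF h] wc(1) by (simp add: W_def)
    qed
    moreover have "W \<noteq> {0\<^sub>v n}" using v by (auto simp: W_def)
    ultimately have "W = carrier_vec n" by (rule irr)
    then show ?thesis by (auto simp: W_def)
  qed
  \<comment> \<open>The line through the first unit vector. Scalars preserve it, so irreducibility
    makes it the whole space, which leaves no room for a second unit vector.\<close>
  define L where "L = {c \<cdot>\<^sub>v unit_vec n 0 | c :: complex. True}"
  have "VectorSpace.subspace class_ring L (module_vec TYPE(complex) n)"
  proof (rule subspace_vecI)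
    show "0\<^sub>v n \<in> L" unfolding L_def by (auto intro!: exI[of _ 0])
    show "v + w \<in> L" if "v \<in> L" "w \<in> L" for v w
      using that unfolding L_def by (auto simp flip: add_smult_distrib_vec)
    show "c \<cdot>\<^sub>v v \<in> L" if "v \<in> L" for c v
      using that unfolding L_def by (auto simp: smult_smult_assoc)
  qed (auto simp: L_def)
  moreover have "\<rho> g *\<^sub>v w \<in> L" if g: "g \<in> carrier H" and w: "w \<in> L" for g w
  proof -
    obtain k where "\<forall>w\<in>carrier_vec n. \<rho> g *\<^sub>v w = k \<cdot>\<^sub>v w" using scalar[OF g] by blast
    then show ?thesis using w unfolding L_def by (auto simp: smult_smult_assoc)
  qed
  moreover have "L \<noteq> {0\<^sub>v n}"
  proof -
    have "unit_vec n 0 \<in> L" unfolding L_def by (auto intro!: exI[of _ 1])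
    moreover have "unit_vec n 0 \<noteq> (0\<^sub>v n :: complex vec)" using n by simp
    ultimately show ?thesis by blast
  qed
  ultimately have L: "L = carrier_vec n" by (rule irr)
  have "n = 1"
  proof (rule ccontr)
    assume "n \<noteq> 1"
    then have "1 < n" using n by simp
    have "unit_vec n 1 \<in> L" unfolding L by simp
    then obtain c where "unit_vec n 1 = c \<cdot>\<^sub>v (unit_vec n 0 :: complex vec)" unfolding L_def by blast
    then have "unit_vec n 1 $ 1 = (c \<cdot>\<^sub>v unit_vec n 0) $ (1 :: nat)" by (rule arg_cong)
    then show False using \<open>1 < n\<close> by simp
  qed
  then have "\<psi> \<one>\<^bsub>H\<^esub> = 1" using repD(3) by (simp add: \<psi>(1) character_def mat_trace_def)
  then show ?thesis using assms(3) by (simp add: linear_character_def)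
qed

section \<open>Characters that vanish off the centre\<close>

lemma center_commute: "z \<in> center G \<Longrightarrow> x \<in> carrier G \<Longrightarrow> z \<otimes>\<^bsub>G\<^esub> x = x \<otimes>\<^bsub>G\<^esub> z"
  unfolding center_def by blast

lemma center_carrier: "z \<in> center G \<Longrightarrow> z \<in> carrier G"
  unfolding center_def by blast

lemma centerI:
  "z \<in> carrier G \<Longrightarrow> (\<And>x. x \<in> carrier G \<Longrightarrow> z \<otimes>\<^bsub>G\<^esub> x = x \<otimes>\<^bsub>G\<^esub> z) \<Longrightarrow> z \<in> center G"
  unfolding center_def by blast

lemma (in group) center_subgroup: "subgroup (center G) G"
proof (rule subgroupI)
  show "center G \<subseteq> carrier G" by (auto dest: center_carrier)
  have "\<one> \<in> center G" by (rule centerI) simp_all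
  then show "center G \<noteq> {}" by blast
  fix a assume a: "a \<in> center G"
  note aG = center_carrier[OF a]
  show "inv a \<in> center G"
  proof (rule centerI)
    fix x assume x: "x \<in> carrier G"
    have "inv a \<otimes> x = inv a \<otimes> (x \<otimes> a) \<otimes> inv a" using aG x by (simp add: m_assoc)
    also have "\<dots> = x \<otimes> inv a"
      unfolding center_commute[OF a x, symmetric] using aG x by (simp add: m_assoc[symmetric])
    finally show "inv a \<otimes> x = x \<otimes> inv a" .
  qed (use aG in simp)
  fix b assume b: "b \<in> center G"
  note bG = center_carrier[OF b]
  show "a \<otimes> b \<in> center G"
  proof (rule centerI)
    fix x assume x: "x \<in> carrier G"
    have "a \<otimes> b \<otimes> x = a \<otimes> (x \<otimes> b)" using aG bG x by (simp add: m_assoc center_commute[OF b x])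
    also have "\<dots> = x \<otimes> (a \<otimes> b)"
      using aG bG x by (simp add: m_assoc[symmetric] center_commute[OF a x])
    finally show "a \<otimes> b \<otimes> x = x \<otimes> (a \<otimes> b)" .
  qed (use aG bG in simp)
qed

section \<open>Fields of character values\<close>

lemma class_ring_inverse:
  fixes x :: complex
  assumes "x \<noteq> 0"
  shows "inv\<^bsub>class_ring\<^esub> x = inverse x"
  unfolding m_inv_def
  by (rule the1_equality, rule ex1I[of _ "inverse x"]) (use assms in \<open>auto simp: field_simps\<close>)

text \<open>Applied to 1, this puts 0 (for \<open>n = 0\<close>) and p^2 into every generated field;
  these are the two constants that occur in \<open>chi_mu\<close>.\<close>

lemma generate_field_of_nat_mult:
  assumes "x \<in> generate_field (class_ring :: complex ring) S"
  shows "of_nat n * x \<in> generate_field class_ring S"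
proof (induction n)
  case 0
  have "x + (- x) \<in> generate_field class_ring S"
    using generate_field.eng_add[OF assms generate_field.a_inv[OF assms]]
    by (simp add: class_ring_simps)
  then show ?case by simp
next
  case (Suc n)
  then show ?case
    using generate_field.eng_add[OF assms Suc.IH] by (simp add: algebra_simps)
qed

lemma generate_field_cong:
  assumes "S \<subseteq> generate_field (class_ring :: complex ring) T"
    and "T \<subseteq> generate_field (class_ring :: complex ring) S"
  shows "generate_field (class_ring :: complex ring) S = generate_field class_ring T"
  using assms[THEN field.generate_field_min_subfield1[OF class_field _
      field.generate_field_is_subfield[OF class_field], rotated -1]]
  by simp

text \<open>The uniqueness half of \<open>required_pair_by_values\<close>.\<close>

lemma (in group) linear_character_eq_on_generate:
  assumes "subgroup H G" and \<phi>: "linear_character (G\<lparr>carrier := H\<rparr>) \<phi>"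
      and \<psi>: "linear_character (G\<lparr>carrier := H\<rparr>) \<psi>"
    and H: "H = generate G S" and eq: "\<And>x. x \<in> S \<Longrightarrow> \<phi> x = \<psi> x"
  shows "\<phi> = \<psi>"
proof -
  have grp: "group (G\<lparr>carrier := H\<rparr>)" using assms(1) by (rule subgroup_imp_group)
  note D = linear_characterD[OF grp, simplified]
  have "\<phi> x = \<psi> x" if "x \<in> H" for x
    using that unfolding H
  proof (induction rule: generate.induct)
    case one
    then show ?case using D(2)[OF \<phi>] D(2)[OF \<psi>] by simp
  next
    case (inv h)
    have h: "h \<in> H" unfolding H using inv generate.incl by metis
    have "\<phi> (inv h) * \<phi> h = 1" "\<psi> (inv h) * \<psi> h = 1" "\<psi> h \<noteq> 0"
      using linear_character_inv[OF grp \<phi>, of h] linear_character_inv[OF grp \<psi>, of h] h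
        m_inv_consistent[OF assms(1) h] by simp_all
    then show ?case using eq[OF inv] by (metis mult_right_cancel)
  next
    case (eng h1 h2)
    then show ?case using D(3)[OF \<phi>, of h1 h2] D(3)[OF \<psi>, of h1 h2] by (simp add: H)
  qed (use eq in auto)
  then show ?thesis using D(1)[OF \<phi>] D(1)[OF \<psi>] by (intro extensionalityI[of _ H]) auto
qed

text \<open>Condition \<open>pairing\<close> forces characters induced from \<open>H\<close> with nontrivial central character
  to vanish off the centre; the complement \<open>N\<close> of the centre in \<open>H\<close> extends central characters.\<close>

locale polarization = group G for G (structure) +
  fixes p :: nat and H N :: "'a set"
  assumes prime_p: "Factorial_Ring.prime p"
    and order_G: "Coset.order G = p ^ 5"
    and card_center: "card (center G) = p"
    and subgroup_H: "subgroup H G"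
    and H_commute: "\<And>x y. x \<in> H \<Longrightarrow> y \<in> H \<Longrightarrow> x \<otimes> y = y \<otimes> x"
    and center_subset: "center G \<subseteq> H"
    and card_H: "card H = p ^ 3"
    and subgroup_N: "subgroup N G"
    and N_subset: "N \<subseteq> H"
    and N_Int_center: "N \<inter> center G = {\<one>}"
    and H_factor: "\<And>h. h \<in> H \<Longrightarrow> \<exists>n\<in>N. \<exists>z\<in>center G. h = n \<otimes> z"
    and pairing: "\<And>h. h \<in> H \<Longrightarrow> h \<notin> center G \<Longrightarrow>
      \<exists>y\<in>carrier G. \<exists>z\<in>center G. z \<noteq> \<one> \<and> h \<otimes> y = y \<otimes> h \<otimes> z"
begin

abbreviation H_group where "H_group \<equiv> G\<lparr>carrier := H\<rparr>"
abbreviation Z_group where "Z_group \<equiv> G\<lparr>carrier := center G\<rparr>"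

lemma p_gt_1: "p > 1" using prime_p prime_gt_1_nat by blast

lemma finite_G: "finite (carrier G)"
  using order_G p_gt_1 by (intro order_gt_0_iff_finite[THEN iffD1]) simp

lemma group_H: "group H_group" using subgroup_H by (rule subgroup_imp_group)
lemma group_Z: "group Z_group" using center_subgroup by (rule subgroup_imp_group)

lemma H_carrier: "h \<in> H \<Longrightarrow> h \<in> carrier G" using subgroup.mem_carrier[OF subgroup_H] .

lemma finite_H: "finite H" using finite_G subgroup.subset[OF subgroup_H] finite_subset by blast

end

section \<open>Characters induced from a polarization\<close>

locale polarization_character = polarization +
  fixes \<mu> :: "'a \<Rightarrow> complex"
  assumes mu_Irr: "\<mu> \<in> Irr Z_group" and mu_nontrivial: "\<mu> \<noteq> (\<lambda>z \<in> center G. 1)"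
begin

lemma linear_mu: "linear_character Z_group \<mu>"
proof (rule abelian_Irr_linear[OF group_Z _ mu_Irr])
  fix x y assume "x \<in> carrier Z_group" "y \<in> carrier Z_group"
  then show "x \<otimes>\<^bsub>Z_group\<^esub> y = y \<otimes>\<^bsub>Z_group\<^esub> x"
    using center_commute[of x G y] center_carrier[of y G] by simp
qed

lemmas mu = linear_characterD[OF group_Z linear_mu, simplified]

text \<open>The kernel of \<mu> is a subgroup of a group of prime order, and it is proper because
  \<mu> is nontrivial.\<close>

lemma mu_eq_1_iff:
  assumes "z \<in> center G"
  shows "\<mu> z = 1 \<longleftrightarrow> z = \<one>"
proof
  define K where "K = {z \<in> center G. \<mu> z = 1}"
  interpret Z: group Z_group by (rule group_Z)
  have "subgroup K Z_group"
  proof (rule Z.subgroupI)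
    show "K \<noteq> {}" using mu(2) subgroup.one_closed[OF center_subgroup] by (auto simp: K_def)
    show "inv\<^bsub>Z_group\<^esub> a \<in> K" if "a \<in> K" for a
      using that linear_character_inv[OF group_Z linear_mu, of a] Z.inv_closed[of a]
      by (auto simp: K_def)
    show "a \<otimes>\<^bsub>Z_group\<^esub> b \<in> K" if "a \<in> K" "b \<in> K" for a b
      using that mu(3) subgroup.m_closed[OF center_subgroup] by (auto simp: K_def)
  qed (auto simp: K_def)
  then have "card K dvd p"
    using Z.lagrange[of K] card_center by (auto simp: Coset.order_def dvd_def mult.commute)
  then consider "card K = 1" | "card K = p" using prime_p prime_nat_iff by blast
  then have "K = {\<one>}"
  proof cases
    case 1
    moreover have "\<one> \<in> K" using mu(2) subgroup.one_closed[OF center_subgroup] by (simp add: K_def)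
    ultimately show ?thesis by (metis card_1_singletonE singletonD)
  next
    case 2
    have "finite (center G)" using card_center p_gt_1 card.infinite by fastforce
    then have "K = center G" using 2 card_center by (intro card_subset_eq) (auto simp: K_def)
    then have "\<mu> = (\<lambda>z \<in> center G. 1)"
      by (intro extensionalityI[OF mu(1)]) (auto simp: K_def)
    then show ?thesis using mu_nontrivial by blast
  qed
  then show "\<mu> z = 1 \<Longrightarrow> z = \<one>" using assms by (auto simp: K_def)
  show "z = \<one> \<Longrightarrow> \<mu> z = 1" using mu(2) by simp
qed

text \<open>\<open>F\<close> is the unnormalised induced character. It is invariant under
  conjugation and is multiplied by \<open>\<mu> z\<close> under translation by a central
  \<open>z\<close>. For noncentral \<open>h\<close> in \<open>H\<close>, \<open>pairing\<close>
  makes \<open>h\<close> conjugate to \<open>h \<otimes> z\<close>, so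
  \<open>F h = \<mu> z * F h\<close> with \<open>\<mu> z \<noteq> 1\<close>. At a central element
  all p^5 summands agree, and dividing by p^3 leaves the factor p^2.\<close>

lemma induced_eq_chi_mu:
  assumes \<psi>: "linear_character H_group \<psi>" and ext: "\<And>z. z \<in> center G \<Longrightarrow> \<psi> z = \<mu> z"
  shows "induced G H \<psi> = chi_mu p G \<mu>"
proof -
  note \<psi>D = linear_characterD[OF group_H \<psi>, simplified]
  define f where "f x = (if x \<in> H then \<psi> x else 0)" for x
  define F where "F g = (\<Sum>x\<in>carrier G. f (inv x \<otimes> g \<otimes> x))" for g
  have ind: "induced G H \<psi> g = F g / of_nat (card H)" if "g \<in> carrier G" for g
    using that finite_G by (simp add: induced_def f_def F_def sum.If_cases Int_def)
  have F_conj: "F (inv y \<otimes> g \<otimes> y) = F g" if "g \<in> carrier G" "y \<in> carrier G" for g y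
  proof -
    have bij: "bij_betw ((\<otimes>) y) (carrier G) (carrier G)"
      using that(2) by (intro bij_betw_byWitness[where f' = "(\<otimes>) (inv y)"])
        (auto simp: m_assoc[symmetric])
    have "F (inv y \<otimes> g \<otimes> y) = (\<Sum>x\<in>carrier G. f (inv (y \<otimes> x) \<otimes> g \<otimes> (y \<otimes> x)))"
      unfolding F_def using that by (intro sum.cong) (auto simp: inv_mult_group m_assoc)
    also have "\<dots> = F g" unfolding F_def by (rule sum.reindex_bij_betw[OF bij])
    finally show ?thesis .
  qed
  have F_center: "F (g \<otimes> z) = \<mu> z * F g" if g: "g \<in> carrier G" and z: "z \<in> center G" for g z
  proof -
    have "f (inv x \<otimes> (g \<otimes> z) \<otimes> x) = \<mu> z * f (inv x \<otimes> g \<otimes> x)" if x: "x \<in> carrier G" for x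
    proof -
      define u where "u = inv x \<otimes> g \<otimes> x"
      have u: "u \<in> carrier G" using g x by (simp add: u_def)
      have zG: "z \<in> carrier G" using z by (rule center_carrier)
      have "inv x \<otimes> (g \<otimes> z) \<otimes> x = inv x \<otimes> g \<otimes> (z \<otimes> x)" using g x zG by (simp add: m_assoc)
      also have "\<dots> = u \<otimes> z" using g x zG by (simp add: u_def center_commute[OF z x] m_assoc)
      finally have *: "inv x \<otimes> (g \<otimes> z) \<otimes> x = u \<otimes> z" .
      have zH: "z \<in> H" "inv z \<in> H" using z center_subset subgroup.m_inv_closed[OF subgroup_H] by auto
      have "u = u \<otimes> z \<otimes> inv z" using u zG by (simp add: m_assoc)
      then have "u \<otimes> z \<in> H \<longleftrightarrow> u \<in> H" using zH subgroup.m_closed[OF subgroup_H] by metis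
      then show ?thesis unfolding * u_def[symmetric]
        using \<psi>D(3)[of u z] ext[OF z] zH by (simp add: f_def)
    qed
    then show ?thesis by (simp add: F_def sum_distrib_left)
  qed
  have "F g = 0" if g: "g \<in> carrier G" "g \<notin> center G" for g
  proof (rule ccontr)
    assume "F g \<noteq> 0"
    \<comment> \<open>A nonzero sum has a nonzero term, so some conjugate \<open>h\<close> of
      \<open>g\<close> lies in \<open>H\<close>, and it is as noncentral as
      \<open>g\<close>.\<close>
    then obtain x where x: "x \<in> carrier G" "f (inv x \<otimes> g \<otimes> x) \<noteq> 0"
      unfolding F_def by (meson sum.neutral)
    define h where "h = inv x \<otimes> g \<otimes> x"
    have h: "h \<in> H" using x(2) by (auto simp: f_def h_def split: if_splits)
    then have hG: "h \<in> carrier G" using H_carrier by blast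
    have "h \<notin> center G"
    proof
      assume "h \<in> center G"
      then have "x \<otimes> h \<otimes> inv x = h"
        using x(1) hG by (simp add: center_commute[of h G x, symmetric] m_assoc)
      moreover have "x \<otimes> h \<otimes> inv x = g"
        using x(1) g(1) by (simp add: h_def m_assoc[symmetric], simp add: m_assoc)
      ultimately show False using \<open>h \<in> center G\<close> g(2) by simp
    qed
    then obtain y z where y: "y \<in> carrier G" and z: "z \<in> center G" "z \<noteq> \<one>" "h \<otimes> y = y \<otimes> h \<otimes> z"
      using pairing[OF h] by blast
    have "inv y \<otimes> h \<otimes> y = inv y \<otimes> (y \<otimes> h \<otimes> z)"
      unfolding z(3)[symmetric] using y hG by (simp add: m_assoc)
    also have "\<dots> = h \<otimes> z" using y hG center_carrier[OF z(1)] by (simp add: m_assoc[symmetric])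
    finally have "inv y \<otimes> h \<otimes> y = h \<otimes> z" .
    then have "F h = \<mu> z * F h" using F_conj[OF hG y] F_center[OF hG z(1)] by simp
    moreover have "F h = F g" unfolding h_def using F_conj g x(1) by blast
    ultimately have "\<mu> z = 1" using \<open>F g \<noteq> 0\<close> by simp
    then show False using mu_eq_1_iff z by blast
  qed
  moreover have "F g / of_nat (card H) = of_nat (p ^ 2) * \<mu> g" if g: "g \<in> center G" for g
  proof -
    have "f (inv x \<otimes> g \<otimes> x) = \<mu> g" if x: "x \<in> carrier G" for x
    proof -
      have "inv x \<otimes> g \<otimes> x = inv x \<otimes> (g \<otimes> x)" using x center_carrier[OF g] by (simp add: m_assoc)
      also have "\<dots> = g" using x center_carrier[OF g]
          by (simp add: center_commute[OF g x] m_assoc[symmetric])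
      finally show ?thesis using ext[OF g] g center_subset by (auto simp: f_def)
    qed
    then have "F g = of_nat (p ^ 5) * \<mu> g"
      using order_G by (simp add: F_def Coset.order_def)
    then show ?thesis using p_gt_1 by (simp add: card_H power_eq_if field_simps)
  qed
  ultimately show ?thesis
    using ind by (auto simp: chi_mu_def fun_eq_iff center_carrier) (simp_all add: induced_def)
qed

text \<open>\<open>H\<close> is the internal direct product of \<open>N\<close> and the centre, so
  \<mu> composed with the projection to the centre is multiplicative and takes no new
  values.\<close>

lemma extension_exists:
  "\<exists>\<psi>. linear_character H_group \<psi> \<and> (\<forall>z\<in>center G. \<psi> z = \<mu> z) \<and> (\<forall>n\<in>N. \<psi> n = 1) \<and>
    \<psi> ` H \<subseteq> \<mu> ` center G"
proof -
  obtain nn zz where nz: "\<And>h. h \<in> H \<Longrightarrow> nn h \<in> N \<and> zz h \<in> center G \<and> h = nn h \<otimes> zz h"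
    using H_factor by metis
  note NG = subgroup.mem_carrier[OF subgroup_N]
  \<comment> \<open>Comparing two factorisations gives an element common to \<open>N\<close> and the
    centre, hence the identity.\<close>
  have unique: "z = z'" if "n \<in> N" "n' \<in> N" "z \<in> center G" "z' \<in> center G"
      "n \<otimes> z = n' \<otimes> z'" for n n' z z'
  proof -
    have c: "n \<in> carrier G" "n' \<in> carrier G" "z \<in> carrier G" "z' \<in> carrier G"
      using that NG center_carrier by auto
    have "inv n' \<otimes> n = inv n' \<otimes> (n \<otimes> z) \<otimes> inv z" using c by (simp add: m_assoc)
    also have "\<dots> = z' \<otimes> inv z" unfolding that(5) using c by (simp add: m_assoc[symmetric])
    finally have *: "inv n' \<otimes> n = z' \<otimes> inv z" .
    have "inv n' \<otimes> n \<in> N"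
        using that subgroup.m_closed[OF subgroup_N] subgroup.m_inv_closed[OF subgroup_N] by blast
    moreover have "z' \<otimes> inv z \<in> center G"
      using that subgroup.m_closed[OF center_subgroup] subgroup.m_inv_closed[OF center_subgroup]
          by blast
    ultimately have "z' \<otimes> inv z = \<one>" using N_Int_center * by auto
    then show ?thesis using inv_equality[of z' "inv z"] c by simp
  qed
  define \<psi> where "\<psi> = (\<lambda>h\<in>H. \<mu> (zz h))"
  have val: "\<psi> (n \<otimes> z) = \<mu> z" if "n \<in> N" "z \<in> center G" for n z
  proof -
    have "n \<otimes> z \<in> H" using that N_subset center_subset subgroup.m_closed[OF subgroup_H] by blast
    moreover from this have "zz (n \<otimes> z) = z"
      using unique[of "nn (n \<otimes> z)" n "zz (n \<otimes> z)" z] nz[of "n \<otimes> z"] that by metis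
    ultimately show ?thesis by (simp add: \<psi>_def)
  qed
  have one: "\<one> \<in> N" "\<one> \<in> center G" using subgroup.one_closed subgroup_N center_subgroup by auto
  have "\<psi> z = \<mu> z" if "z \<in> center G" for z using val[OF one(1) that] center_carrier[OF that] by simp
  moreover have "\<psi> n = 1" if "n \<in> N" for n using val[OF that one(2)] NG[OF that] mu(2) by simp
  moreover have "\<psi> ` H \<subseteq> \<mu> ` center G" using nz by (auto simp: \<psi>_def)
  moreover have "linear_character H_group \<psi>"
  proof (rule linear_characterI[OF group_H])
    show "\<psi> \<one>\<^bsub>H_group\<^esub> = 1" using val[OF one] mu(2) by simp
    fix x y assume "x \<in> carrier H_group" "y \<in> carrier H_group"
    then have xy: "x \<in> H" "y \<in> H" by auto
    obtain n z m w where n: "n \<in> N" "m \<in> N" and z: "z \<in> center G" "w \<in> center G"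
      and eq: "x = n \<otimes> z" "y = m \<otimes> w" using nz[OF xy(1)] nz[OF xy(2)] by metis
    have c: "n \<in> carrier G" "m \<in> carrier G" "z \<in> carrier G" "w \<in> carrier G"
      using n z NG center_carrier by auto
    have "x \<otimes> y = n \<otimes> (z \<otimes> m) \<otimes> w" using c by (simp add: eq m_assoc)
    also have "\<dots> = (n \<otimes> m) \<otimes> (z \<otimes> w)" unfolding center_commute[OF z(1) c(2)] using c
        by (simp add: m_assoc)
    finally show "\<psi> (x \<otimes>\<^bsub>H_group\<^esub> y) = \<psi> x * \<psi> y"
      using val n z subgroup.m_closed[OF subgroup_N] subgroup.m_closed[OF center_subgroup] mu(3)
      by (simp add: eq)
  qed (auto simp: \<psi>_def finite_H)
  ultimately show ?thesis by blast
qed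

text \<open>The criterion for irreducibility applies with the centre as \<open>Z\<close>, because
  p^5 = p^2 * p^2 * p.\<close>

lemma chi_mu_Irr: "chi_mu p G \<mu> \<in> Irr G"
proof -
  obtain \<psi> where \<psi>: "linear_character H_group \<psi>" "\<And>z. z \<in> center G \<Longrightarrow> \<psi> z = \<mu> z"
    "\<And>n. n \<in> N \<Longrightarrow> \<psi> n = 1" "\<psi> ` H \<subseteq> \<mu> ` center G"
    using extension_exists by auto
  note \<psi>D = linear_characterD[OF group_H \<psi>(1), simplified]
  have "Coset.order G = p ^ 2 * card H" by (simp add: order_G card_H power_add[symmetric])
  then have "\<exists>\<rho>. matrix_rep G (p ^ 2) \<rho> \<and> character G \<rho> = induced G H \<psi>"
    by (rule induced_rep[OF finite_G subgroup_H _ \<psi>D(3) \<psi>D(2)])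
  moreover have "induced G H \<psi> = chi_mu p G \<mu>"
    by (rule induced_eq_chi_mu[OF \<psi>(1,2)])
  ultimately obtain \<rho> where \<rho>: "matrix_rep G (p ^ 2) \<rho>" "character G \<rho> = chi_mu p G \<mu>"
    by auto
  have "irreducible_rep G (p ^ 2) \<rho>"
  proof (rule irreducible_rep_if_vanishing[OF \<rho>(1) _ finite_G center_subgroup])
    show "Coset.order G = p ^ 2 * p ^ 2 * card (center G)"
      by (simp add: order_G card_center eval_nat_numeral)
    show "mat_trace (\<rho> g) = 0" if "g \<in> carrier G" "g \<notin> center G" for g
      using that fun_cong[OF \<rho>(2), of g] by (simp add: character_def chi_mu_def)
  qed (use p_gt_1 in simp)
  then show ?thesis unfolding Irr_def using \<rho>(2)[symmetric] by blast
qed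

lemma character_field_eq:
  assumes "\<psi> ` H \<subseteq> \<mu> ` center G" "\<And>z. z \<in> center G \<Longrightarrow> \<psi> z = \<mu> z"
  shows "character_field H_group \<psi> = character_field G (chi_mu p G \<mu>)"
proof -
  let ?K = "class_ring :: complex ring"
  have image: "\<psi> ` H = \<mu> ` center G"
    using assms center_subset by force
  have "generate_field ?K (\<mu> ` center G) = generate_field ?K (chi_mu p G \<mu> ` carrier G)"
  proof (rule generate_field_cong)
    show "chi_mu p G \<mu> ` carrier G \<subseteq> generate_field ?K (\<mu> ` center G)"
    proof clarify
      fix g assume "g \<in> carrier G"
      show "chi_mu p G \<mu> g \<in> generate_field ?K (\<mu> ` center G)"
      proof (cases "g \<in> center G")
        case True
        then have "\<mu> g \<in> generate_field ?K (\<mu> ` center G)" by (intro generate_field.incl) auto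
        from generate_field_of_nat_mult[OF this, of "p ^ 2"] show ?thesis
          using True \<open>g \<in> carrier G\<close> by (simp add: chi_mu_def)
      next
        case False
        have "(0 :: complex) \<in> generate_field ?K (\<mu> ` center G)"
          using generate_field_of_nat_mult[OF generate_field.one, of 0] by simp
        then show ?thesis using False \<open>g \<in> carrier G\<close> by (simp add: chi_mu_def)
      qed
    qed
    show "\<mu> ` center G \<subseteq> generate_field ?K (chi_mu p G \<mu> ` carrier G)"
    proof clarify
      fix z assume z: "z \<in> center G"
      have "chi_mu p G \<mu> z \<in> generate_field ?K (chi_mu p G \<mu> ` carrier G)"
        using center_carrier[OF z] by (intro generate_field.incl) auto
      moreover have "of_nat (p ^ 2) \<in> generate_field ?K (chi_mu p G \<mu> ` carrier G)"
        using generate_field_of_nat_mult[OF generate_field.one, of "p ^ 2"] by simp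
      \<comment> \<open>A value of \<mu> is recovered by dividing a value of \<open>chi_mu\<close>
        by p^2, which is possible inside the generated field.\<close>
      then have "inverse (of_nat (p ^ 2)) \<in> generate_field ?K (chi_mu p G \<mu> ` carrier G)"
        using generate_field.m_inv[of "of_nat (p ^ 2)" ?K] p_gt_1 class_ring_inverse[of "of_nat (p ^
            2)"]
        by simp
      ultimately have "inverse (of_nat (p ^ 2)) * chi_mu p G \<mu> z \<in> generate_field ?K (chi_mu p G \<mu> `
          carrier G)"
        using generate_field.eng_mult by fastforce
      moreover have "inverse (of_nat (p ^ 2)) * chi_mu p G \<mu> z = \<mu> z"
        using z center_carrier[OF z] p_gt_1 by (simp add: chi_mu_def)
      ultimately show "\<mu> z \<in> generate_field ?K (chi_mu p G \<mu> ` carrier G)" by (simp only:)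
    qed
  qed
  then show ?thesis by (simp add: character_field_def image)
qed

lemma required_pairI:
  assumes "linear_character H_group \<psi>" "\<And>z. z \<in> center G \<Longrightarrow> \<psi> z = \<mu> z" "\<psi> ` H \<subseteq> \<mu> ` center G"
  shows "required_pair G (chi_mu p G \<mu>) H \<psi>"
  unfolding required_pair_def
  using chi_mu_Irr subgroup_H assms induced_eq_chi_mu[OF assms(1,2)] character_field_eq[OF assms(3,2)]
  by blast

text \<open>The condition on \<open>V\<close> matches what \<open>extension_exists\<close> delivers,
  which gives existence; the prescribed elements generate \<open>H\<close>, which gives
  uniqueness.\<close>

lemma required_pair_by_valuesI:
  assumes V: "\<And>h c. (h, c) \<in> V \<Longrightarrow> h \<in> N \<and> c = 1 \<or> h \<in> center G \<and> c = \<mu> h"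
    and H: "H = generate G (fst ` V)"
  shows "required_pair_by_values G (chi_mu p G \<mu>) H V"
proof -
  obtain \<psi> where \<psi>: "linear_character H_group \<psi>" "\<And>z. z \<in> center G \<Longrightarrow> \<psi> z = \<mu> z"
    "\<And>n. n \<in> N \<Longrightarrow> \<psi> n = 1" "\<psi> ` H \<subseteq> \<mu> ` center G"
    using extension_exists by auto
  have val: "\<psi> h = c" if "(h, c) \<in> V" for h c using V[OF that] \<psi> by auto
  have "\<phi> = \<psi>" if "linear_character H_group \<phi>" "\<forall>(h, c) \<in> V. \<phi> h = c" for \<phi>
    using linear_character_eq_on_generate[OF subgroup_H that(1) \<psi>(1) H] that(2) val by fastforce
  then have "{\<phi>. linear_character H_group \<phi> \<and> (\<forall>(h, c) \<in> V. \<phi> h = c)} = {\<psi>}"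
    using \<psi>(1) val by auto
  then show ?thesis
    unfolding required_pair_by_values_def using required_pairI[OF \<psi>(1,2,4)] by blast
qed

text \<open>Here \<psi> is an arbitrary extension and need not be trivial on \<open>N\<close>. Its
  values are still confined: exponent p makes them p-th roots of unity, and \<mu>, being injective
  on a centre of order p, attains all of these.\<close>

lemma Irr_over_required_pairs:
  assumes exponent: "\<And>h. h \<in> H \<Longrightarrow> h [^] p = \<one>"
  defines "\<Psi> \<equiv> {\<psi> \<in> Irr_over H_group (center G). restrict \<psi> (center G) = \<mu>}"
  shows "\<Psi> \<noteq> {} \<and> (\<forall>\<psi>\<in>\<Psi>. required_pair G (chi_mu p G \<mu>) H \<psi>)"
proof
  obtain \<psi> where \<psi>: "linear_character H_group \<psi>" "\<And>z. z \<in> center G \<Longrightarrow> \<psi> z = \<mu> z"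
    "\<And>n. n \<in> N \<Longrightarrow> \<psi> n = 1" "\<psi> ` H \<subseteq> \<mu> ` center G"
    using extension_exists by auto
  have "\<exists>z\<in>center G. \<mu> z \<noteq> 1"
  proof (rule ccontr)
    assume "\<not> (\<exists>z\<in>center G. \<mu> z \<noteq> 1)"
    then have "\<mu> = (\<lambda>z \<in> center G. 1)" by (intro extensionalityI[OF mu(1)]) auto
    then show False using mu_nontrivial by blast
  qed
  \<comment> \<open>Nontriviality of \<mu> is what keeps the centre out of the kernel of its
    extension.\<close>
  then have "\<psi> \<in> Irr_over H_group (center G)"
    using \<psi> linear_characterD(2)[OF group_H \<psi>(1)]
    by (auto simp: Irr_over_def linear_character_def char_kernel_def)
  moreover have "restrict \<psi> (center G) = \<mu>"
    using \<psi>(2) by (intro extensionalityI[OF _ mu(1)]) auto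
  ultimately show "\<Psi> \<noteq> {}" by (auto simp: \<Psi>_def)
  show "\<forall>\<psi>\<in>\<Psi>. required_pair G (chi_mu p G \<mu>) H \<psi>"
  proof
    fix \<psi> assume "\<psi> \<in> \<Psi>"
    then have "\<psi> \<in> Irr H_group" and restr: "restrict \<psi> (center G) = \<mu>"
      by (auto simp: \<Psi>_def Irr_over_def)
    have lin: "linear_character H_group \<psi>"
    proof (rule abelian_Irr_linear[OF group_H _ \<open>\<psi> \<in> Irr H_group\<close>])
      fix x y assume "x \<in> carrier H_group" "y \<in> carrier H_group"
      then show "x \<otimes>\<^bsub>H_group\<^esub> y = y \<otimes>\<^bsub>H_group\<^esub> x" using H_commute[of x y] by simp
    qed
    have ext: "\<psi> z = \<mu> z" if "z \<in> center G" for z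
      using that restr by (metis restrict_apply')
    have pow_H: "x [^]\<^bsub>H_group\<^esub> k = x [^] k" for x and k :: nat
      by (rule nat_pow_consistent[symmetric])
    have root: "\<psi> h ^ p = 1" if "h \<in> H" for h
      using linear_character_pow[OF group_H lin, of h p] that exponent[OF that]
        linear_characterD(2)[OF group_H lin] by (simp add: pow_H)
    have inj: "inj_on \<mu> (center G)"
    proof (rule inj_onI)
      fix z w assume zw: "z \<in> center G" "w \<in> center G" "\<mu> z = \<mu> w"
      have iw: "inv w \<in> center G" using zw(2) subgroup.m_inv_closed[OF center_subgroup] by blast
      have "\<mu> (inv w \<otimes> z) = \<mu> (inv w) * \<mu> w" using mu(3)[OF iw zw(1)] zw(3) by simp
      also have "\<dots> = 1" using mu(3)[OF iw zw(2)] mu(2) center_carrier[OF zw(2)] by simp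
      finally have "inv w \<otimes> z = \<one>"
        using mu_eq_1_iff[of "inv w \<otimes> z"] subgroup.m_closed[OF center_subgroup iw zw(1)] by blast
      then have "inv z = inv w"
        using inv_equality[of "inv w" z] center_carrier[OF zw(1)] center_carrier[OF zw(2)] by simp
      then have "inv (inv z) = inv (inv w)" by (rule arg_cong)
      then show "z = w" using center_carrier[OF zw(1)] center_carrier[OF zw(2)] by simp
    qed
    \<comment> \<open>One inclusion plus equal cardinality p.\<close>
    have roots: "\<mu> ` center G = {c :: complex. c ^ p = 1}"
    proof (rule card_subset_eq)
      show "finite {c :: complex. c ^ p = 1}" using p_gt_1 by (intro finite_roots_unity) simp
      show "\<mu> ` center G \<subseteq> {c. c ^ p = 1}" using root center_subset ext by force
      show "card (\<mu> ` center G) = card {c :: complex. c ^ p = 1}"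
        using card_image[OF inj] card_center p_gt_1 card_roots_unity_eq[of p] by simp
    qed
    show "required_pair G (chi_mu p G \<mu>) H \<psi>"
      using root by (intro required_pairI[OF lin ext]) (auto simp: roots)
  qed
qed

end

section \<open>Subgroups generated in normalised steps\<close>

context group begin

lemma conj_generate:
  assumes S: "S \<subseteq> carrier G" and x: "x \<in> carrier G"
    and conj: "\<And>h. h \<in> S \<Longrightarrow> inv x \<otimes> h \<otimes> x \<in> generate G S"
    and "h \<in> generate G S"
  shows "inv x \<otimes> h \<otimes> x \<in> generate G S"
  using assms(4)
proof (induction rule: generate.induct)
  case one
  then show ?case using x generate.one[of G S] by simp
next
  case (incl h)
  then show ?case by (rule conj)
next
  case (inv h)
  have h: "h \<in> carrier G" using inv S by blast
  have "inv x \<otimes> inv h \<otimes> x = inv (inv x \<otimes> h \<otimes> x)"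
    using h x by (simp add: inv_mult_group m_assoc)
  then show ?case using generate_m_inv_closed[OF S conj[OF inv]] by simp
next
  case (eng h1 h2)
  have h: "h1 \<in> carrier G" "h2 \<in> carrier G" using eng generate_in_carrier[OF S] by auto
  have "x \<otimes> (inv x \<otimes> (h2 \<otimes> x)) = h2 \<otimes> x" using h x by (simp add: m_assoc[symmetric])
  then have "inv x \<otimes> (h1 \<otimes> h2) \<otimes> x = (inv x \<otimes> h1 \<otimes> x) \<otimes> (inv x \<otimes> h2 \<otimes> x)"
    using h x by (simp add: m_assoc)
  then show ?case using generate.eng[OF eng.IH] by simp
qed

lemma conj_pow_generate:
  assumes S: "S \<subseteq> carrier G" and x: "x \<in> carrier G"
    and conj: "\<And>h. h \<in> S \<Longrightarrow> inv x \<otimes> h \<otimes> x \<in> generate G S"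
    and h: "h \<in> generate G S"
  shows "inv (x [^] (j :: nat)) \<otimes> h \<otimes> x [^] j \<in> generate G S"
proof (induction j)
  case 0
  then show ?case using h generate_in_carrier[OF S h] by simp
next
  case (Suc j)
  have hG: "h \<in> carrier G" using generate_in_carrier[OF S h] .
  have "inv (x [^] Suc j) \<otimes> h \<otimes> x [^] Suc j = inv x \<otimes> (inv (x [^] j) \<otimes> h \<otimes> x [^] j) \<otimes> x"
    using hG x by (simp add: inv_mult_group m_assoc)
  then show ?case using conj_generate[OF S x conj Suc.IH] by simp
qed

text \<open>Powers of \<open>x\<close> can be moved to the left past the subgroup generated by
  \<open>S\<close>, since conjugation by \<open>x\<close> maps that subgroup into itself. Finiteness
  of the group makes natural exponents sufficient.\<close>

lemma generate_insert_normalised: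
  assumes fin: "finite (carrier G)" and S: "S \<subseteq> carrier G" and x: "x \<in> carrier G"
    and conj: "\<And>h. h \<in> S \<Longrightarrow> inv x \<otimes> h \<otimes> x \<in> generate G S"
  shows "generate G (insert x S) = {x [^] (i :: nat) \<otimes> h | i h. h \<in> generate G S}" (is "_ = ?T")
proof
  note carr = generate_in_carrier[OF S]
  have closed: "a \<otimes> b \<in> ?T" if "a \<in> ?T" "b \<in> ?T" for a b
  proof -
    obtain i h j k where a: "a = x [^] (i :: nat) \<otimes> h" "h \<in> generate G S"
      and b: "b = x [^] (j :: nat) \<otimes> k" "k \<in> generate G S" using \<open>a \<in> ?T\<close> \<open>b \<in> ?T\<close> by blast
    have hk: "h \<in> carrier G" "k \<in> carrier G" using a b carr by auto
    define w where "w = inv (x [^] j) \<otimes> h \<otimes> x [^] j"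
    have w: "w \<in> generate G S" unfolding w_def by (rule conj_pow_generate[OF S x conj a(2)])
    have "x [^] j \<otimes> w = h \<otimes> x [^] j"
      using hk x by (simp add: w_def m_assoc[symmetric])
    then have "a \<otimes> b = x [^] i \<otimes> (x [^] j \<otimes> w) \<otimes> k" using hk x by (simp add: a b m_assoc)
    also have "\<dots> = x [^] (i + j) \<otimes> (w \<otimes> k)"
      using hk x carr[OF w] by (simp add: nat_pow_mult[symmetric] m_assoc)
    finally show ?thesis using generate.eng[OF w b(2)] by blast
  qed
  have pow_mem: "x [^] (k :: nat) \<in> ?T" for k
    using generate.one[of G S] x by (auto intro!: exI[of _ k] exI[of _ \<one>])
  have gen_mem: "h \<in> ?T" if "h \<in> generate G S" for h
    using that carr[OF that] by (auto intro!: exI[of _ "0 :: nat"] exI[of _ h])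
  have "subgroup ?T G"
  proof (rule subgroupI)
    show "?T \<subseteq> carrier G" using carr x by auto
    show "?T \<noteq> {}" using pow_mem[of 0] by blast
    show "a \<otimes> b \<in> ?T" if "a \<in> ?T" "b \<in> ?T" for a b using closed that .
    fix a assume "a \<in> ?T"
    then obtain i h where a: "a = x [^] (i :: nat) \<otimes> h" "h \<in> generate G S" by blast
    \<comment> \<open>By Lagrange, the inverse of \<open>x [^] i\<close> is the natural power with
      exponent \<open>i * (n - 1)\<close>.\<close>
    define n where "n = Coset.order G"
    have "n > 0" unfolding n_def using fin by (simp add: order_gt_0_iff_finite)
    have "x [^] (i * (n - 1)) \<otimes> x [^] i = x [^] (i * n)"
      using x \<open>n > 0\<close> by (simp add: nat_pow_mult algebra_simps diff_mult_distrib2)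
    also have "\<dots> = (x [^] n) [^] i" using x by (simp add: nat_pow_pow mult.commute)
    also have "\<dots> = \<one>" unfolding n_def using x pow_order_eq_1 by simp
    finally have "inv (x [^] i) = x [^] (i * (n - 1))" using x by (intro inv_equality) auto
    then have "inv a = inv h \<otimes> x [^] (i * (n - 1))"
      using x carr[OF a(2)] by (simp add: a inv_mult_group)
    then show "inv a \<in> ?T"
      using closed[OF gen_mem pow_mem] generate_m_inv_closed[OF S a(2)] by simp
  qed
  moreover have "insert x S \<subseteq> ?T"
    using pow_mem[of 1] x gen_mem generate.incl[of _ S G] by (auto simp del: One_nat_def)
  ultimately show "generate G (insert x S) \<subseteq> ?T" by (intro generate_subgroup_incl)
  have "subgroup (generate G (insert x S)) G" using S x by (intro generate_is_subgroup) auto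
  moreover have "x \<in> generate G (insert x S)" by (rule generate.incl) simp
  ultimately have "x [^] (i :: nat) \<in> generate G (insert x S)" for i
    by (induction i) (auto intro: subgroup.one_closed subgroup.m_closed)
  then show "?T \<subseteq> generate G (insert x S)"
    using mono_generate[of S "insert x S"] generate.eng[of _ G "insert x S"] by blast
qed

section \<open>Counting the index of one step\<close>

lemma card_generate_insert_le:
  assumes fin: "finite (carrier G)" and S: "S \<subseteq> carrier G" and x: "x \<in> carrier G"
    and conj: "\<And>h. h \<in> S \<Longrightarrow> inv x \<otimes> h \<otimes> x \<in> generate G S"
    and pow: "x [^] (p :: nat) \<in> generate G S" and "p > 0"
  shows "card (generate G (insert x S)) \<le> p * card (generate G S)"
proof -
  note carr = generate_in_carrier[OF S]
  have sub: "subgroup (generate G S) G" using S by (rule generate_is_subgroup)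
  have finS: "finite (generate G S)" using fin generate_incl[OF S] finite_subset by blast
  have "generate G (insert x S) \<subseteq> (\<lambda>(i, h). x [^] i \<otimes> h) ` ({..<p} \<times> generate G S)"
  proof
    fix g assume "g \<in> generate G (insert x S)"
    then obtain i h where g: "g = x [^] (i :: nat) \<otimes> h" "h \<in> generate G S"
      using generate_insert_normalised[OF fin S x conj] by auto
    have powS: "(x [^] p) [^] (k :: nat) \<in> generate G S" for k
      using pow by (induction k) (auto intro: subgroup.one_closed[OF sub] subgroup.m_closed[OF sub])
    \<comment> \<open>The exponent is reduced modulo \<open>p\<close> at the cost of a power of
      \<open>x [^] p\<close>, which is absorbed by the smaller subgroup.\<close>
    have "x [^] i = x [^] (i mod p + p * (i div p))" by simp
    also have "\<dots> = x [^] (i mod p) \<otimes> (x [^] p) [^] (i div p)"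
      using nat_pow_mult[OF x, of "i mod p" "p * (i div p)"] x by (simp add: nat_pow_pow)
    finally have "g = x [^] (i mod p) \<otimes> ((x [^] p) [^] (i div p) \<otimes> h)"
      using x carr[OF g(2)] by (simp add: g m_assoc)
    moreover have "(x [^] p) [^] (i div p) \<otimes> h \<in> generate G S"
      using powS g(2) subgroup.m_closed[OF sub] by blast
    moreover have "i mod p < p" using \<open>p > 0\<close> by simp
    ultimately show "g \<in> (\<lambda>(i, h). x [^] i \<otimes> h) ` ({..<p} \<times> generate G S)" by force
  qed
  then have "card (generate G (insert x S)) \<le> card ({..<p} \<times> generate G S)"
    using finS by (intro surj_card_le) auto
  then show ?thesis by (simp add: card_cartesian_product)
qed

text \<open>By Bezout with natural coefficients, the power with exponent gcd is a quotient of two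
  powers that lie in \<open>S\<close>.\<close>

lemma pow_gcd_mem_subgroup:
  assumes S: "subgroup S G" and x: "x \<in> carrier G"
    and "x [^] (m :: nat) \<in> S" "x [^] (i :: nat) \<in> S"
  shows "x [^] gcd i m \<in> S"
\<comment> \<open>Bezout in this form needs a nonzero first argument; for \<open>i = 0\<close> the
  gcd is \<open>m\<close> itself.\<close>
proof (cases "i = 0")
  case True
  then show ?thesis using assms(3) by simp
next
  case False
  then obtain a b where ab: "i * a = m * b + gcd i m" using bezout_nat by blast
  have powS: "y [^] (k :: nat) \<in> S" if "y \<in> S" for y k
    using that by (induction k) (auto intro: subgroup.one_closed[OF S] subgroup.m_closed[OF S])
  have "(x [^] m) [^] b \<otimes> x [^] gcd i m = x [^] (i * a)"
    using x by (simp add: ab nat_pow_pow nat_pow_mult)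
  also have "\<dots> = (x [^] i) [^] a" using x by (simp add: nat_pow_pow)
  finally have eq: "(x [^] m) [^] b \<otimes> x [^] gcd i m = (x [^] i) [^] a" .
  have "x [^] gcd i m = inv ((x [^] m) [^] b) \<otimes> ((x [^] m) [^] b \<otimes> x [^] gcd i m)"
    using x by (simp add: m_assoc[symmetric])
  also have "\<dots> \<in> S"
    unfolding eq using powS assms(3,4) subgroup.m_inv_closed[OF S] subgroup.m_closed[OF S] by blast
  finally show ?thesis .
qed

text \<open>If \<open>x [^] i\<close> falls into the smaller subgroup, so does the power with
  exponent gcd of \<open>i\<close> and \<open>m\<close>. The counting bound then holds with this gcd
  in place of \<open>m\<close>, and an index of exactly \<open>m\<close> forces the gcd to be
  \<open>m\<close>.\<close>

lemma new_generator:
  assumes fin: "finite (carrier G)" and S: "S \<subseteq> carrier G" and x: "x \<in> carrier G"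
    and conj: "\<And>h. h \<in> S \<Longrightarrow> inv x \<otimes> h \<otimes> x \<in> generate G S"
    and card: "card (generate G (insert x S)) = m * card (generate G S)" and "m > 0"
    and "x [^] m \<in> generate G S" "x [^] (i :: nat) \<in> generate G S"
  shows "m dvd i"
proof -
  have "x [^] gcd i m \<in> generate G S"
    by (rule pow_gcd_mem_subgroup[OF generate_is_subgroup[OF S] x assms(7,8)])
  then have "m * card (generate G S) \<le> gcd i m * card (generate G S)"
    using card_generate_insert_le[OF fin S x conj] card \<open>m > 0\<close> by simp
  moreover have "card (generate G S) > 0"
    using fin generate_incl[OF S] generate.one[of G S] by (metis card_gt_0_iff empty_iff finite_subset)
  ultimately have "m \<le> gcd i m" by simp
  moreover have "gcd i m \<le> m" using \<open>m > 0\<close> by (intro dvd_imp_le) auto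
  ultimately show ?thesis by (metis gcd_dvd1 le_antisym)
qed

text \<open>The converse of \<open>new_generator\<close>, for subgroups outside the chain that
  exhausts the group, such as \<open>generate G {w, z}\<close> in \<open>two_step\<close>. The
  products with exponents below \<open>m\<close> are pairwise distinct.\<close>

lemma card_generate_insert:
  assumes fin: "finite (carrier G)" and S: "S \<subseteq> carrier G" and x: "x \<in> carrier G"
    and conj: "\<And>h. h \<in> S \<Longrightarrow> inv x \<otimes> h \<otimes> x \<in> generate G S"
    and "x [^] m \<in> generate G S" "m > 0"
    and new: "\<And>i :: nat. x [^] i \<in> generate G S \<Longrightarrow> m dvd i"
  shows "card (generate G (insert x S)) = m * card (generate G S)"
proof (rule antisym)
  show "card (generate G (insert x S)) \<le> m * card (generate G S)"
    by (rule card_generate_insert_le[OF fin S x conj assms(5,6)])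
  note carr = generate_in_carrier[OF S]
  have sub: "subgroup (generate G S) G" using S by (rule generate_is_subgroup)
  have le: "i = j" if "i \<le> j" "j < m" "h \<in> generate G S" "k \<in> generate G S"
    and eq: "x [^] i \<otimes> h = x [^] j \<otimes> k" for i j h k
  proof -
    have hk: "h \<in> carrier G" "k \<in> carrier G" using that carr by auto
    have "x [^] i \<otimes> h = x [^] i \<otimes> (x [^] (j - i) \<otimes> k)"
      unfolding eq using x hk \<open>i \<le> j\<close> by (simp add: m_assoc[symmetric] nat_pow_mult)
    then have h: "h = x [^] (j - i) \<otimes> k"
      using x hk Units_l_cancel[of "x [^] i" h "x [^] (j - i) \<otimes> k"] by (simp add: Units_eq)
    have "x [^] (j - i) = h \<otimes> inv k" using x hk by (simp add: h m_assoc)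
    then have "m dvd j - i"
      using that new subgroup.m_closed[OF sub] subgroup.m_inv_closed[OF sub] by metis
    then show ?thesis using that by (metis diff_is_0_eq le_antisym less_imp_diff_less
        nat_dvd_not_less not_gr0)
  qed
  have "inj_on (\<lambda>(i, h). x [^] i \<otimes> h) ({..<m} \<times> generate G S)"
  proof (rule inj_onI, clarify)
    fix i h j k assume *: "i < m" "h \<in> generate G S" "j < m" "k \<in> generate G S"
        "x [^] i \<otimes> h = x [^] j \<otimes> k"
    then have "i = j" using le[of i j h k] le[of j i k h] by (cases "i \<le> j") auto
    moreover from this have "h = k"
      using * x carr Units_l_cancel[of "x [^] i" h k] by (simp add: Units_eq)
    ultimately show "i = j \<and> h = k" by simp
  qed
  then have "m * card (generate G S) = card ((\<lambda>(i, h). x [^] i \<otimes> h) ` ({..<m} \<times> generate G S))"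
    by (simp add: card_image card_cartesian_product)
  also have "\<dots> \<le> card (generate G (insert x S))"
  proof (rule card_mono)
    show "finite (generate G (insert x S))"
      using fin generate_incl[of "insert x S"] S x finite_subset by blast
    show "(\<lambda>(i, h). x [^] i \<otimes> h) ` ({..<m} \<times> generate G S) \<subseteq> generate G (insert x S)"
      using generate_insert_normalised[OF fin S x conj] by auto
  qed
  finally show "m * card (generate G S) \<le> card (generate G (insert x S))" .
qed

lemma generate_empty: "generate G {} = {\<one>}"
  using generate_subgroup_incl[of "{}"
      "{\<one>}"] one_is_normal normal_imp_subgroup generate.one[of G "{}"] by blast

lemma generate_pow_closed:
  assumes "S \<subseteq> carrier G" "x \<in> generate G S"
  shows "x [^] (k :: nat) \<in> generate G S"
  using assms(2) generate_is_subgroup[OF assms(1)]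
  by (induction k) (auto intro: subgroup.one_closed subgroup.m_closed)

lemma commute_generate:
  assumes S: "S \<subseteq> carrier G" and x: "x \<in> carrier G"
    and "\<And>s. s \<in> S \<Longrightarrow> x \<otimes> s = s \<otimes> x" and "g \<in> generate G S"
  shows "x \<otimes> g = g \<otimes> x"
  using assms(4)
proof (induction rule: generate.induct)
  case (inv h)
  have h: "h \<in> carrier G" using inv S by blast
  have "x \<otimes> inv h = inv h \<otimes> (h \<otimes> x) \<otimes> inv h" using h x by (simp add: m_assoc[symmetric])
  also have "\<dots> = inv h \<otimes> x" unfolding assms(3)[OF inv, symmetric] using h x by (simp add: m_assoc)
  finally show ?case .
next
  case (eng h1 h2)
  have h: "h1 \<in> carrier G" "h2 \<in> carrier G" using eng generate_in_carrier[OF S] by auto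
  have "x \<otimes> (h1 \<otimes> h2) = h1 \<otimes> x \<otimes> h2" using h x by (simp add: m_assoc[symmetric] eng.IH(1))
  also have "\<dots> = h1 \<otimes> h2 \<otimes> x" using h x by (simp add: m_assoc eng.IH(2))
  finally show ?case .
qed (use assms in auto)

section \<open>Commutator identities for powers\<close>

lemma conj_eq:
  assumes "h \<in> carrier G" "x \<in> carrier G" "k \<in> carrier G" "h \<otimes> x = x \<otimes> h \<otimes> k"
  shows "inv x \<otimes> h \<otimes> x = h \<otimes> k"
proof -
  have "inv x \<otimes> h \<otimes> x = inv x \<otimes> (x \<otimes> h \<otimes> k)" using assms by (simp add: m_assoc)
  also have "\<dots> = h \<otimes> k" using assms(1-3) by (simp add: m_assoc[symmetric])
  finally show ?thesis .
qed

text \<open>The commutator \<open>c\<close> has to commute only with the element that is raised to a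
  power. In \<open>two_step\<close> the commutator \<open>b\<close> of \<open>x\<close> and
  \<open>w\<close> commutes with \<open>x\<close> but not with \<open>w\<close>, so the asymmetry
  between this lemma and \<open>commute_pow_left\<close> matters.\<close>

lemma commute_pow_right:
  assumes "a \<in> carrier G" "b \<in> carrier G" "c \<in> carrier G"
    and ab: "a \<otimes> b = b \<otimes> a \<otimes> c" and cb: "c \<otimes> b = b \<otimes> c"
  shows "a \<otimes> b [^] (i :: nat) = b [^] i \<otimes> a \<otimes> c [^] i"
proof (induction i)
  case (Suc i)
  have "a \<otimes> b [^] Suc i = b [^] i \<otimes> a \<otimes> (c [^] i \<otimes> b)"
    using assms(1-3) Suc by (simp add: m_assoc[symmetric])
  also have "\<dots> = b [^] i \<otimes> (a \<otimes> b) \<otimes> c [^] i"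
    using assms(1-3) by (simp add: group_commutes_pow[OF cb] m_assoc)
  also have "\<dots> = b [^] Suc i \<otimes> a \<otimes> c [^] Suc i"
    using assms(1-3) group_commutes_pow[of c c i] by (simp add: ab m_assoc)
  finally show ?case .
qed (use assms in simp)

lemma commute_pow_left:
  assumes "a \<in> carrier G" "b \<in> carrier G" "c \<in> carrier G"
    and ab: "a \<otimes> b = b \<otimes> a \<otimes> c" and ca: "c \<otimes> a = a \<otimes> c"
  shows "a [^] (i :: nat) \<otimes> b = b \<otimes> a [^] i \<otimes> c [^] i"
proof (induction i)
  case (Suc i)
  have "a [^] Suc i \<otimes> b = a [^] i \<otimes> b \<otimes> (a \<otimes> c)"
    using assms(1-3) by (simp add: ab m_assoc)
  also have "\<dots> = b \<otimes> a [^] i \<otimes> (c [^] i \<otimes> a) \<otimes> c"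
    using assms(1-3) by (simp add: Suc m_assoc)
  also have "\<dots> = b \<otimes> a [^] Suc i \<otimes> c [^] Suc i"
    using assms(1-3) by (simp add: group_commutes_pow[OF ca] m_assoc)
  finally show ?case .
qed (use assms in simp)

text \<open>A tool for finding the centre from a normal form: the test element \<open>a\<close>
  commutes with the tail \<open>h\<close>, so commuting with the whole product is a condition on the
  leading exponent only.\<close>

lemma commuting_pow_eq_one:
  assumes carrs: "a \<in> carrier G" "b \<in> carrier G" "h \<in> carrier G" "w \<in> carrier G"
    and comm: "a \<otimes> b = b \<otimes> a \<otimes> w" "w \<otimes> b = b \<otimes> w" "a \<otimes> h = h \<otimes> a"
    and g: "a \<otimes> (b [^] (i :: nat) \<otimes> h) = b [^] i \<otimes> h \<otimes> a"
  shows "w [^] i = \<one>"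
proof -
  have "b [^] i \<otimes> a \<otimes> w [^] i \<otimes> h = a \<otimes> (b [^] i \<otimes> h)"
    unfolding commute_pow_right[OF carrs(1,2,4) comm(1,2), symmetric] using carrs by (simp add: m_assoc)
  also have "\<dots> = b [^] i \<otimes> a \<otimes> h" using g carrs by (simp add: m_assoc comm(3))
  finally have "b [^] i \<otimes> a \<otimes> (w [^] i \<otimes> h) = b [^] i \<otimes> a \<otimes> h" using carrs by (simp add: m_assoc)
  then have "w [^] i \<otimes> h = h"
    using carrs Units_l_cancel[of "b [^] i \<otimes> a" "w [^] i \<otimes> h" h] by (simp add: Units_eq)
  then show ?thesis using carrs r_cancel_one[of h "w [^] i"] by simp
qed

end

section \<open>The presentations of \<open>\<Phi>\<^sub>7\<close>, \<open>\<Phi>\<^sub>1\<^sub>0\<close> and \<open>\<Phi>\<^sub>8\<close>\<close>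

text \<open>The common shape of the presentations of \<open>\<Phi>\<^sub>7\<close> and \<open>\<Phi>\<^sub>1\<^sub>0\<close>: adjoining
  \<open>z, v, u, s, t\<close> one after the other gives subgroups each normalised by the next generator, and
  counting shows that each of the five indices is exactly \<open>p\<close>.\<close>

locale five_step = group G for G (structure) +
  fixes p :: nat and z v u s t y c d :: 'a
  assumes prime_p: "Factorial_Ring.prime p"
    and order_G: "Coset.order G = p ^ 5"
    and carr [simp]: "z \<in> carrier G" "v \<in> carrier G" "u \<in> carrier G" "s \<in> carrier G" "t \<in> carrier G"
    and generators: "generate G {t, s, u, v, z} = carrier G"
    and z_comm: "z \<otimes> v = v \<otimes> z" "z \<otimes> u = u \<otimes> z" "z \<otimes> s = s \<otimes> z" "z \<otimes> t = t \<otimes> z"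
    and v_comm: "v \<otimes> u = u \<otimes> v" "v \<otimes> s = s \<otimes> v" "v \<otimes> t = t \<otimes> v \<otimes> z"
    and u_comm: "u \<otimes> s = s \<otimes> u \<otimes> y" "u \<otimes> t = t \<otimes> u \<otimes> c"
    and s_comm: "s \<otimes> t = t \<otimes> s \<otimes> d"
    and y: "y = z \<or> y = inv z" and c: "c \<in> generate G {v, z}" and d: "d \<in> generate G {u, v, z}"
    and pow_zvu: "z [^] p = \<one>" "v [^] p = \<one>" "u [^] p = \<one>"
    and pow_s: "s [^] p \<in> generate G {u, v, z}" and pow_t: "t [^] p \<in> generate G {s, u, v, z}"
begin

lemma p_pos: "p > 0" "p > 1" using prime_p prime_gt_0_nat prime_gt_1_nat by blast+

lemma fin: "finite (carrier G)"
  using order_G p_pos by (intro order_gt_0_iff_finite[THEN iffD1]) simp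

lemma y_closed: "y \<in> carrier G" using y by auto
lemma c_closed: "c \<in> carrier G" using generate_in_carrier[OF _ c] by simp
lemma d_closed: "d \<in> carrier G" using generate_in_carrier[OF _ d] by simp

lemma z_commute: "g \<in> carrier G \<Longrightarrow> z \<otimes> g = g \<otimes> z"
  using commute_generate[of "{t, s, u, v, z}" z g] generators z_comm by auto

lemma gen_z_commute: "a \<in> generate G {z} \<Longrightarrow> g \<in> carrier G \<Longrightarrow> a \<otimes> g = g \<otimes> a"
  using commute_generate[of "{z}" g a] z_commute[of g] by auto

lemma gen_carrier: "a \<in> generate G {z} \<Longrightarrow> a \<in> carrier G"
  "a \<in> generate G {v, z} \<Longrightarrow> a \<in> carrier G"
  "a \<in> generate G {u, v, z} \<Longrightarrow> a \<in> carrier G"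
  "a \<in> generate G {s, u, v, z} \<Longrightarrow> a \<in> carrier G"
  by (rule generate_in_carrier; auto)+

text \<open>This and the next four facts are the normalisation premises of the five steps: each
  conjugate is a generator times a commutator that is already present.\<close>

lemma conj_z: "h \<in> {} \<Longrightarrow> inv z \<otimes> h \<otimes> z \<in> generate G {}" by simp

lemma conj_v: "h \<in> {z} \<Longrightarrow> inv v \<otimes> h \<otimes> v \<in> generate G {z}"
  using conj_eq[of z v \<one>] z_comm generate.incl[of z "{z}" G] by simp

lemma conj_u: "h \<in> {v, z} \<Longrightarrow> inv u \<otimes> h \<otimes> u \<in> generate G {v, z}"
  using conj_eq[of z u \<one>] conj_eq[of v u \<one>] z_comm v_comm generate.incl[of _ "{v, z}" G] by auto

lemma y_gen: "y \<in> generate G {z}"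
  using y generate.incl[of z "{z}" G] generate.inv[of z "{z}" G] by auto

lemma conj_s: "h \<in> {u, v, z} \<Longrightarrow> inv s \<otimes> h \<otimes> s \<in> generate G {u, v, z}"
proof -
  have "u \<otimes> y \<in> generate G {u, v, z}"
    using y_gen mono_generate[of "{z}" "{u, v, z}"] generate.incl[of u "{u, v, z}" G]
    by (intro generate.eng) auto
  then show "h \<in> {u, v, z} \<Longrightarrow> inv s \<otimes> h \<otimes> s \<in> generate G {u, v, z}"
    using conj_eq[of z s \<one>] conj_eq[of v s \<one>] conj_eq[of u s y] y_closed z_comm v_comm u_comm
      generate.incl[of _ "{u, v, z}" G] by auto
qed

lemma conj_t: "h \<in> {s, u, v, z} \<Longrightarrow> inv t \<otimes> h \<otimes> t \<in> generate G {s, u, v, z}"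
proof -
  note incl = generate.incl[of _ "{s, u, v, z}" G]
  have "c \<in> generate G {s, u, v, z}" "d \<in> generate G {s, u, v, z}"
    using c d mono_generate[of "{v, z}" "{s, u, v, z}"] mono_generate[of "{u, v, z}" "{s, u, v, z}"]
        by auto
  then have "u \<otimes> c \<in> generate G {s, u, v, z}" "v \<otimes> z \<in> generate G {s, u, v, z}"
      "s \<otimes> d \<in> generate G {s, u, v, z}"
    using incl by (auto intro!: generate.eng)
  then show "h \<in> {s, u, v, z} \<Longrightarrow> inv t \<otimes> h \<otimes> t \<in> generate G {s, u, v, z}"
    using conj_eq[of z t \<one>] conj_eq[of v t z] conj_eq[of u t c] conj_eq[of s t d] c_closed d_closed
        z_comm v_comm u_comm s_comm
      incl[of z] by auto
qed

lemma cards: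
  "card (generate G {z}) = p" "card (generate G {v, z}) = p ^ 2" "card (generate G {u, v, z}) = p ^ 3"
  "card (generate G {s, u, v, z}) = p ^ 4"
proof -
  note le = card_generate_insert_le[OF fin _ _ _ _ p_pos(1)]
  note one = generate_empty
  have 1: "card (generate G {z}) \<le> p * 1"
    using le[of "{}" z] conj_z pow_zvu one by simp
  have 2: "card (generate G {v, z}) \<le> p * card (generate G {z})"
    using le[of "{z}" v] conj_v pow_zvu generate.one[of G "{z}"] by simp
  have 3: "card (generate G {u, v, z}) \<le> p * card (generate G {v, z})"
    using le[of "{v, z}" u] conj_u pow_zvu generate.one[of G "{v, z}"] by simp
  have 4: "card (generate G {s, u, v, z}) \<le> p * card (generate G {u, v, z})"
    using le[of "{u, v, z}" s] conj_s pow_s by simp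
  have 5: "p ^ 5 \<le> p * card (generate G {s, u, v, z})"
    using le[of "{s, u, v, z}" t] conj_t pow_t generators order_G by (simp add: Coset.order_def)
  \<comment> \<open>The upper bounds climb the chain; then the lower bound in \<open>5\<close>,
    which uses the order of the group, descends it, cancelling one factor p at a time.\<close>
  have "card (generate G {v, z}) \<le> p ^ 2"
    using order_trans[OF 2 mult_le_mono2[OF 1]] by (simp add: power2_eq_square)
  moreover from order_trans[OF 3 mult_le_mono2[OF this]]
  have "card (generate G {u, v, z}) \<le> p ^ 3" by (simp add: eval_nat_numeral)
  moreover from order_trans[OF 4 mult_le_mono2[OF this]]
  have "card (generate G {s, u, v, z}) \<le> p ^ 4" by (simp add: eval_nat_numeral)
  moreover have "p ^ 4 \<le> card (generate G {s, u, v, z})" using 5 p_pos by (simp add: eval_nat_numeral)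
  moreover from order_trans[OF this 4] have "p ^ 3 \<le> card (generate G {u, v, z})"
    using p_pos by (simp add: eval_nat_numeral)
  moreover from order_trans[OF this 3] have "p ^ 2 \<le> card (generate G {v, z})"
    using p_pos by (simp add: eval_nat_numeral)
  moreover from order_trans[OF this 2] have "p \<le> card (generate G {z})"
    using p_pos by (simp add: eval_nat_numeral)
  ultimately show "card (generate G {z}) = p" "card (generate G {v, z}) = p ^ 2"
      "card (generate G {u, v, z}) = p ^ 3"
    "card (generate G {s, u, v, z}) = p ^ 4" using 1 by auto
qed

lemma dvd_if_pow:
  "z [^] (i :: nat) = \<one> \<Longrightarrow> p dvd i"
  "v [^] i \<in> generate G {z} \<Longrightarrow> p dvd i"
  "u [^] i \<in> generate G {v, z} \<Longrightarrow> p dvd i"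
  "s [^] i \<in> generate G {u, v, z} \<Longrightarrow> p dvd i"
  "t [^] i \<in> generate G {s, u, v, z} \<Longrightarrow> p dvd i"
proof -
  note one = generate_empty
  note new = new_generator[OF fin _ _ _ _ p_pos(1)]
  show "z [^] i = \<one> \<Longrightarrow> p dvd i"
    using new[of "{}" z i] conj_z cards one pow_zvu by simp
  show "v [^] i \<in> generate G {z} \<Longrightarrow> p dvd i"
    using new[of "{z}" v i] conj_v cards pow_zvu generate.one[of G "{z}"]
        by (simp add: power2_eq_square)
  show "u [^] i \<in> generate G {v, z} \<Longrightarrow> p dvd i"
    using new[of "{v, z}" u i] conj_u cards pow_zvu generate.one[of G "{v, z}"]
        by (simp add: eval_nat_numeral)
  show "s [^] i \<in> generate G {u, v, z} \<Longrightarrow> p dvd i"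
    using new[of "{u, v, z}" s i] conj_s cards pow_s by (simp add: eval_nat_numeral)
  show "t [^] i \<in> generate G {s, u, v, z} \<Longrightarrow> p dvd i"
    using new[of "{s, u, v, z}" t i] conj_t cards pow_t generators order_G
    by (simp add: eval_nat_numeral Coset.order_def)
qed

lemma y_pow: "y [^] (i :: nat) = \<one> \<Longrightarrow> p dvd i"
  using y dvd_if_pow(1)[of i] by (auto simp: nat_pow_inv)

lemma z_pow_gen: "z [^] (k :: nat) \<in> generate G {z}" "y [^] k \<in> generate G {z}"
proof -
  have sub: "subgroup (generate G {z}) G" by (rule generate_is_subgroup) simp
  have "x [^] k \<in> generate G {z}" if "x \<in> generate G {z}" for x and k :: nat
    using that by (induction k) (auto intro: subgroup.one_closed[OF sub] subgroup.m_closed[OF sub])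
  then show "z [^] k \<in> generate G {z}" "y [^] k \<in> generate G {z}"
    using y_gen generate.incl[of z "{z}" G] by auto
qed

lemma gen_z: "generate G {z} = {z [^] (k :: nat) | k. True}"
  and gen_vz: "generate G {v, z} = {v [^] (j :: nat) \<otimes> h | j h. h \<in> generate G {z}}"
  and gen_uvz: "generate G {u, v, z} = {u [^] (i :: nat) \<otimes> h | i h. h \<in> generate G {v, z}}"
  and gen_suvz: "generate G {s, u, v, z} = {s [^] (i :: nat) \<otimes> h | i h. h \<in> generate G {u, v, z}}"
  and gen_all: "carrier G = {t [^] (i :: nat) \<otimes> h | i h. h \<in> generate G {s, u, v, z}}"
  and gen_uv: "generate G {u, v} = {u [^] (i :: nat) \<otimes> v [^] (j :: nat) | i j. True}"
proof -
  note one = generate_empty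
  note gi = generate_insert_normalised[OF fin]
  show "generate G {z} = {z [^] (k :: nat) | k. True}" using gi[of "{}" z] one by simp
  have v: "generate G {v} = {v [^] (k :: nat) | k. True}" using gi[of "{}" v] one by simp
  show "generate G {v, z} = {v [^] (j :: nat) \<otimes> h | j h. h \<in> generate G {z}}"
    using gi[of "{z}" v, OF _ _ conj_v] by simp
  show "generate G {u, v, z} = {u [^] (i :: nat) \<otimes> h | i h. h \<in> generate G {v, z}}"
    using gi[of "{v, z}" u, OF _ _ conj_u] by simp
  show "generate G {s, u, v, z} = {s [^] (i :: nat) \<otimes> h | i h. h \<in> generate G {u, v, z}}"
    using gi[of "{u, v, z}" s, OF _ _ conj_s] by simp
  show "carrier G = {t [^] (i :: nat) \<otimes> h | i h. h \<in> generate G {s, u, v, z}}"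
    using gi[of "{s, u, v, z}" t, OF _ _ conj_t] generators by simp
  have "inv u \<otimes> h \<otimes> u \<in> generate G {v}" if "h \<in> {v}" for h
    using that conj_eq[of v u \<one>] v_comm generate.incl[of v "{v}" G] by simp
  from gi[of "{v}" u, OF _ _ this]
  show "generate G {u, v} = {u [^] (i :: nat) \<otimes> v [^] (j :: nat) | i j. True}"
    unfolding v by auto
qed

lemma H_form:
  assumes "h \<in> generate G {u, v, z}"
  obtains i j k :: nat where "h = u [^] i \<otimes> (v [^] j \<otimes> z [^] k)"
  using assms unfolding gen_uvz gen_vz gen_z by blast

lemma pow_eq_one: "p dvd i \<Longrightarrow> x \<in> carrier G \<Longrightarrow> x [^] p = \<one> \<Longrightarrow> x [^] (i :: nat) = \<one>"
  by (auto simp: dvd_def nat_pow_pow[symmetric])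

text \<open>With h = u^i v^j z^k: if p does not divide i, then \<open>s\<close> serves, since among
  \<open>u\<close>, \<open>v\<close>, \<open>z\<close> it fails to commute only with
  \<open>u\<close>, and y^i is nontrivial. Otherwise u^i disappears and \<open>t\<close> serves,
  contributing z^j. The order of the cases matters, as the commutator \<open>c\<close> of
  \<open>u\<close> and \<open>t\<close> need not be central.\<close>

lemma pairing_gen:
  assumes h: "h \<in> generate G {u, v, z}" "h \<notin> generate G {z}"
  shows "\<exists>x\<in>carrier G. \<exists>w\<in>generate G {z}. w \<noteq> \<one> \<and> h \<otimes> x = x \<otimes> h \<otimes> w"
proof -
  obtain i j k :: nat where form: "h = u [^] i \<otimes> (v [^] j \<otimes> z [^] k)" using H_form[OF h(1)] .
  show ?thesis
  proof (cases "p dvd i")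
    case False
    then have ne: "y [^] i \<noteq> \<one>" using y_pow by blast
    have us: "u [^] i \<otimes> s = s \<otimes> u [^] i \<otimes> y [^] i"
      using commute_pow_left[of u s y i] y_closed u_comm gen_z_commute[OF y_gen] by simp
    have vs: "v [^] j \<otimes> s = s \<otimes> v [^] j" using group_commutes_pow[of v s j] v_comm by simp
    have zs: "z [^] k \<otimes> s = s \<otimes> z [^] k" using group_commutes_pow[of z s k] z_comm by simp
    have yvz: "y [^] i \<otimes> (v [^] j \<otimes> z [^] k) = v [^] j \<otimes> z [^] k \<otimes> y [^] i"
      by (rule gen_z_commute[OF z_pow_gen(2)]) simp
    have "h \<otimes> s = u [^] i \<otimes> s \<otimes> (v [^] j \<otimes> z [^] k)"
    proof -
      have "h \<otimes> s = u [^] i \<otimes> (v [^] j \<otimes> (z [^] k \<otimes> s))" using form by (simp add: m_assoc)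
      also have "\<dots> = u [^] i \<otimes> (v [^] j \<otimes> s \<otimes> z [^] k)" by (simp add: zs m_assoc)
      also have "\<dots> = u [^] i \<otimes> s \<otimes> (v [^] j \<otimes> z [^] k)" by (simp add: vs m_assoc)
      finally show ?thesis .
    qed
    also have "\<dots> = s \<otimes> u [^] i \<otimes> (y [^] i \<otimes> (v [^] j \<otimes> z [^] k))" using y_closed
        by (simp add: us m_assoc)
    also have "\<dots> = s \<otimes> h \<otimes> y [^] i" unfolding yvz using y_closed by (simp add: form m_assoc)
    finally show ?thesis using ne z_pow_gen(2) by (intro bexI[of _ s] bexI[of _ "y [^] i"]) auto
  next
    case True
    then have "h = v [^] j \<otimes> z [^] k" using form pow_eq_one[of i u] pow_zvu by simp
    note form = this
    have "\<not> p dvd j"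
      using h(2) z_pow_gen(1)[of k] pow_eq_one[of j v] pow_zvu by (auto simp: form)
    then have ne: "z [^] j \<noteq> \<one>" using dvd_if_pow(1) by blast
    have vt: "v [^] j \<otimes> t = t \<otimes> v [^] j \<otimes> z [^] j"
      using commute_pow_left[of v t z j] v_comm z_comm by simp
    have zt: "z [^] k \<otimes> t = t \<otimes> z [^] k" using group_commutes_pow[of z t k] z_comm by simp
    have zz: "z [^] j \<otimes> z [^] k = z [^] k \<otimes> z [^] j" by (rule nat_pow_comm) simp
    have "h \<otimes> t = v [^] j \<otimes> t \<otimes> z [^] k" by (simp add: form m_assoc zt)
    also have "\<dots> = t \<otimes> h \<otimes> z [^] j" by (simp add: vt form m_assoc zz)
    finally show ?thesis using ne z_pow_gen(1) by (intro bexI[of _ t] bexI[of _ "z [^] j"]) auto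
  qed
qed

text \<open>A central element is pushed down the chain by test elements: \<open>v\<close> commutes
  with \<open>s\<close>, \<open>u\<close>, \<open>v\<close>, \<open>z\<close> but not with
  \<open>t\<close>, which removes the power of \<open>t\<close>; then \<open>u\<close> removes that
  of \<open>s\<close>; what is left lies in \<open>generate G {u, v, z}\<close>, where
  \<open>pairing_gen\<close> decides.\<close>

lemma center_eq: "center G = generate G {z}"
proof
  show "generate G {z} \<subseteq> center G"
    using gen_z_commute gen_carrier(1) by (auto intro!: centerI)
  show "center G \<subseteq> generate G {z}"
  proof
    fix g assume g: "g \<in> center G"
    have gG: "g \<in> carrier G" using g by (rule center_carrier)
    have g_comm: "x \<otimes> g = g \<otimes> x" if "x \<in> carrier G" for x using center_commute[OF g that] by simp
    obtain i h where h: "g = t [^] (i :: nat) \<otimes> h" "h \<in> generate G {s, u, v, z}"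
      using gG unfolding gen_all by blast
    have "v \<otimes> h = h \<otimes> v"
      by (rule commute_generate[OF _ _ _ h(2)]) (use v_comm z_comm in auto)
    then have "z [^] i = \<one>"
      using commuting_pow_eq_one[of v t h z i] v_comm z_comm gen_carrier(4)[OF h(2)] g_comm[of v]
          by (simp add: h(1))
    then have "t [^] i \<in> generate G {s, u, v, z}"
    proof -
      assume "z [^] i = \<one>"
      then obtain k where k: "i = p * k" using dvd_if_pow(1) by (auto simp: dvd_def)
      have sub: "subgroup (generate G {s, u, v, z}) G" by (rule generate_is_subgroup) simp
      have "(t [^] p) [^] k \<in> generate G {s, u, v, z}"
        using pow_t by (induction k) (auto intro: subgroup.one_closed[OF sub] subgroup.m_closed[OF sub])
      then show ?thesis by (simp add: k nat_pow_pow)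
    qed
    then have "g \<in> generate G {s, u, v, z}" using h generate.eng by metis
    then obtain j h' where h': "g = s [^] (j :: nat) \<otimes> h'" "h' \<in> generate G {u, v, z}"
      unfolding gen_suvz by blast
    have "u \<otimes> h' = h' \<otimes> u"
      by (rule commute_generate[OF _ _ _ h'(2)]) (use v_comm z_comm in auto)
    then have "y [^] j = \<one>"
      using commuting_pow_eq_one[of u s h' y j] u_comm y_closed gen_z_commute[OF y_gen, of s]
          gen_carrier(3)[OF h'(2)] g_comm[of u]
      by (simp add: h'(1))
    then have "s [^] j \<in> generate G {u, v, z}"
    proof -
      assume "y [^] j = \<one>"
      then obtain k where k: "j = p * k" using y_pow by (auto simp: dvd_def)
      have sub: "subgroup (generate G {u, v, z}) G" by (rule generate_is_subgroup) simp
      have "(s [^] p) [^] k \<in> generate G {u, v, z}"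
        using pow_s by (induction k) (auto intro: subgroup.one_closed[OF sub] subgroup.m_closed[OF sub])
      then show ?thesis by (simp add: k nat_pow_pow)
    qed
    then have gH: "g \<in> generate G {u, v, z}" using h' generate.eng by metis
    show "g \<in> generate G {z}"
    proof (rule ccontr)
      assume "g \<notin> generate G {z}"
      then obtain x w where x: "x \<in> carrier G" "w \<in> generate G {z}" "w \<noteq> \<one>" "g \<otimes> x = x \<otimes> g \<otimes> w"
        using pairing_gen[OF gH] by blast
      have "x \<otimes> g \<otimes> w = x \<otimes> g" using x(4) g_comm[OF x(1)] by simp
      then show False using x gG gen_carrier(1)[OF x(2)] l_cancel_one[of "x \<otimes> g" w] by simp
    qed
  qed
qed

lemma polarization: "polarization G p (generate G {u, v, z}) (generate G {u, v})"
proof (intro polarization.intro polarization_axioms.intro is_group)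
  show "Factorial_Ring.prime p" "Coset.order G = p ^ 5" by (fact prime_p order_G)+
  show "card (center G) = p" "card (generate G {u, v, z}) = p ^ 3" by (simp_all add: center_eq cards)
  show "subgroup (generate G {u, v, z}) G" "subgroup (generate G {u, v}) G"
    by (rule generate_is_subgroup; simp)+
  show "center G \<subseteq> generate G {u, v, z}" unfolding center_eq by (rule mono_generate) auto
  show "generate G {u, v} \<subseteq> generate G {u, v, z}" by (rule mono_generate) auto
  show "a \<otimes> b = b \<otimes> a" if "a \<in> generate G {u, v, z}" "b \<in> generate G {u, v, z}" for a b
  proof (rule commute_generate[of "{u, v, z}"])
    show "a \<otimes> x = x \<otimes> a" if x: "x \<in> {u, v, z}" for x
    proof -
      have "x \<otimes> a = a \<otimes> x"
        by (rule commute_generate[of "{u, v, z}"])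
          (use x that \<open>a \<in> generate G {u, v, z}\<close> v_comm z_comm in auto)
      then show ?thesis by simp
    qed
  qed (use that gen_carrier in auto)
  show "generate G {u, v} \<inter> center G = {\<one>}"
  proof
    show "{\<one>} \<subseteq> generate G {u, v} \<inter> center G"
      unfolding center_eq using generate.one[of G] by auto
    show "generate G {u, v} \<inter> center G \<subseteq> {\<one>}"
    proof
      fix x assume "x \<in> generate G {u, v} \<inter> center G"
      then obtain i j where x: "x = u [^] (i :: nat) \<otimes> v [^] (j :: nat)" "x \<in> generate G {z}"
        unfolding gen_uv center_eq by blast
      have sub: "subgroup (generate G {v, z}) G" by (rule generate_is_subgroup) simp
      have "v [^] j \<in> generate G {v, z}" for j :: nat
        using generate.incl[of v "{v, z}" G]
        by (induction j) (auto intro: subgroup.one_closed[OF sub] subgroup.m_closed[OF sub])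
      moreover have "x \<in> generate G {v, z}" using x(2) mono_generate[of "{z}" "{v, z}"] by auto
      \<comment> \<open>In a common element the power of \<open>u\<close> lies in
        \<open>generate G {v, z}\<close>, so p divides its exponent and it is trivial; the remaining
        power of \<open>v\<close> then lies in \<open>generate G {z}\<close> and is trivial for the
        same reason.\<close>
      moreover have "u [^] i = x \<otimes> inv (v [^] j)" using x(1) by (simp add: m_assoc)
      ultimately have "u [^] i \<in> generate G {v, z}"
        using subgroup.m_closed[OF sub] subgroup.m_inv_closed[OF sub] by metis
      then have "u [^] i = \<one>" using dvd_if_pow(3) pow_eq_one[of i u] pow_zvu by simp
      then have v: "x = v [^] j" using x(1) by simp
      then have "v [^] j = \<one>" using dvd_if_pow(2)[of j] x(2) pow_eq_one[of j v] pow_zvu by simp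
      then show "x \<in> {\<one>}" using v by simp
    qed
  qed
  show "\<exists>n\<in>generate G {u, v}. \<exists>w\<in>center G. h = n \<otimes> w" if h: "h \<in> generate G {u, v, z}" for h
  proof -
    obtain i j k :: nat where "h = u [^] i \<otimes> (v [^] j \<otimes> z [^] k)" using H_form[OF h] .
    then have "h = (u [^] i \<otimes> v [^] j) \<otimes> z [^] k" by (simp add: m_assoc)
    then show ?thesis using z_pow_gen(1) unfolding center_eq gen_uv by blast
  qed
  show "\<exists>x\<in>carrier G. \<exists>w\<in>center G. w \<noteq> \<one> \<and> h \<otimes> x = x \<otimes> h \<otimes> w"
    if "h \<in> generate G {u, v, z}" "h \<notin> center G" for h
    using that unfolding center_eq by (rule pairing_gen)
qed

end

text \<open>Here \<open>x, w\<close> are \<open>\<alpha>\<^sub>1, \<alpha>\<^sub>2\<close>; \<open>b = x [^] p\<close> is their commutator and \<open>z = b [^] p\<close> turns out to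
  generate the centre.\<close>

locale two_step = group G for G (structure) +
  fixes p :: nat and x w b z :: 'a
  assumes prime_p: "Factorial_Ring.prime p" and p_odd: "odd p"
    and order_G: "Coset.order G = p ^ 5"
    and carr [simp]: "x \<in> carrier G" "w \<in> carrier G"
    and generators: "generate G {w, x} = carrier G"
    and xw: "x \<otimes> w = w \<otimes> x \<otimes> b"
    and b_def: "b = x [^] p" and z_def: "z = x [^] (p ^ 2)"
    and pow_x: "x [^] (p ^ 3) = \<one>" and pow_w: "w [^] (p ^ 2) = \<one>"
begin

lemma p_pos: "p > 0" "p > 1" using prime_p prime_gt_0_nat prime_gt_1_nat by blast+

lemma fin: "finite (carrier G)"
  using order_G p_pos by (intro order_gt_0_iff_finite[THEN iffD1]) simp

lemma bz_carr [simp]: "b \<in> carrier G" "z \<in> carrier G" by (simp_all add: b_def z_def)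

lemma b_pow: "b [^] p = z" by (simp add: b_def z_def nat_pow_pow power2_eq_square)

lemma z_pow: "z [^] p = \<one>"
  using pow_x by (simp add: z_def nat_pow_pow power2_eq_square power3_eq_cube mult.assoc)

lemma bx: "b \<otimes> x = x \<otimes> b" and zx: "z \<otimes> x = x \<otimes> z" and zb: "z \<otimes> b = b \<otimes> z"
  using group_commutes_pow[of x x] nat_pow_comm[of x] by (simp_all add: b_def z_def)

lemma pow_x_w: "x [^] (i :: nat) \<otimes> w = w \<otimes> x [^] i \<otimes> b [^] i"
  by (rule commute_pow_left) (simp_all add: xw bx)

text \<open>The case of exponent p in \<open>pow_x_w\<close>: the power of \<open>x\<close> is
  \<open>b\<close> itself, and the commutator b^p is \<open>z\<close>.\<close>

lemma bw: "b \<otimes> w = w \<otimes> b \<otimes> z"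
  using pow_x_w[of p] by (simp add: b_pow) (simp add: b_def)

text \<open>Raising \<open>bw\<close> to the p-th power leaves z^p, which is trivial because x has
  order dividing p^3.\<close>

lemma zw: "z \<otimes> w = w \<otimes> z"
proof -
  have "b [^] p \<otimes> w = w \<otimes> b [^] p \<otimes> z [^] p"
    by (rule commute_pow_left) (simp_all add: bw zb)
  then show ?thesis by (simp add: b_pow z_pow)
qed

lemma z_commute: "g \<in> carrier G \<Longrightarrow> z \<otimes> g = g \<otimes> z"
  using commute_generate[of "{w, x}" z g] generators zw zx by auto

lemma b_pow_w: "b \<otimes> w [^] (j :: nat) = w [^] j \<otimes> b \<otimes> z [^] j"
  by (rule commute_pow_right) (simp_all add: bw zw)

text \<open>Moving b^j past one more \<open>w\<close> costs z^j, and 0 + 1 + ... + (j - 1) is the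
  binomial coefficient.\<close>

lemma x_pow_w: "x \<otimes> w [^] (j :: nat) = w [^] j \<otimes> x \<otimes> b [^] j \<otimes> z [^] (j choose 2)"
proof (induction j)
  case (Suc j)
  have bjw: "b [^] j \<otimes> w = w \<otimes> b [^] j \<otimes> z [^] j"
    by (rule commute_pow_left) (simp_all add: bw zb)
  have zjw: "z [^] (j choose 2) \<otimes> w = w \<otimes> z [^] (j choose 2)"
    by (rule group_commutes_pow) (simp_all add: zw)
  have "x \<otimes> w [^] Suc j = w [^] j \<otimes> x \<otimes> b [^] j \<otimes> (z [^] (j choose 2) \<otimes> w)"
    using Suc by (simp add: m_assoc[symmetric])
  also have "\<dots> = w [^] j \<otimes> x \<otimes> (b [^] j \<otimes> w) \<otimes> z [^] (j choose 2)"
    by (simp add: zjw m_assoc)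
  also have "\<dots> = w [^] j \<otimes> (x \<otimes> w) \<otimes> b [^] j \<otimes> (z [^] j \<otimes> z [^] (j choose 2))"
    by (simp add: bjw m_assoc)
  also have "\<dots> = w [^] Suc j \<otimes> x \<otimes> (b \<otimes> b [^] j) \<otimes> (z [^] j \<otimes> z [^] (j choose 2))"
    by (simp add: xw m_assoc)
  also have "b \<otimes> b [^] j = b [^] Suc j" by (rule nat_pow_Suc2[symmetric]) simp
  also have "z [^] j \<otimes> z [^] (j choose 2) = z [^] (Suc j choose 2)"
    by (simp add: nat_pow_mult numeral_2_eq_2)
  finally show ?case .
qed (simp add: numeral_2_eq_2)

text \<open>For odd p the binomial coefficient p over 2 is a multiple of p, so the correction term
  in \<open>x_pow_w\<close> vanishes and only b^p = z remains.\<close>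

lemma x_W: "x \<otimes> w [^] p = w [^] p \<otimes> x \<otimes> z"
proof -
  obtain k where k: "p = 2 * k + 1" using p_odd by (rule oddE)
  have "p choose 2 = p * k" unfolding choose_two k by simp
  then have "p dvd p choose 2" by simp
  then have "z [^] (p choose 2) = \<one>"
    using z_pow by (auto simp: dvd_def nat_pow_pow[symmetric])
  then show ?thesis using x_pow_w[of p] by (simp add: b_pow)
qed

lemma x_pow_W: "x \<otimes> (w [^] p) [^] (j :: nat) = (w [^] p) [^] j \<otimes> x \<otimes> z [^] j"
proof (rule commute_pow_right)
  show "z \<otimes> w [^] p = w [^] p \<otimes> z" by (rule z_commute) simp
qed (simp_all add: x_W)

text \<open>Conjugation by \<open>w\<close> sends \<open>x\<close> to x^(1 + p), so the group is
  metacyclic.\<close>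

lemma conj_x: "h \<in> {x} \<Longrightarrow> inv w \<otimes> h \<otimes> w \<in> generate G {x}"
  using conj_eq[of x w b] xw generate_pow_closed[of "{x}" x] generate.incl[of x "{x}" G]
  by (auto simp: b_def intro!: generate.eng)

lemma gen_x: "generate G {x} = {x [^] (i :: nat) | i. True}"
  and gen_z: "generate G {z} = {z [^] (i :: nat) | i. True}"
  and gen_w: "generate G {w} = {w [^] (i :: nat) | i. True}"
  using generate_insert_normalised[OF fin, of "{}"] generate_empty by auto

lemma gen_all: "carrier G = {w [^] (j :: nat) \<otimes> x [^] (i :: nat) | i j. True}"
  using generate_insert_normalised[OF fin, of "{x}" w, OF _ _ conj_x] generators gen_x by auto

lemma conj_z: "h \<in> {z} \<Longrightarrow> inv w \<otimes> h \<otimes> w \<in> generate G {z}"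
  using conj_eq[of z w \<one>] zw generate.incl[of z "{z}" G] by simp

lemma gen_wz: "generate G {w, z} = {w [^] (j :: nat) \<otimes> z [^] (i :: nat) | i j. True}"
  using generate_insert_normalised[OF fin, of "{z}" w, OF _ _ conj_z] gen_z by auto

text \<open>Two counting steps, with exponents p^3 and p^2, already exhaust p^5, so both bounds are
  attained.\<close>

lemma card_x: "card (generate G {x}) = p ^ 3"
proof (rule antisym)
  show "card (generate G {x}) \<le> p ^ 3"
    using card_generate_insert_le[OF fin, of "{}" x "p ^ 3"] pow_x p_pos generate_empty by simp
  have "p ^ 5 \<le> p ^ 2 * card (generate G {x})"
    using card_generate_insert_le[OF fin, of "{x}" w "p ^ 2", OF _ _ conj_x] pow_w p_pos
      generate.one[of G "{x}"] generators order_G by (simp add: Coset.order_def)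
  then show "p ^ 3 \<le> card (generate G {x})"
    using p_pos by (simp add: eval_nat_numeral)
qed

lemma x_pow_dvd: "x [^] (i :: nat) = \<one> \<Longrightarrow> p ^ 3 dvd i"
  using new_generator[OF fin, of "{}" x "p ^ 3" i] card_x pow_x p_pos generate_empty by simp

lemma w_pow_dvd: "w [^] (j :: nat) \<in> generate G {x} \<Longrightarrow> p ^ 2 dvd j"
  using new_generator[OF fin, of "{x}" w "p ^ 2" j, OF _ _ conj_x] card_x pow_w p_pos generators order_G
    generate.one[of G "{x}"]
  by (simp add: Coset.order_def power_add[symmetric])

lemma z_pow_dvd: "z [^] (i :: nat) = \<one> \<Longrightarrow> p dvd i"
  using x_pow_dvd[of "p ^ 2 * i"] p_pos by (simp add: z_def nat_pow_pow power2_eq_square power3_eq_cube)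

lemma z_gen_x: "h \<in> generate G {z} \<Longrightarrow> h \<in> generate G {x}"
  unfolding gen_z gen_x by (auto simp: z_def nat_pow_pow)

lemma card_z: "card (generate G {z}) = p"
  using card_generate_insert[OF fin, of "{}" z p] z_pow z_pow_dvd p_pos generate_empty by simp

text \<open>A power of \<open>w\<close> in \<open>generate G {z}\<close> lies in
  \<open>generate G {x}\<close>, so its exponent is divisible by p^2.\<close>

lemma card_wz: "card (generate G {w, z}) = p ^ 3"
  using card_generate_insert[OF fin, of "{z}" w "p ^ 2", OF _ _ conj_z] w_pow_dvd z_gen_x pow_w p_pos
    generate.one[of G "{z}"] card_z by (simp add: eval_nat_numeral)

lemma w_pow_eq_one: "p ^ 2 dvd j \<Longrightarrow> w [^] (j :: nat) = \<one>"
  using pow_w by (auto simp: dvd_def nat_pow_pow[symmetric])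

lemma gen_z_commute: "a \<in> generate G {z} \<Longrightarrow> g \<in> carrier G \<Longrightarrow> a \<otimes> g = g \<otimes> a"
  using commute_generate[of "{z}" g a] z_commute[of g] by auto

lemma z_pow_commute: "g \<in> carrier G \<Longrightarrow> z [^] (i :: nat) \<otimes> g = g \<otimes> z [^] i"
  by (rule gen_z_commute) (auto simp: gen_z)

text \<open>The power rules compute the commutator with the test element on the left, whereas
  \<open>pairing\<close> asks for it on the right.\<close>

lemma swap:
  assumes "a \<in> carrier G" "g \<in> carrier G" "a \<otimes> g = g \<otimes> a \<otimes> z [^] (j :: nat)"
  shows "g \<otimes> a = a \<otimes> g \<otimes> inv (z [^] j)"
  unfolding assms(3) using assms(1,2) by (simp add: m_assoc)

text \<open>For central g = w^j x^i, commuting with \<open>b\<close> gives z^j = 1; then, with j = p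
  k, commuting with \<open>x\<close> gives z^k = 1, so w^j = 1. Finally, commuting with
  \<open>w\<close> gives b^i = 1, which leaves a power of x^(p^2).\<close>

lemma center_eq: "center G = generate G {z}"
proof
  show "generate G {z} \<subseteq> center G"
    using gen_z_commute generate_in_carrier[of "{z}"] by (auto intro!: centerI)
  show "center G \<subseteq> generate G {z}"
  proof
    fix g assume g: "g \<in> center G"
    have g_comm: "a \<otimes> g = g \<otimes> a" if "a \<in> carrier G" for a using center_commute[OF g that] by simp
    obtain i j :: nat where form: "g = w [^] j \<otimes> x [^] i"
      using center_carrier[OF g] unfolding gen_all by blast
    have "b \<otimes> x [^] i = x [^] i \<otimes> b" using nat_pow_comm[of x p i] by (simp add: b_def)
    then have "z [^] j = \<one>"
      using commuting_pow_eq_one[of b w "x [^] i" z j] bw zw g_comm[of b] by (simp add: form)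
    then obtain k where j: "j = p * k" using z_pow_dvd by (auto simp: dvd_def)
    have "x \<otimes> x [^] i = x [^] i \<otimes> x" using nat_pow_Suc2[of x i] by simp
    then have "z [^] k = \<one>"
      using commuting_pow_eq_one[of x "w [^] p" "x [^] i" z k] x_W z_commute[of "w [^] p"] g_comm[of x]
      by (simp add: form j nat_pow_pow[symmetric])
    then have "p ^ 2 dvd j" using z_pow_dvd[of k] by (auto simp: j power2_eq_square)
    then have gx: "g = x [^] i" using w_pow_eq_one[of j] by (simp add: form)
    have "w \<otimes> x [^] i \<otimes> b [^] i = w \<otimes> x [^] i" using pow_x_w[of i] g_comm[of w] by (simp add: gx)
    then have "b [^] i = \<one>" using l_cancel_one[of "w \<otimes> x [^] i" "b [^] i"] by simp
    then have "p ^ 3 dvd p * i" using x_pow_dvd[of "p * i"] by (simp add: b_def nat_pow_pow)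
    then have "p ^ 2 dvd i" using p_pos by (simp add: power2_eq_square power3_eq_cube)
    then show "g \<in> generate G {z}" unfolding gen_z gx by (auto simp: z_def nat_pow_pow dvd_def)
  qed
qed

lemma polarization: "polarization G p (generate G {w, z}) (generate G {w})"
proof (intro polarization.intro polarization_axioms.intro is_group)
  show "Factorial_Ring.prime p" "Coset.order G = p ^ 5" by (fact prime_p order_G)+
  show "card (center G) = p" "card (generate G {w, z}) = p ^ 3"
      by (simp_all add: center_eq card_z card_wz)
  show "subgroup (generate G {w, z}) G" "subgroup (generate G {w}) G"
    by (rule generate_is_subgroup; simp)+
  show "center G \<subseteq> generate G {w, z}" unfolding center_eq by (rule mono_generate) auto
  show "generate G {w} \<subseteq> generate G {w, z}" by (rule mono_generate) auto
  show "f \<otimes> g = g \<otimes> f" if f: "f \<in> generate G {w, z}" and g: "g \<in> generate G {w, z}" for f g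
  proof (rule commute_generate[of "{w, z}"])
    show fc: "f \<in> carrier G" using generate_in_carrier[OF _ f] by simp
    show "f \<otimes> a = a \<otimes> f" if a: "a \<in> {w, z}" for a
    proof -
      have "a \<otimes> f = f \<otimes> a"
        by (rule commute_generate[of "{w, z}"]) (use a f zw in auto)
      then show ?thesis by simp
    qed
  qed (use g in auto)
  show "generate G {w} \<inter> center G = {\<one>}"
  proof
    show "{\<one>} \<subseteq> generate G {w} \<inter> center G"
      unfolding center_eq using generate.one[of G] by auto
    show "generate G {w} \<inter> center G \<subseteq> {\<one>}"
      unfolding center_eq gen_w using w_pow_dvd[OF z_gen_x] w_pow_eq_one by auto
  qed
  show "\<exists>n\<in>generate G {w}. \<exists>y\<in>center G. h = n \<otimes> y" if "h \<in> generate G {w, z}" for h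
    using that unfolding center_eq gen_w gen_z gen_wz by blast
  show "\<exists>y\<in>carrier G. \<exists>c\<in>center G. c \<noteq> \<one> \<and> h \<otimes> y = y \<otimes> h \<otimes> c"
    if h: "h \<in> generate G {w, z}" "h \<notin> center G" for h
  proof -
    obtain i j :: nat where form: "h = w [^] j \<otimes> z [^] i" using h(1) unfolding gen_wz by blast
    have hG: "h \<in> carrier G" by (simp add: form)
    \<comment> \<open>The test element \<open>a\<close> is \<open>b\<close> with k = j when p does
      not divide j, and \<open>x\<close> with k = j / p when it does.\<close>
    have pairing: ?thesis if a: "a \<in> carrier G" and aw: "a \<otimes> w [^] j = w [^] j \<otimes> a \<otimes> z [^] k"
        and "\<not> p dvd k" for a k
    proof -
      have "a \<otimes> h = w [^] j \<otimes> a \<otimes> (z [^] k \<otimes> z [^] i)"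
        using a by (simp add: form m_assoc[symmetric] aw)
      also have "\<dots> = w [^] j \<otimes> (a \<otimes> z [^] i) \<otimes> z [^] k"
        using a by (simp add: nat_pow_comm[of z k i] m_assoc)
      also have "\<dots> = h \<otimes> a \<otimes> z [^] k"
        unfolding z_pow_commute[OF a, symmetric] using a by (simp add: form m_assoc)
      finally have "h \<otimes> a = a \<otimes> h \<otimes> inv (z [^] k)"
        using swap[of a h k] a hG by simp
      moreover have "z [^] k \<in> center G" unfolding center_eq gen_z by blast
      then have "inv (z [^] k) \<in> center G" using subgroup.m_inv_closed[OF center_subgroup] by blast
      moreover have "inv (z [^] k) \<noteq> \<one>" using z_pow_dvd \<open>\<not> p dvd k\<close> by auto
      ultimately show ?thesis using a by blast
    qed
    show ?thesis
    proof (cases "p dvd j")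
      case False
      then show ?thesis using pairing[OF _ b_pow_w] by simp
    next
      case True
      then obtain k where j: "j = p * k" by (auto simp: dvd_def)
      have "\<not> p dvd k"
      proof
        assume "p dvd k"
        then have "p ^ 2 dvd j" by (auto simp: j power2_eq_square)
        then have "h = z [^] i" using w_pow_eq_one[of j] by (simp add: form)
        then show False using h(2) unfolding center_eq gen_z by blast
      qed
      then show ?thesis using pairing[of x k] x_pow_W[of k] by (simp add: j nat_pow_pow)
    qed
  qed
qed

end

section \<open>Isoclinism\<close>

lemma (in group) commutator_closed [simp]:
  "x \<in> carrier G \<Longrightarrow> y \<in> carrier G \<Longrightarrow> commutator G x y \<in> carrier G"
  by (simp add: commutator_def)

lemma (in group) commutator_swap:
  assumes "x \<in> carrier G" "y \<in> carrier G"
  shows "x \<otimes> y = y \<otimes> x \<otimes> commutator G x y"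
proof -
  have "y \<otimes> x \<otimes> commutator G x y = y \<otimes> (x \<otimes> inv x) \<otimes> inv y \<otimes> x \<otimes> y"
    using assms unfolding commutator_def by (simp only: m_assoc m_closed inv_closed)
  then show ?thesis using assms by simp
qed

lemma (in group) commutator_eqI:
  assumes "x \<in> carrier G" "y \<in> carrier G" "c \<in> carrier G" "x \<otimes> y = y \<otimes> x \<otimes> c"
  shows "commutator G x y = c"
proof -
  have "y \<otimes> x \<otimes> commutator G x y = y \<otimes> x \<otimes> c" using commutator_swap[OF assms(1,2)] assms(4) by simp
  then show ?thesis
    using assms(1-3) Units_l_cancel[of "y \<otimes> x" "commutator G x y" c] by (simp add: Units_eq)
qed

lemma (in group) commutator_eq_one_iff:
  assumes "x \<in> carrier G" "y \<in> carrier G"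
  shows "commutator G x y = \<one> \<longleftrightarrow> x \<otimes> y = y \<otimes> x"
  using commutator_swap[OF assms] commutator_eqI[OF assms one_closed] assms by auto

text \<open>\<open>derived\<close> is built from the products
  \<open>h1 \<otimes> h2 \<otimes> inv h1 \<otimes> inv h2\<close>; replacing both elements by their
  inverses turns one convention into the other.\<close>

lemma (in group) derived_eq_generate_commutators:
  "derived G (carrier G) = generate G {commutator G x y | x y. x \<in> carrier G \<and> y \<in> carrier G}"
proof -
  have "(\<Union>h1\<in>carrier G. \<Union>h2\<in>carrier G. {h1 \<otimes> h2 \<otimes> inv h1 \<otimes> inv h2})
    = {commutator G x y | x y. x \<in> carrier G \<and> y \<in> carrier G}"
  proof (intro subset_antisym subsetI)
    fix c assume "c \<in> (\<Union>h1\<in>carrier G. \<Union>h2\<in>carrier G. {h1 \<otimes> h2 \<otimes> inv h1 \<otimes> inv h2})"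
    then obtain h1 h2 where h: "h1 \<in> carrier G" "h2 \<in> carrier G" "c = h1 \<otimes> h2 \<otimes> inv h1 \<otimes> inv h2"
        by blast
    then have "c = commutator G (inv h1) (inv h2)" by (simp add: commutator_def)
    moreover have "inv h1 \<in> carrier G" "inv h2 \<in> carrier G" using h by auto
    ultimately show "c \<in> {commutator G x y | x y. x \<in> carrier G \<and> y \<in> carrier G}" by blast
  next
    fix c assume "c \<in> {commutator G x y | x y. x \<in> carrier G \<and> y \<in> carrier G}"
    then obtain x y where xy: "x \<in> carrier G" "y \<in> carrier G" "c = commutator G x y" by blast
    then have "c = inv x \<otimes> inv y \<otimes> inv (inv x) \<otimes> inv (inv y)" by (simp add: commutator_def)
    then show "c \<in> (\<Union>h1\<in>carrier G. \<Union>h2\<in>carrier G. {h1 \<otimes> h2 \<otimes> inv h1 \<otimes> inv h2})"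
      using inv_closed[OF xy(1)] inv_closed[OF xy(2)] by blast
  qed
  then show ?thesis by (simp add: derived_def)
qed

lemma (in group_hom) hom_commutator:
  assumes "x \<in> carrier G" "y \<in> carrier G"
  shows "h (commutator G x y) = commutator H (h x) (h y)"
  using assms by (simp add: commutator_def)

lemma (in group) center_normal: "center G \<lhd> G"
proof (rule normal_invI[OF center_subgroup])
  fix x h assume x: "x \<in> carrier G" and h: "h \<in> center G"
  have "x \<otimes> h \<otimes> inv x = h"
    unfolding center_commute[OF h x, symmetric] using x center_carrier[OF h] by (simp add: m_assoc)
  then show "x \<otimes> h \<otimes> inv x \<in> center G" using h by simp
qed

locale isoclinism = G: group G + K: group K for G (structure) and K (structure) +
  fixes \<theta> \<phi>
  assumes theta: "\<theta> \<in> iso (G Mod center G) (K Mod center K)"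
    and phi: "\<phi> \<in> iso (G\<lparr>carrier := derived_subgroup G\<rparr>) (K\<lparr>carrier := derived_subgroup K\<rparr>)"
    and compatible: "\<And>g1 g2 k1 k2. g1 \<in> carrier G \<Longrightarrow> g2 \<in> carrier G \<Longrightarrow> k1 \<in> carrier K \<Longrightarrow> k2 \<in> carrier K \<Longrightarrow>
      \<theta> (center G #>\<^bsub>G\<^esub> g1) = center K #>\<^bsub>K\<^esub> k1 \<Longrightarrow> \<theta> (center G #>\<^bsub>G\<^esub> g2) = center K #>\<^bsub>K\<^esub> k2 \<Longrightarrow>
      \<phi> (commutator G g1 g2) = commutator K k1 k2"
begin

abbreviation "G' \<equiv> derived_subgroup G"
abbreviation "K' \<equiv> derived_subgroup K"

text \<open>Both groups are compared inside the quotient of \<open>K\<close> by its centre: \<alpha>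
  and \<beta> map \<open>G\<close> and \<open>K\<close> there, and \<open>compatible\<close> relates
  elements with the same image.\<close>

definition \<alpha> where "\<alpha> g = \<theta> (center G #>\<^bsub>G\<^esub> g)"
definition \<beta> where "\<beta> k = center K #>\<^bsub>K\<^esub> k"

lemma alpha_hom: "group_hom G (K Mod center K) \<alpha>"
proof -
  have "(#>\<^bsub>G\<^esub>) (center G) \<in> hom G (G Mod center G)"
    by (rule normal.r_coset_hom_Mod[OF G.center_normal])
  moreover have "\<theta> \<in> hom (G Mod center G) (K Mod center K)" using theta by (simp add: iso_def)
  ultimately have "\<theta> \<circ> (#>\<^bsub>G\<^esub>) (center G) \<in> hom G (K Mod center K)" by (rule hom_compose)
  moreover have "\<theta> \<circ> (#>\<^bsub>G\<^esub>) (center G) = \<alpha>" by (rule ext) (simp add: \<alpha>_def)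
  ultimately have "\<alpha> \<in> hom G (K Mod center K)" by simp
  then show ?thesis
    using G.is_group normal.factorgroup_is_group[OF K.center_normal]
    by (simp add: group_hom_def group_hom_axioms_def)
qed

lemma beta_hom: "group_hom K (K Mod center K) \<beta>"
proof -
  have "(#>\<^bsub>K\<^esub>) (center K) \<in> hom K (K Mod center K)"
    by (rule normal.r_coset_hom_Mod[OF K.center_normal])
  moreover have "(#>\<^bsub>K\<^esub>) (center K) = \<beta>" by (rule ext) (simp add: \<beta>_def)
  ultimately have "\<beta> \<in> hom K (K Mod center K)" by simp
  then show ?thesis
    using K.is_group normal.factorgroup_is_group[OF K.center_normal]
    by (simp add: group_hom_def group_hom_axioms_def)
qed

lemma alpha_surj:
  assumes "k \<in> carrier K"
  obtains g where "g \<in> carrier G" "\<alpha> g = \<beta> k"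
proof -
  have "\<beta> k \<in> carrier (K Mod center K)" using assms by (auto simp: \<beta>_def carrier_FactGroup)
  moreover have "\<theta> ` carrier (G Mod center G) = carrier (K Mod center K)"
    using theta by (simp add: iso_def bij_betw_def)
  ultimately obtain X where "X \<in> carrier (G Mod center G)" "\<theta> X = \<beta> k"
    by (metis imageE)
  then show ?thesis using that by (auto simp: carrier_FactGroup \<alpha>_def)
qed

lemma beta_surj:
  assumes "g \<in> carrier G"
  obtains k where "k \<in> carrier K" "\<alpha> g = \<beta> k"
proof -
  have "center G #>\<^bsub>G\<^esub> g \<in> carrier (G Mod center G)" using assms by (auto simp: carrier_FactGroup)
  then have "\<alpha> g \<in> carrier (K Mod center K)"
    using theta unfolding iso_def bij_betw_def \<alpha>_def by auto
  then show ?thesis using that by (auto simp: carrier_FactGroup \<beta>_def)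
qed

lemma alpha_one_iff:
  assumes g: "g \<in> carrier G"
  shows "\<alpha> g = \<one>\<^bsub>K Mod center K\<^esub> \<longleftrightarrow> g \<in> center G"
proof -
  have "\<theta> \<one>\<^bsub>G Mod center G\<^esub> = \<one>\<^bsub>K Mod center K\<^esub>"
    using theta normal.factorgroup_is_group[OF G.center_normal] normal.factorgroup_is_group[OF
        K.center_normal]
    by (intro hom_one) (auto simp: iso_def)
  moreover have "inj_on \<theta> (carrier (G Mod center G))" using theta by (simp add: iso_def bij_betw_def)
  moreover have "center G #>\<^bsub>G\<^esub> g \<in> carrier (G Mod center G)" using g by (auto simp: carrier_FactGroup)
  moreover have "\<one>\<^bsub>G Mod center G\<^esub> \<in> carrier (G Mod center G)"
    using normal.factorgroup_is_group[OF G.center_normal]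
        by (rule group.is_monoid[THEN monoid.one_closed])
  ultimately have "\<alpha> g = \<one>\<^bsub>K Mod center K\<^esub> \<longleftrightarrow> center G #>\<^bsub>G\<^esub> g = center G"
    unfolding \<alpha>_def by (metis inj_onD one_FactGroup)
  also have "\<dots> \<longleftrightarrow> g \<in> center G"
    using G.coset_join1[OF _ g G.center_subgroup] G.coset_join2[OF g G.center_subgroup]
      subgroup.subset[OF G.center_subgroup] by blast
  finally show ?thesis .
qed

lemma beta_one_iff:
  assumes k: "k \<in> carrier K"
  shows "\<beta> k = \<one>\<^bsub>K Mod center K\<^esub> \<longleftrightarrow> k \<in> center K"
  using K.coset_join1[OF _ k K.center_subgroup] K.coset_join2[OF k K.center_subgroup]
    subgroup.subset[OF K.center_subgroup] by (auto simp: \<beta>_def)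

lemma phi_mult: "x \<in> G' \<Longrightarrow> y \<in> G' \<Longrightarrow> \<phi> (x \<otimes>\<^bsub>G\<^esub> y) = \<phi> x \<otimes>\<^bsub>K\<^esub> \<phi> y"
  using phi by (auto simp: iso_def hom_def)

lemma phi_bij: "bij_betw \<phi> G' K'" using phi by (simp add: iso_def)

lemma phi_inj: "x \<in> G' \<Longrightarrow> y \<in> G' \<Longrightarrow> \<phi> x = \<phi> y \<Longrightarrow> x = y"
  using phi_bij by (auto simp: bij_betw_def dest: inj_onD)

lemma phi_closed: "x \<in> G' \<Longrightarrow> \<phi> x \<in> K'" using bij_betwE[OF phi_bij] by blast

lemma phi_surj:
  assumes "k \<in> K'"
  obtains g where "g \<in> G'" "\<phi> g = k"
  using assms bij_betw_imp_surj_on[OF phi_bij] that by (metis imageE)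

lemma subgroup_G': "subgroup G' G" by (rule G.derived_is_subgroup) simp
lemma subgroup_K': "subgroup K' K" by (rule K.derived_is_subgroup) simp

lemma G'_carrier: "x \<in> G' \<Longrightarrow> x \<in> carrier G" using subgroup.mem_carrier[OF subgroup_G'] .
lemma K'_carrier: "x \<in> K' \<Longrightarrow> x \<in> carrier K" using subgroup.mem_carrier[OF subgroup_K'] .

lemma phi_one: "\<phi> \<one>\<^bsub>G\<^esub> = \<one>\<^bsub>K\<^esub>"
proof -
  have one: "\<one>\<^bsub>G\<^esub> \<in> G'" using subgroup.one_closed[OF subgroup_G'] .
  have "\<phi> \<one>\<^bsub>G\<^esub> \<otimes>\<^bsub>K\<^esub> \<phi> \<one>\<^bsub>G\<^esub> = \<phi> \<one>\<^bsub>G\<^esub>" using phi_mult[OF one one] by simp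
  then show ?thesis using K'_carrier[OF phi_closed[OF one]] by (simp add: K.l_cancel_one)
qed

lemma phi_inv: "x \<in> G' \<Longrightarrow> \<phi> (inv\<^bsub>G\<^esub> x) = inv\<^bsub>K\<^esub> (\<phi> x)"
proof -
  assume x: "x \<in> G'"
  have ix: "inv\<^bsub>G\<^esub> x \<in> G'" using subgroup.m_inv_closed[OF subgroup_G' x] .
  have "\<phi> (inv\<^bsub>G\<^esub> x) \<otimes>\<^bsub>K\<^esub> \<phi> x = \<one>\<^bsub>K\<^esub>"
    using phi_mult[OF ix x] G'_carrier[OF x] phi_one by simp
  then show ?thesis
    using K.inv_equality[of "\<phi> (inv\<^bsub>G\<^esub> x)"
        "\<phi> x"] K'_carrier[OF phi_closed[OF x]] K'_carrier[OF phi_closed[OF ix]] by simp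
qed

lemma phi_pow: "x \<in> G' \<Longrightarrow> \<phi> (x [^]\<^bsub>G\<^esub> (n :: nat)) = \<phi> x [^]\<^bsub>K\<^esub> n"
proof (induction n)
  case (Suc n)
  have "x [^]\<^bsub>G\<^esub> n \<in> G'"
    using Suc.prems by (induction n) (auto intro: subgroup.one_closed[OF subgroup_G']
        subgroup.m_closed[OF subgroup_G'])
  then show ?case using Suc phi_mult by simp
qed (simp add: phi_one)

lemma commutator_mem: "x \<in> carrier G \<Longrightarrow> y \<in> carrier G \<Longrightarrow> commutator G x y \<in> G'"
  unfolding G.derived_eq_generate_commutators by (intro generate.incl) blast

text \<open>The definition ties \<phi> to \<theta> only through commutators of arbitrary elements.
  On a single commutator both sides are the commutator of the same two cosets, and multiplicativity
  extends this to the derived subgroup. Consequently \<phi> respects centrality.\<close>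

lemma alpha_eq_beta_phi:
  assumes "c \<in> G'"
  shows "\<alpha> c = \<beta> (\<phi> c)"
proof -
  interpret A: group_hom G "K Mod center K" \<alpha> by (rule alpha_hom)
  interpret B: group_hom K "K Mod center K" \<beta> by (rule beta_hom)
  have comm: "\<alpha> (commutator G x y) = \<beta> (\<phi> (commutator G x y))" if xy: "x \<in> carrier G"
      "y \<in> carrier G" for x y
  proof -
    obtain k l where k: "k \<in> carrier K" "\<alpha> x = \<beta> k" and l: "l \<in> carrier K" "\<alpha> y = \<beta> l"
      using beta_surj xy by metis
    have "\<phi> (commutator G x y) = commutator K k l"
      using compatible[of x y k l] xy k l by (simp add: \<alpha>_def \<beta>_def)
    then show ?thesis
      by (simp add: A.hom_commutator[OF xy] B.hom_commutator[OF k(1) l(1)] k(2) l(2))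
  qed
  have "c \<in> generate G {commutator G x y | x y. x \<in> carrier G \<and> y \<in> carrier G}"
    using assms unfolding G.derived_eq_generate_commutators .
  then show ?thesis
  proof (induction rule: generate.induct)
    case one
    then show ?case by (simp add: phi_one)
  next
    case (incl h)
    then show ?case using comm by auto
  next
    case (inv h)
    then obtain x y where xy: "x \<in> carrier G" "y \<in> carrier G" "h = commutator G x y" by blast
    have h: "h \<in> G'" using commutator_mem xy by simp
    have "\<alpha> h = \<beta> (\<phi> h)" using comm xy by simp
    then show ?case
      using G'_carrier[OF h] K'_carrier[OF phi_closed[OF h]] by (simp add: phi_inv[OF h])
  next
    case (eng h1 h2)
    have h: "h1 \<in> G'" "h2 \<in> G'" using eng.hyps unfolding G.derived_eq_generate_commutators by auto
    then show ?case
      using eng.IH G'_carrier[OF h(1)] G'_carrier[OF h(2)] K'_carrier[OF phi_closed[OF h(1)]]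
        K'_carrier[OF phi_closed[OF h(2)]]
      by (simp add: phi_mult)
  qed
qed

lemma phi_center_iff: "c \<in> G' \<Longrightarrow> \<phi> c \<in> center K \<longleftrightarrow> c \<in> center G"
  using alpha_one_iff[OF G'_carrier] beta_one_iff[OF K'_carrier[OF phi_closed]] alpha_eq_beta_phi
      by metis

lemma card_center_eq:
  assumes "finite (carrier G)" "Coset.order G = Coset.order K"
  shows "card (center G) = card (center K)"
proof -
  have "card (rcosets\<^bsub>G\<^esub> center G) = card (rcosets\<^bsub>K\<^esub> center K)"
    using theta bij_betw_same_card[of \<theta>] by (auto simp: iso_def FactGroup_def)
  moreover have "card (rcosets\<^bsub>G\<^esub> center G) * card (center G) = card (rcosets\<^bsub>K\<^esub> center K) * card
      (center K)"
    using G.lagrange[OF G.center_subgroup] K.lagrange[OF K.center_subgroup] assms(2) by simp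
  moreover have "card (rcosets\<^bsub>G\<^esub> center G) > 0"
    using G.lagrange[OF G.center_subgroup] assms(1) G.order_gt_0_iff_finite by (metis mult_0 not_gr0)
  ultimately show ?thesis by simp
qed

text \<open>Everything inside the derived subgroup is pulled back along \<phi>; only the conjugating
  elements of \<open>pairing\<close> come from outside, and they are lifted along \<theta>.\<close>

lemma polarization_transfer:
  assumes pol: "polarization K p K' N" and order: "Coset.order G = p ^ 5"
  shows "polarization G p G' {h \<in> G'. \<phi> h \<in> N}"
proof -
  interpret P: polarization K p K' N by (rule pol)
  have fin: "finite (carrier G)"
    using order P.p_gt_1 by (intro G.order_gt_0_iff_finite[THEN iffD1]) simp
  have card: "card (center G) = p"
    using card_center_eq[OF fin] order P.order_G P.card_center by simp
  have card_G': "card G' = p ^ 3" using bij_betw_same_card[OF phi_bij] P.card_H by simp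
  \<comment> \<open>That the centre lies in the derived subgroup is obtained by counting: their
    intersection corresponds to the centre of \<open>K\<close>, which has p elements, as many as the
    centre of \<open>G\<close>.\<close>
  have "\<phi> ` (G' \<inter> center G) = center K"
  proof (intro subset_antisym subsetI)
    fix k assume k: "k \<in> center K"
    then obtain g where "g \<in> G'" "\<phi> g = k" using P.center_subset phi_surj by blast
    then show "k \<in> \<phi> ` (G' \<inter> center G)" using phi_center_iff k by auto
  qed (use phi_center_iff in auto)
  moreover have "inj_on \<phi> (G' \<inter> center G)" using phi_inj by (auto intro: inj_onI)
  ultimately have "card (G' \<inter> center G) = card (center G)"
    using card_image[of \<phi> "G' \<inter> center G"] card P.card_center by simp
  then have center_sub: "center G \<subseteq> G'"
    using card_subset_eq[of "center G" "G' \<inter> center G"] card P.p_gt_1 card.infinite[of "center G"]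
        by fastforce
  note NK = subgroup.one_closed[OF P.subgroup_N] subgroup.m_closed[OF P.subgroup_N]
      subgroup.m_inv_closed[OF P.subgroup_N]
  show ?thesis
  proof (intro polarization.intro polarization_axioms.intro G.is_group)
    show "Factorial_Ring.prime p" by (rule P.prime_p)
    show "Coset.order G = p ^ 5" "card (center G) = p" "card G' = p ^ 3" "subgroup G' G" "center G \<subseteq> G'"
      by (fact order card card_G' subgroup_G' center_sub)+
    show "x \<otimes>\<^bsub>G\<^esub> y = y \<otimes>\<^bsub>G\<^esub> x" if "x \<in> G'" "y \<in> G'" for x y
    proof (rule phi_inj)
      show "\<phi> (x \<otimes>\<^bsub>G\<^esub> y) = \<phi> (y \<otimes>\<^bsub>G\<^esub> x)"
        unfolding phi_mult[OF that] phi_mult[OF that(2,1)]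
        by (rule P.H_commute) (use that phi_closed in auto)
    qed (use that subgroup.m_closed[OF subgroup_G'] in auto)
    show "subgroup {h \<in> G'. \<phi> h \<in> N} G"
    proof (rule G.subgroupI)
      show "{h \<in> G'. \<phi> h \<in> N} \<subseteq> carrier G" using G'_carrier by blast
      have "\<one>\<^bsub>G\<^esub> \<in> {h \<in> G'. \<phi> h \<in> N}"
        using subgroup.one_closed[OF subgroup_G'] phi_one NK(1) by simp
      then show "{h \<in> G'. \<phi> h \<in> N} \<noteq> {}" by blast
    qed (use subgroup.m_inv_closed[OF subgroup_G'] subgroup.m_closed[OF subgroup_G'] NK phi_inv
        phi_mult in auto)
    show "{h \<in> G'. \<phi> h \<in> N} \<subseteq> G'" by blast
    show "{h \<in> G'. \<phi> h \<in> N} \<inter> center G = {\<one>\<^bsub>G\<^esub>}"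
    proof
      show "{\<one>\<^bsub>G\<^esub>} \<subseteq> {h \<in> G'. \<phi> h \<in> N} \<inter> center G"
        using subgroup.one_closed[OF subgroup_G'] subgroup.one_closed[OF G.center_subgroup] phi_one
            NK(1) by simp
      show "{h \<in> G'. \<phi> h \<in> N} \<inter> center G \<subseteq> {\<one>\<^bsub>G\<^esub>}"
      proof
        fix h assume h: "h \<in> {h \<in> G'. \<phi> h \<in> N} \<inter> center G"
        then have "\<phi> h \<in> N \<inter> center K" using phi_center_iff by auto
        then have "\<phi> h = \<phi> \<one>\<^bsub>G\<^esub>" using P.N_Int_center phi_one by auto
        then show "h \<in> {\<one>\<^bsub>G\<^esub>}" using phi_inj[of h "\<one>\<^bsub>G\<^esub>"] h subgroup.one_closed[OF subgroup_G'] by simp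
      qed
    qed
    show "\<exists>n\<in>{h \<in> G'. \<phi> h \<in> N}. \<exists>z\<in>center G. h = n \<otimes>\<^bsub>G\<^esub> z" if h: "h \<in> G'" for h
    proof -
      obtain n z where nz: "n \<in> N" "z \<in> center K" "\<phi> h = n \<otimes>\<^bsub>K\<^esub> z"
          using P.H_factor[OF phi_closed[OF h]] by blast
      obtain n' z' where n': "n' \<in> G'" "\<phi> n' = n" and z': "z' \<in> G'" "\<phi> z' = z"
        using phi_surj nz(1,2) P.N_subset P.center_subset by (metis subsetD)
      have "h = n' \<otimes>\<^bsub>G\<^esub> z'"
        by (rule phi_inj)
          (use h n' z' nz(3) phi_mult subgroup.m_closed[OF subgroup_G'] in auto)
      moreover have "z' \<in> center G" using phi_center_iff[OF z'(1)] z'(2) nz(2) by simp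
      ultimately show ?thesis using n' nz(1) by blast
    qed
    show "\<exists>y\<in>carrier G. \<exists>z\<in>center G. z \<noteq> \<one>\<^bsub>G\<^esub> \<and> h \<otimes>\<^bsub>G\<^esub> y = y \<otimes>\<^bsub>G\<^esub> h \<otimes>\<^bsub>G\<^esub> z"
      if h: "h \<in> G'" "h \<notin> center G" for h
    proof -
      have ph: "\<phi> h \<in> K'" "\<phi> h \<notin> center K" using phi_closed[OF h(1)] phi_center_iff[OF h(1)] h(2)
          by auto
      obtain k z where k: "k \<in> carrier K" and z: "z \<in> center K" "z \<noteq> \<one>\<^bsub>K\<^esub>"
        "\<phi> h \<otimes>\<^bsub>K\<^esub> k = k \<otimes>\<^bsub>K\<^esub> \<phi> h \<otimes>\<^bsub>K\<^esub> z" using P.pairing[OF ph] by blast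
      \<comment> \<open>Any preimage of the coset of \<open>k\<close> will do: since
        \<open>h\<close> and \<open>\<phi> h\<close> agree modulo the centres, \<phi> sends the
        commutator of \<open>h\<close> and \<open>y\<close> to that of \<open>\<phi> h\<close> and
        \<open>k\<close>.\<close>
      obtain y where y: "y \<in> carrier G" "\<alpha> y = \<beta> k" using alpha_surj[OF k] .
      have "commutator K (\<phi> h) k = z"
        by (rule K.commutator_eqI[OF K'_carrier[OF ph(1)] k center_carrier[OF z(1)] z(3)])
      moreover have "\<phi> (commutator G h y) = commutator K (\<phi> h) k"
        using compatible[OF G'_carrier[OF h(1)] y(1) K'_carrier[OF ph(1)] k] alpha_eq_beta_phi[OF
            h(1)] y(2)
        by (simp add: \<alpha>_def \<beta>_def)
      ultimately have phi_c: "\<phi> (commutator G h y) = z" by simp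
      have mem: "commutator G h y \<in> G'" using commutator_mem[OF G'_carrier[OF h(1)] y(1)] .
      have "commutator G h y \<in> center G" using phi_center_iff[OF mem] phi_c z(1) by simp
      moreover have "commutator G h y \<noteq> \<one>\<^bsub>G\<^esub>" using phi_c phi_one z(2) by auto
      ultimately show ?thesis
        using G.commutator_swap[OF G'_carrier[OF h(1)] y(1)] y(1) by blast
    qed
  qed
qed

end

section \<open>Locating the derived subgroup\<close>

lemma (in group) derived_subset_normal:
  assumes N: "N \<lhd> G" and S: "S \<subseteq> carrier G" "generate G S = carrier G"
    and comm: "\<And>x y. x \<in> S \<Longrightarrow> y \<in> S \<Longrightarrow> commutator G x y \<in> N"
  shows "derived G (carrier G) \<subseteq> N"
proof -
  interpret Q: group "G Mod N" by (rule normal.factorgroup_is_group[OF N])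
  interpret \<pi>: group_hom G "G Mod N" "\<lambda>x. N #> x"
    using normal.r_coset_hom_Mod[OF N] by unfold_locales
  have sub: "subgroup N G" using N by (rule normal_imp_subgroup)
  have one_iff: "N #> x = \<one>\<^bsub>G Mod N\<^esub> \<longleftrightarrow> x \<in> N" if "x \<in> carrier G" for x
    using coset_join1[OF _ that sub] coset_join2[OF that sub] subgroup.subset[OF sub] by auto
  have img: "generate (G Mod N) ((\<lambda>x. N #> x) ` S) = (\<lambda>x. N #> x) ` carrier G"
    using \<pi>.generate_img[OF S(1)] S(2) by simp
  have carr: "(\<lambda>x. N #> x) ` S \<subseteq> carrier (G Mod N)" using S(1) by auto
  \<comment> \<open>The quotient is shown to be abelian in two passes: images of generators commute
    with everything, and then so does everything else.\<close>
  have commute_S: "(N #> x) \<otimes>\<^bsub>G Mod N\<^esub> (N #> y) = (N #> y) \<otimes>\<^bsub>G Mod N\<^esub> (N #> x)"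
    if x: "x \<in> S" and y: "y \<in> carrier G" for x y
  proof (rule Q.commute_generate[OF carr])
    have xG: "x \<in> carrier G" using x S(1) by blast
    show "N #> x \<in> carrier (G Mod N)" using xG by simp
    show "N #> y \<in> generate (G Mod N) ((\<lambda>x. N #> x) ` S)" unfolding img using y by blast
    fix X assume "X \<in> (\<lambda>x. N #> x) ` S"
    then obtain s where s: "s \<in> S" "X = N #> s" by blast
    then have sG: "s \<in> carrier G" using S(1) by blast
    have "commutator (G Mod N) (N #> x) X = \<one>\<^bsub>G Mod N\<^esub>"
      using \<pi>.hom_commutator[OF xG sG] one_iff[of "commutator G x s"] comm[OF x s(1)] xG sG
      by (simp add: s(2))
    then show "(N #> x) \<otimes>\<^bsub>G Mod N\<^esub> X = X \<otimes>\<^bsub>G Mod N\<^esub> (N #> x)"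
      using Q.commutator_eq_one_iff[of "N #> x" X] \<pi>.hom_closed[OF xG] \<pi>.hom_closed[OF sG] s(2) by blast
  qed
  have commute: "(N #> y) \<otimes>\<^bsub>G Mod N\<^esub> (N #> x) = (N #> x) \<otimes>\<^bsub>G Mod N\<^esub> (N #> y)"
    if x: "x \<in> carrier G" and y: "y \<in> carrier G" for x y
  proof (rule Q.commute_generate[OF carr])
    show "N #> y \<in> carrier (G Mod N)" using y by simp
    show "N #> x \<in> generate (G Mod N) ((\<lambda>x. N #> x) ` S)" unfolding img using x by blast
    fix X assume "X \<in> (\<lambda>x. N #> x) ` S"
    then obtain s where s: "s \<in> S" "X = N #> s" by blast
    then show "(N #> y) \<otimes>\<^bsub>G Mod N\<^esub> X = X \<otimes>\<^bsub>G Mod N\<^esub> (N #> y)"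
      using commute_S[OF s(1) y] by simp
  qed
  have "commutator G x y \<in> N" if xy: "x \<in> carrier G" "y \<in> carrier G" for x y
  proof -
    have "commutator (G Mod N) (N #> x) (N #> y) = \<one>\<^bsub>G Mod N\<^esub>"
      using Q.commutator_eq_one_iff[OF \<pi>.hom_closed[OF xy(1)] \<pi>.hom_closed[OF xy(2)]] commute[OF
          xy(2,1)] by blast
    then show ?thesis using \<pi>.hom_commutator[OF xy] one_iff[of "commutator G x y"] xy by simp
  qed
  then show ?thesis
    unfolding derived_eq_generate_commutators using sub by (intro generate_subgroup_incl) auto
qed

context five_step begin

lemma conj_H:
  assumes "h \<in> generate G {u, v, z}" "x \<in> carrier G"
  shows "inv x \<otimes> h \<otimes> x \<in> generate G {u, v, z}"
proof -
  have sub: "subgroup (generate G {u, v, z}) G" by (rule generate_is_subgroup) simp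
  \<comment> \<open>\<open>conj_t\<close> only lands in the larger subgroup with \<open>s\<close>;
    here the commutators of \<open>u\<close> and \<open>v\<close> with \<open>t\<close> are seen to
    lie in the smaller one already.\<close>
  have t: "inv t \<otimes> k \<otimes> t \<in> generate G {u, v, z}" if "k \<in> {u, v, z}" for k
  proof -
    note incl = generate.incl[of _ "{u, v, z}" G]
    have "c \<in> generate G {u, v, z}" using c mono_generate[of "{v, z}" "{u, v, z}"] by auto
    then have "u \<otimes> c \<in> generate G {u, v, z}" "v \<otimes> z \<in> generate G {u, v, z}"
      using incl by (auto intro!: generate.eng)
    then show ?thesis
      using that conj_eq[of z t \<one>] conj_eq[of v t z] conj_eq[of u t c] c_closed z_comm v_comm u_comm
          incl[of z] by auto
  qed
  obtain i :: nat and g where x: "x = t [^] i \<otimes> g" "g \<in> generate G {s, u, v, z}"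
    using assms(2) unfolding gen_all by blast
  obtain j :: nat and k where g: "g = s [^] j \<otimes> k" "k \<in> generate G {u, v, z}"
    using x(2) unfolding gen_suvz by blast
  define h1 where "h1 = inv (t [^] i) \<otimes> h \<otimes> t [^] i"
  have h1: "h1 \<in> generate G {u, v, z}"
    unfolding h1_def by (rule conj_pow_generate[OF _ _ t assms(1)]) auto
  define h2 where "h2 = inv (s [^] j) \<otimes> h1 \<otimes> s [^] j"
  have h2: "h2 \<in> generate G {u, v, z}"
    unfolding h2_def by (rule conj_pow_generate[OF _ _ conj_s h1]) auto
  have "inv x \<otimes> h \<otimes> x = inv k \<otimes> h2 \<otimes> k"
    using gen_carrier(3)[OF assms(1)] gen_carrier(3)[OF g(2)]
    by (simp add: h2_def h1_def x(1) g(1) inv_mult_group m_assoc)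
  then show ?thesis
    using h2 g(2) subgroup.m_closed[OF sub] subgroup.m_inv_closed[OF sub] by simp
qed

lemma normal_H: "generate G {u, v, z} \<lhd> G"
proof (rule normal_invI)
  show "subgroup (generate G {u, v, z}) G" by (rule generate_is_subgroup) simp
  show "x \<otimes> h \<otimes> inv x \<in> generate G {u, v, z}" if "x \<in> carrier G" "h \<in> generate G {u, v, z}" for x h
    using conj_H[OF that(2), of "inv x"] that(1) by simp
qed

text \<open>The subgroup is normal and contains all generators except \<open>s\<close> and
  \<open>t\<close>, so the only commutator to be checked is \<open>d\<close>.\<close>

lemma derived_subset: "derived G (carrier G) \<subseteq> generate G {u, v, z}"
proof (rule derived_subset_normal[OF normal_H _ generators])
  let ?H = "generate G {u, v, z}"
  have sub: "subgroup ?H G" by (rule generate_is_subgroup) simp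
  have left: "commutator G h x \<in> ?H" if h: "h \<in> ?H" and x: "x \<in> carrier G" for h x
  proof -
    have "commutator G h x = inv h \<otimes> (inv x \<otimes> h \<otimes> x)"
      using gen_carrier(3)[OF h] x by (simp add: commutator_def m_assoc)
    then show ?thesis
      using conj_H[OF h x] h subgroup.m_closed[OF sub] subgroup.m_inv_closed[OF sub] by simp
  qed
  have right: "commutator G x h \<in> ?H" if h: "h \<in> ?H" and x: "x \<in> carrier G" for h x
  proof -
    have "commutator G x h = inv (commutator G h x)"
      using gen_carrier(3)[OF h] x by (simp add: commutator_def inv_mult_group m_assoc)
    then show ?thesis using left[OF h x] subgroup.m_inv_closed[OF sub] by simp
  qed
  have st: "commutator G s t = d" by (rule commutator_eqI) (simp_all add: d_closed s_comm)
  have "commutator G t s = inv (commutator G s t)"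
    by (simp add: commutator_def inv_mult_group m_assoc)
  then have ts: "commutator G t s \<in> ?H" using st d subgroup.m_inv_closed[OF sub] by simp
  have self: "commutator G x x = \<one>" if "x \<in> carrier G" for x
    by (rule commutator_eqI) (use that in simp_all)
  fix x y assume xy: "x \<in> {t, s, u, v, z}" "y \<in> {t, s, u, v, z}"
  have xyG: "x \<in> carrier G" "y \<in> carrier G" using xy by auto
  consider "x \<in> ?H" | "y \<in> ?H" | "x \<in> {t, s}" "y \<in> {t, s}"
    using xy generate.incl[of _ "{u, v, z}" G] by auto
  then show "commutator G x y \<in> ?H"
  proof cases
    case 1
    then show ?thesis using left xyG by blast
  next
    case 2
    then show ?thesis using right xyG by blast
  next
    case 3
    then show ?thesis using st ts d self generate.one[of G "{u, v, z}"] by auto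
  qed
qed simp

end

text \<open>An inverse of r modulo the group order undoes the r-th power.\<close>

lemma (in group) pow_coprime_inj:
  assumes "x \<in> carrier G" "y \<in> carrier G" "x [^] (r :: nat) = y [^] r" "coprime r (Coset.order G)"
      "r \<noteq> 0"
  shows "x = y"
proof -
  obtain a b where ab: "r * a = Coset.order G * b + gcd r (Coset.order G)"
    using bezout_nat[OF assms(5)] by blast
  have "g = (g [^] r) [^] a" if "g \<in> carrier G" for g
  proof -
    have "(g [^] r) [^] a = g [^] (Coset.order G * b + 1)"
      using that ab assms(4) by (simp add: nat_pow_pow)
    also have "\<dots> = (g [^] Coset.order G) [^] b \<otimes> g"
      using that by (simp add: nat_pow_pow)
    finally show ?thesis using that by (simp add: pow_order_eq_1)
  qed
  then show ?thesis using assms(1-3) by metis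
qed

text \<open>\<open>LEAST\<close> is meaningful only once a non-residue exists: squaring on residues
  is not injective for odd p, hence not surjective. Multiples of p are squares of 0 in the sense of
  \<open>QuadRes\<close>, so \<open>nu p\<close> is not one of them.\<close>

lemma nu_not_dvd:
  assumes p: "Factorial_Ring.prime p" "odd p"
  shows "nu p \<noteq> 0" "\<not> p dvd nu p"
proof -
  have p2: "p > 2" using p prime_gt_1_nat[OF p(1)] by (cases "p = 2") auto
  have "\<exists>n. n \<in> {0..<p} \<and> n \<notin> (\<lambda>y. y ^ 2 mod p) ` {0..<p}"
  proof (rule ccontr)
    assume "\<not> ?thesis"
    then have "{0..<p} \<subseteq> (\<lambda>y. y ^ 2 mod p) ` {0..<p}" by blast
    moreover have "(\<lambda>y. y ^ 2 mod p) ` {0..<p} \<subseteq> {0..<p}" using p2 by auto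
    ultimately have "(\<lambda>y. y ^ 2 mod p) ` {0..<p} = {0..<p}" by blast
    then have "inj_on (\<lambda>y. y ^ 2 mod p) {0..<p}" by (intro eq_card_imp_inj_on) auto
    moreover have "(p - 1) ^ 2 mod p = 1 ^ 2 mod p"
    proof -
      \<comment> \<open>The substitution avoids truncated subtraction in (p - 1)^2 = 1 + p (p - 2),
        which shows that 1 and p - 1 have the same square.\<close>
      obtain q where q: "p = q + 3" using p2 le_Suc_ex[of 3 p] by (auto simp: add.commute)
      have "(p - 1) ^ 2 = 1 + p * (q + 1)" by (simp add: q power2_eq_square algebra_simps)
      then show ?thesis using mod_mult_self2[of 1 p "q + 1"] by simp
    qed
    ultimately have "p - 1 = 1" using p2 inj_onD[of "\<lambda>y. y ^ 2 mod p" "{0..<p}" "p - 1" 1] by simp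
    then show False using p2 by simp
  qed
  then obtain n where n: "n < p" "n \<notin> (\<lambda>y. y ^ 2 mod p) ` {0..<p}" by auto
  have not_QR: "\<not> QuadRes (int p) (int n)"
  proof
    assume "QuadRes (int p) (int n)"
    then obtain y where "[y\<^sup>2 = int n] (mod int p)" by (auto simp: QuadRes_def)
    then have "[(nat (y mod int p))\<^sup>2 = n] (mod p)"
      using p2 by (simp add: cong_int_iff[symmetric] cong_def power_mod)
    then have "n = (nat (y mod int p))\<^sup>2 mod p" using n(1) by (simp add: cong_def)
    moreover have "nat (y mod int p) \<in> {0..<p}" using p2 by (simp add: nat_less_iff)
    ultimately show False using n(2) by blast
  qed
  have dvd_QR: "QuadRes (int p) (int m)" if "p dvd m" for m
    using that unfolding QuadRes_def cong_def by (intro exI[of _ 0]) auto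
  have "n \<noteq> 0" using not_QR dvd_QR[of 0] by (cases n) auto
  then have "0 < nu p \<and> \<not> QuadRes (int p) (int (nu p))"
    unfolding nu_def using not_QR by (intro LeastI[of "\<lambda>n. 0 < n \<and> \<not> QuadRes (int p) (int n)" n]) simp
  then show "nu p \<noteq> 0" "\<not> p dvd nu p" using dvd_QR by auto
qed

section \<open>Required pairs\<close>

text \<open>The roles of \<open>z\<close>, \<open>v\<close>, \<open>u\<close>, \<open>s\<close>,
  \<open>t\<close> are played by \<open>a3\<close>, \<open>a2\<close>, \<open>b\<close>,
  \<open>a1\<close>, \<open>a\<close>. The commutator of \<open>b\<close> with \<open>a1\<close> is
  the reverse of the given one, which is why \<open>y\<close> may be the inverse of
  \<open>z\<close>. Taking \<open>b\<close> as \<open>u\<close> requires its p-th power to be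
  trivial.\<close>

lemma Phi7_polarization_beta:
  fixes G (structure)
  assumes p: "Factorial_Ring.prime p" and G: "Phi7_common p G a a1 a2 a3 b"
    and comm: "commutator G a1 b = a3" and pow_b: "b [^]\<^bsub>G\<^esub> p = \<one>\<^bsub>G\<^esub>"
    and pow_a: "a [^]\<^bsub>G\<^esub> p \<in> generate G {a3}" and pow_a1: "a1 [^]\<^bsub>G\<^esub> p \<in> generate G {a3}"
  shows "center G = generate G {a3}" "polarization G p (generate G {a2, a3, b}) (generate G {b, a2})"
proof -
  interpret group G using G by (simp add: Phi7_common_def generated_p5_def)
  have carr: "a \<in> carrier G" "a1 \<in> carrier G" "a2 \<in> carrier G" "a3 \<in> carrier G" "b \<in> carrier G"
    and order: "Coset.order G = p ^ 5" and gen: "generate G {a, a1, a2, a3, b} = carrier G"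
    and c: "commutator G a1 a = a2" "commutator G a2 a = a3"
    and triv: "commutator G a3 a = \<one>" "commutator G a1 a2 = \<one>" "commutator G a1 a3 = \<one>"
        "commutator G a2 a3 = \<one>"
      "commutator G a b = \<one>" "commutator G a2 b = \<one>" "commutator G a3 b = \<one>"
    and pow: "a2 [^] p = \<one>" "a3 [^] p = \<one>"
    using G by (auto simp: Phi7_common_def generated_p5_def commuting_pairs_def)
  note swap = commutator_swap[of a1 a] commutator_swap[of a2 a] commutator_swap[of a1 b]
  note comm_iff = commutator_eq_one_iff[of a3 a] commutator_eq_one_iff[of a1 a2]
      commutator_eq_one_iff[of a1 a3]
    commutator_eq_one_iff[of a2 a3] commutator_eq_one_iff[of a b] commutator_eq_one_iff[of a2 b]
        commutator_eq_one_iff[of a3 b]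
  have commute: "a3 \<otimes> a = a \<otimes> a3" "a1 \<otimes> a2 = a2 \<otimes> a1" "a1 \<otimes> a3 = a3 \<otimes> a1" "a2 \<otimes> a3 = a3 \<otimes> a2"
      "a \<otimes> b = b \<otimes> a" "a2 \<otimes> b = b \<otimes> a2" "a3 \<otimes> b = b \<otimes> a3"
    using comm_iff carr triv by blast+
  have "a1 \<otimes> b \<otimes> inv a3 = b \<otimes> a1"
    using swap(3) carr comm by (simp add: m_assoc)
  then have ba1: "b \<otimes> a1 = a1 \<otimes> b \<otimes> inv a3" by simp
  interpret five_step G p a3 a2 b a1 a "inv a3" "\<one>" a2
  proof
    show "generate G {a, a1, b, a2, a3} = carrier G" using gen by (simp add: insert_commute)
    show "a1 [^] p \<in> generate G {b, a2, a3}" "a [^] p \<in> generate G {a1, b, a2, a3}"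
      using pow_a pow_a1 mono_generate[of "{a3}" "{b, a2, a3}"] mono_generate[of "{a3}"
          "{a1, b, a2, a3}"] by auto
    show "a1 \<otimes> a = a \<otimes> a1 \<otimes> a2" "a2 \<otimes> a = a \<otimes> a2 \<otimes> a3" using swap(1,2) carr c by auto
    show "b \<otimes> a = a \<otimes> b \<otimes> \<one>" using commute(5) carr by simp
    show "\<one> \<in> generate G {a2, a3}" by (rule generate.one)
    show "a2 \<in> generate G {b, a2, a3}" by (rule generate.incl) simp
    show "a3 \<otimes> a2 = a2 \<otimes> a3" "a2 \<otimes> a1 = a1 \<otimes> a2" "a3 \<otimes> a1 = a1 \<otimes> a3"
      using commute(4,2,3) by simp_all
    show "inv a3 = a3 \<or> inv a3 = inv a3" by simp
  qed (fact p order carr commute ba1 pow pow_b)+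
  show "center G = generate G {a3}" by (rule center_eq)
  show "polarization G p (generate G {a2, a3, b}) (generate G {b, a2})"
    using polarization by (simp add: insert_commute)
qed

text \<open>The roles of \<open>a1\<close> and \<open>b\<close> are exchanged, so that
  \<open>b\<close> may have a nontrivial central p-th power, as it does in
  \<open>Phi7_2111c\<close>. Now \<open>c\<close> is the noncentral element
  \<open>a2\<close>.\<close>

lemma Phi7_polarization_alpha:
  fixes G (structure)
  assumes p: "Factorial_Ring.prime p" and G: "Phi7_common p G a a1 a2 a3 b"
    and comm: "commutator G a1 b = a3" and pow_a1: "a1 [^]\<^bsub>G\<^esub> p = \<one>\<^bsub>G\<^esub>"
    and pow_a: "a [^]\<^bsub>G\<^esub> p \<in> generate G {a3}" and pow_b: "b [^]\<^bsub>G\<^esub> p \<in> generate G {a3}"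
  shows "center G = generate G {a3}" "polarization G p (generate G {a1, a2, a3}) (generate G {a1, a2})"
proof -
  interpret group G using G by (simp add: Phi7_common_def generated_p5_def)
  have carr: "a \<in> carrier G" "a1 \<in> carrier G" "a2 \<in> carrier G" "a3 \<in> carrier G" "b \<in> carrier G"
    and order: "Coset.order G = p ^ 5" and gen: "generate G {a, a1, a2, a3, b} = carrier G"
    and c: "commutator G a1 a = a2" "commutator G a2 a = a3"
    and triv: "commutator G a3 a = \<one>" "commutator G a1 a2 = \<one>" "commutator G a1 a3 = \<one>"
        "commutator G a2 a3 = \<one>"
      "commutator G a b = \<one>" "commutator G a2 b = \<one>" "commutator G a3 b = \<one>"
    and pow: "a2 [^] p = \<one>" "a3 [^] p = \<one>"
    using G by (auto simp: Phi7_common_def generated_p5_def commuting_pairs_def)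
  note swap = commutator_swap[of a1 a] commutator_swap[of a2 a] commutator_swap[of a1 b]
  note comm_iff = commutator_eq_one_iff[of a3 a] commutator_eq_one_iff[of a1 a2]
      commutator_eq_one_iff[of a1 a3]
    commutator_eq_one_iff[of a2 a3] commutator_eq_one_iff[of a b] commutator_eq_one_iff[of a2 b]
        commutator_eq_one_iff[of a3 b]
  have commute: "a3 \<otimes> a = a \<otimes> a3" "a1 \<otimes> a2 = a2 \<otimes> a1" "a1 \<otimes> a3 = a3 \<otimes> a1" "a2 \<otimes> a3 = a3 \<otimes> a2"
      "a \<otimes> b = b \<otimes> a" "a2 \<otimes> b = b \<otimes> a2" "a3 \<otimes> b = b \<otimes> a3"
    using comm_iff carr triv by blast+
  interpret five_step G p a3 a2 a1 b a a3 a2 "\<one>"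
  proof
    show "generate G {a, b, a1, a2, a3} = carrier G" using gen by (simp add: insert_commute)
    show "b [^] p \<in> generate G {a1, a2, a3}" "a [^] p \<in> generate G {b, a1, a2, a3}"
      using pow_a pow_b mono_generate[of "{a3}" "{a1, a2, a3}"] mono_generate[of "{a3}"
          "{b, a1, a2, a3}"] by auto
    show "a1 \<otimes> a = a \<otimes> a1 \<otimes> a2" "a2 \<otimes> a = a \<otimes> a2 \<otimes> a3" "a1 \<otimes> b = b \<otimes> a1 \<otimes> a3"
      using swap carr c comm by auto
    show "b \<otimes> a = a \<otimes> b \<otimes> \<one>" using commute(5) carr by simp
    show "\<one> \<in> generate G {a1, a2, a3}" by (rule generate.one)
    show "a2 \<in> generate G {a2, a3}" by (rule generate.incl) simp
    show "a3 \<otimes> a2 = a2 \<otimes> a3" "a2 \<otimes> a1 = a1 \<otimes> a2" "a3 \<otimes> a1 = a1 \<otimes> a3"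
      using commute(4,2,3) by simp_all
    show "a3 = a3 \<or> a3 = inv a3" by simp
  qed (fact p order carr commute pow pow_a1)+
  show "center G = generate G {a3}" by (rule center_eq)
  show "polarization G p (generate G {a1, a2, a3}) (generate G {a1, a2})" by (rule polarization)
qed

lemma Phi7_2111a_polarization:
  assumes "Factorial_Ring.prime p" "Phi7_2111a p G a a1 a2 a3 b"
  shows "center G = generate G {a3}" "polarization G p (generate G {a2, a3, b}) (generate G {b, a2})"
proof -
  note D = assms(2)[unfolded Phi7_2111a_def]
  have common: "Phi7_common p G a a1 a2 a3 b" and comm: "commutator G a1 b = a3" using D by blast+
  have pow: "b [^]\<^bsub>G\<^esub> p = \<one>\<^bsub>G\<^esub>" using D by blast
  have mem: "a [^]\<^bsub>G\<^esub> p \<in> generate G {a3}" "a1 [^]\<^bsub>G\<^esub> p \<in> generate G {a3}"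
    using D generate.incl[of a3 "{a3}" G] generate.one[of G "{a3}"] by auto
  show "center G = generate G {a3}" "polarization G p (generate G {a2, a3, b}) (generate G {b, a2})"
    by (rule Phi7_polarization_beta[OF assms(1) common comm pow mem])+
qed

text \<open>The relations only equate r-th powers of the commutator and \<open>a3\<close>. As r is
  prime to the group order, the elements themselves agree.\<close>

lemma Phi7_2111b_polarization:
  fixes G (structure)
  assumes p: "Factorial_Ring.prime p" and G: "Phi7_2111b r p G a a1 a2 a3 b" and r: "r \<noteq> 0" "\<not> p dvd r"
  shows "center G = generate G {a3}" "polarization G p (generate G {a2, a3, b}) (generate G {b, a2})"
proof -
  have common: "Phi7_common p G a a1 a2 a3 b" using G by (simp add: Phi7_2111b_def)
  interpret group G using common by (simp add: Phi7_common_def generated_p5_def)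
  have carr: "a1 \<in> carrier G" "a3 \<in> carrier G" "b \<in> carrier G" and order: "Coset.order G = p ^ 5"
    using common by (auto simp: Phi7_common_def generated_p5_def)
  have "coprime r (Coset.order G)"
    using prime_imp_coprime[OF p r(2)] unfolding order by (simp add: coprime_commute)
  then have "commutator G a1 b = a3"
    using pow_coprime_inj[of "commutator G a1 b" a3 r] carr r(1) G by (simp add: Phi7_2111b_def)
  moreover have "a1 [^] p \<in> generate G {a3}"
    using generate_pow_closed[of "{a3}" a3 r] carr generate.incl[of a3 "{a3}" G] G
    by (simp add: Phi7_2111b_def)
  ultimately show "center G = generate G {a3}"
      "polarization G p (generate G {a2, a3, b}) (generate G {b, a2})"
    using Phi7_polarization_beta[OF p common] G generate.one[of G "{a3}"]
    by (simp_all add: Phi7_2111b_def)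
qed

lemma Phi7_2111c_polarization:
  assumes "Factorial_Ring.prime p" "Phi7_2111c p G a a1 a2 a3 b"
  shows "center G = generate G {a3}" "polarization G p (generate G {a1, a2, a3}) (generate G {a1, a2})"
proof -
  note D = assms(2)[unfolded Phi7_2111c_def]
  have common: "Phi7_common p G a a1 a2 a3 b" and comm: "commutator G a1 b = a3" using D by blast+
  have pow: "a1 [^]\<^bsub>G\<^esub> p = \<one>\<^bsub>G\<^esub>" using D by blast
  have mem: "a [^]\<^bsub>G\<^esub> p \<in> generate G {a3}" "b [^]\<^bsub>G\<^esub> p \<in> generate G {a3}"
    using D generate.incl[of a3 "{a3}" G] generate.one[of G "{a3}"] by auto
  show "center G = generate G {a3}" "polarization G p (generate G {a1, a2, a3}) (generate G {a1, a2})"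
    by (rule Phi7_polarization_alpha[OF assms(1) common comm pow mem])+
qed

lemma Phi7_1_5_polarization:
  assumes "Factorial_Ring.prime p" "Phi7_1_5 p G a a1 a2 a3 b"
  shows "center G = generate G {a3}" "polarization G p (generate G {a2, a3, b}) (generate G {b, a2})"
proof -
  note D = assms(2)[unfolded Phi7_1_5_def]
  have common: "Phi7_common p G a a1 a2 a3 b" and comm: "commutator G a1 b = a3" using D by blast+
  have pow: "b [^]\<^bsub>G\<^esub> p = \<one>\<^bsub>G\<^esub>" using D by blast
  have mem: "a [^]\<^bsub>G\<^esub> p \<in> generate G {a3}" "a1 [^]\<^bsub>G\<^esub> p \<in> generate G {a3}"
    using D generate.incl[of a3 "{a3}" G] generate.one[of G "{a3}"] by auto
  show "center G = generate G {a3}" "polarization G p (generate G {a2, a3, b}) (generate G {b, a2})"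
    by (rule Phi7_polarization_beta[OF assms(1) common comm pow mem])+
qed

lemma Phi8_polarization:
  fixes G (structure)
  assumes p: "Factorial_Ring.prime p" "odd p" and G: "Phi8_32 p G a1 a2 b"
  shows "center G = generate G {a1 [^]\<^bsub>G\<^esub> (p ^ 2)}"
    "polarization G p (generate G {a1 [^]\<^bsub>G\<^esub> (p ^ 2), a2}) (generate G {a2})"
proof -
  interpret group G using G by (simp add: Phi8_32_def generated_p5_def)
  have carr: "a1 \<in> carrier G" "a2 \<in> carrier G" "b \<in> carrier G" and order: "Coset.order G = p ^ 5"
    and gen: "generate G {a1, a2, b} = carrier G" and comm: "commutator G a1 a2 = b"
    and b: "b = a1 [^] p" and pow: "b [^] (p ^ 2) = \<one>" "a2 [^] (p ^ 2) = \<one>"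
    using G unfolding Phi8_32_def generated_p5_def by blast+
  interpret two_step G p a1 a2 b "a1 [^] (p ^ 2)"
  proof
    have "b \<in> generate G {a2, a1}"
      unfolding b by (rule generate_pow_closed) (use carr in \<open>auto intro: generate.incl\<close>)
    then have "{a1, a2, b} \<subseteq> generate G {a2, a1}" by (auto intro: generate.incl)
    then have "generate G {a1, a2, b} \<subseteq> generate G {a2, a1}"
      by (rule generate_subgroup_incl) (use carr in \<open>auto intro: generate_is_subgroup\<close>)
    then show "generate G {a2, a1} = carrier G" using gen generate_incl[of "{a2, a1}"] carr by auto
    show "a1 \<otimes> a2 = a2 \<otimes> a1 \<otimes> b" using commutator_swap[of a1 a2] carr comm by simp
    show "a1 [^] (p ^ 3) = \<one>"
      using pow(1) carr by (simp add: b nat_pow_pow power3_eq_cube power2_eq_square mult.assoc)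
  qed (fact p order carr b pow refl)+
  show "center G = generate G {a1 [^] (p ^ 2)}" by (rule center_eq)
  show "polarization G p (generate G {a1 [^] (p ^ 2), a2}) (generate G {a2})"
    using polarization by (simp add: insert_commute)
qed

text \<open>Here \<open>a4\<close>, \<open>a3\<close>, \<open>a2\<close>, \<open>a1\<close>,
  \<open>a\<close> play the roles of \<open>z\<close>, \<open>v\<close>, \<open>u\<close>,
  \<open>s\<close>, \<open>t\<close>. The elements \<open>a2\<close>, \<open>a3\<close>,
  \<open>a4\<close> are commutators, so they generate the derived subgroup; it is abelian, so p-th
  powers vanish on all of it because they do on these generators.\<close>

lemma Phi10_1_5_polarization:
  assumes p: "Factorial_Ring.prime p" and K: "Phi10_1_5 p K a a1 a2 a3 a4"
  shows "polarization K p (derived_subgroup K) (generate K {a2, a3})"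
    and "\<And>h. h \<in> derived_subgroup K \<Longrightarrow> h [^]\<^bsub>K\<^esub> p = \<one>\<^bsub>K\<^esub>"
proof -
  interpret group K using K by (simp add: Phi10_1_5_def generated_p5_def)
  have elems: "a \<in> carrier K" "a1 \<in> carrier K" "a2 \<in> carrier K" "a3 \<in> carrier K" "a4 \<in> carrier K"
    and order: "Coset.order K = p ^ 5" and gen: "generate K {a, a1, a2, a3, a4} = carrier K"
    and comms: "commutator K a1 a = a2" "commutator K a2 a = a3" "commutator K a3 a = a4"
        "commutator K a1 a2 = a4"
    and triv: "commutator K a4 a = \<one>\<^bsub>K\<^esub>" "commutator K a1 a3 = \<one>\<^bsub>K\<^esub>" "commutator K a1 a4 = \<one>\<^bsub>K\<^esub>"
      "commutator K a2 a3 = \<one>\<^bsub>K\<^esub>" "commutator K a2 a4 = \<one>\<^bsub>K\<^esub>" "commutator K a3 a4 = \<one>\<^bsub>K\<^esub>"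
    and pow: "a [^]\<^bsub>K\<^esub> p = \<one>\<^bsub>K\<^esub>" "a1 [^]\<^bsub>K\<^esub> p = \<one>\<^bsub>K\<^esub>" "a2 [^]\<^bsub>K\<^esub> p = \<one>\<^bsub>K\<^esub>" "a3 [^]\<^bsub>K\<^esub> p = \<one>\<^bsub>K\<^esub>"
      "a4 [^]\<^bsub>K\<^esub> p = \<one>\<^bsub>K\<^esub>"
    using K by (auto simp: Phi10_1_5_def generated_p5_def commuting_pairs_def)
  note swap = commutator_swap[of a1 a] commutator_swap[of a2 a] commutator_swap[of a3 a]
      commutator_swap[of a1 a2]
  note comm_iff = commutator_eq_one_iff[of a4 a] commutator_eq_one_iff[of a1 a3]
      commutator_eq_one_iff[of a1 a4]
    commutator_eq_one_iff[of a2 a3] commutator_eq_one_iff[of a2 a4] commutator_eq_one_iff[of a3 a4]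
  have commute: "a4 \<otimes>\<^bsub>K\<^esub> a = a \<otimes>\<^bsub>K\<^esub> a4" "a1 \<otimes>\<^bsub>K\<^esub> a3 = a3 \<otimes>\<^bsub>K\<^esub> a1" "a1 \<otimes>\<^bsub>K\<^esub> a4 = a4 \<otimes>\<^bsub>K\<^esub> a1"
    "a2 \<otimes>\<^bsub>K\<^esub> a3 = a3 \<otimes>\<^bsub>K\<^esub> a2" "a2 \<otimes>\<^bsub>K\<^esub> a4 = a4 \<otimes>\<^bsub>K\<^esub> a2" "a3 \<otimes>\<^bsub>K\<^esub> a4 = a4 \<otimes>\<^bsub>K\<^esub> a3"
    using comm_iff elems triv by blast+
  have "a1 \<otimes>\<^bsub>K\<^esub> a2 \<otimes>\<^bsub>K\<^esub> inv\<^bsub>K\<^esub> a4 = a2 \<otimes>\<^bsub>K\<^esub> a1"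
    using swap(4) elems comms by (simp add: m_assoc)
  then have a21: "a2 \<otimes>\<^bsub>K\<^esub> a1 = a1 \<otimes>\<^bsub>K\<^esub> a2 \<otimes>\<^bsub>K\<^esub> inv\<^bsub>K\<^esub> a4" by simp
  interpret five_step K p a4 a3 a2 a1 a "inv\<^bsub>K\<^esub> a4" a3 a2
  proof
    show "generate K {a, a1, a2, a3, a4} = carrier K" by (rule gen)
    show "a1 [^]\<^bsub>K\<^esub> p \<in> generate K {a2, a3, a4}" "a [^]\<^bsub>K\<^esub> p \<in> generate K {a1, a2, a3, a4}"
      using pow generate.one[of K] by simp_all
    show "a1 \<otimes>\<^bsub>K\<^esub> a = a \<otimes>\<^bsub>K\<^esub> a1 \<otimes>\<^bsub>K\<^esub> a2" "a2 \<otimes>\<^bsub>K\<^esub> a = a \<otimes>\<^bsub>K\<^esub> a2 \<otimes>\<^bsub>K\<^esub> a3"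
      "a3 \<otimes>\<^bsub>K\<^esub> a = a \<otimes>\<^bsub>K\<^esub> a3 \<otimes>\<^bsub>K\<^esub> a4"
      using swap elems comms by auto
    show "a3 \<in> generate K {a3, a4}" "a2 \<in> generate K {a2, a3, a4}" by (rule generate.incl; simp)+
    show "a4 \<otimes>\<^bsub>K\<^esub> a3 = a3 \<otimes>\<^bsub>K\<^esub> a4" "a4 \<otimes>\<^bsub>K\<^esub> a2 = a2 \<otimes>\<^bsub>K\<^esub> a4" "a4 \<otimes>\<^bsub>K\<^esub> a1 = a1 \<otimes>\<^bsub>K\<^esub> a4"
      "a3 \<otimes>\<^bsub>K\<^esub> a2 = a2 \<otimes>\<^bsub>K\<^esub> a3" "a3 \<otimes>\<^bsub>K\<^esub> a1 = a1 \<otimes>\<^bsub>K\<^esub> a3"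
      using commute by simp_all
    show "inv\<^bsub>K\<^esub> a4 = a4 \<or> inv\<^bsub>K\<^esub> a4 = inv\<^bsub>K\<^esub> a4" by simp
  qed (fact p order elems commute a21 pow)+
  have "commutator K x y \<in> derived_subgroup K" if "x \<in> carrier K" "y \<in> carrier K" for x y
    unfolding derived_eq_generate_commutators using that by (intro generate.incl) blast
  from this[of a1 a] this[of a2 a] this[of a3 a]
  have "{a2, a3, a4} \<subseteq> derived_subgroup K" using comms elems by simp
  then have "generate K {a2, a3, a4} \<subseteq> derived_subgroup K"
    by (rule generate_subgroup_incl) (rule derived_is_subgroup, simp)
  then have eq: "derived_subgroup K = generate K {a2, a3, a4}" using derived_subset by blast
  show "polarization K p (derived_subgroup K) (generate K {a2, a3})"
    unfolding eq by (rule polarization)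
  interpret P: polarization K p "generate K {a2, a3, a4}" "generate K {a2, a3}" by (rule polarization)
  fix h assume "h \<in> derived_subgroup K"
  then have "h \<in> generate K {a2, a3, a4}" by (simp add: eq)
  then show "h [^]\<^bsub>K\<^esub> p = \<one>\<^bsub>K\<^esub>"
  proof (induction rule: generate.induct)
    case (inv h)
    then show ?case using elems pow by (auto simp: nat_pow_inv)
  next
    case (eng h1 h2)
    then show ?case
      using P.H_commute[OF eng.hyps(1,2)] P.H_carrier by (simp add: pow_mult_distrib)
  qed (use pow in auto)
qed

text \<open>The power relations of the model group need not hold in \<open>G\<close>, but the
  derived subgroups are isomorphic, and that carries over the exponent.\<close>

lemma Phi10_polarization:
  fixes G (structure)
  assumes p: "Factorial_Ring.prime p" and G: "in_Phi10 p G"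
  shows "\<exists>N. polarization G p (derived_subgroup G) N \<and> (\<forall>h\<in>derived_subgroup G. h [^] p = \<one>)"
proof -
  obtain K :: "'a monoid" and a a1 a2 a3 a4 where K: "Phi10_1_5 p K a a1 a2 a3 a4"
      and iso: "isoclinic G K"
    using G unfolding in_Phi10_def by blast
  have grp: "group G" "group K" and order: "Coset.order G = p ^ 5"
    using G K by (auto simp: in_Phi10_def Phi10_1_5_def generated_p5_def)
  obtain \<theta> \<phi> where "isoclinism G K \<theta> \<phi>"
    using iso grp unfolding isoclinic_def isoclinism_def isoclinism_axioms_def by blast
  then interpret isoclinism G K \<theta> \<phi> .
  note pol = polarization_transfer[OF Phi10_1_5_polarization(1)[OF p K] order]
  have "h [^] p = \<one>" if h: "h \<in> derived_subgroup G" for h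
  proof (rule phi_inj)
    have "\<phi> (h [^] p) = \<phi> h [^]\<^bsub>K\<^esub> p" using phi_pow[OF h] .
    also have "\<dots> = \<one>\<^bsub>K\<^esub>" using Phi10_1_5_polarization(2)[OF p K phi_closed[OF h]] .
    finally show "\<phi> (h [^] p) = \<phi> \<one>" by (simp add: phi_one)
    show "\<one> \<in> derived_subgroup G" using subgroup.one_closed[OF subgroup_G'] .
    show "h [^] p \<in> derived_subgroup G"
      using h subgroup.one_closed[OF subgroup_G'] subgroup.m_closed[OF subgroup_G']
      by (induction p) auto
  qed
  then show ?thesis using pol by blast
qed

theorem theorem27:
  fixes G :: "('a, 'b) monoid_scheme" and p :: nat and \<mu> :: "'a \<Rightarrow> complex"
  assumes "Factorial_Ring.prime p" and "p \<ge> 5"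
    and "group G" and "Coset.order G = p ^ 5"
    and "in_Phi7 p G \<or> in_Phi8 p G \<or> in_Phi10 p G"
    and "\<mu> \<in> Irr (G\<lparr>carrier := center G\<rparr>)" and "\<mu> \<noteq> (\<lambda>z \<in> center G. 1)"
  shows "chi_mu p G \<mu> \<in> Irr G \<and>
    (\<forall>a a1 a2 a3 b.
      (Phi7_2111a p G a a1 a2 a3 b \<longrightarrow>
        center G = generate G {a3} \<and>
        required_pair_by_values G (chi_mu p G \<mu>) (generate G {a2, a3, b})
          {(a2, 1), (a3, \<mu> a3), (b, 1)}) \<and>
      (\<forall>r \<in> {1, nu p}. Phi7_2111b r p G a a1 a2 a3 b \<longrightarrow>
        center G = generate G {a3} \<and>
        required_pair_by_values G (chi_mu p G \<mu>) (generate G {a2, a3, b})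
          {(a2, 1), (a3, \<mu> a3), (b, 1)}) \<and>
      (Phi7_2111c p G a a1 a2 a3 b \<longrightarrow>
        center G = generate G {a3} \<and>
        required_pair_by_values G (chi_mu p G \<mu>) (generate G {a1, a2, a3})
          {(a1, 1), (a2, 1), (a3, \<mu> a3)}) \<and>
      (Phi7_1_5 p G a a1 a2 a3 b \<longrightarrow>
        center G = generate G {a3} \<and>
        required_pair_by_values G (chi_mu p G \<mu>) (generate G {a2, a3, b})
          {(a2, 1), (a3, \<mu> a3), (b, 1)})) \<and>
    (\<forall>a1 a2 b. Phi8_32 p G a1 a2 b \<longrightarrow>
      center G = generate G {a1 [^]\<^bsub>G\<^esub> (p ^ 2)} \<and>
      required_pair_by_values G (chi_mu p G \<mu>) (generate G {a1 [^]\<^bsub>G\<^esub> (p ^ 2), a2})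
        {(a1 [^]\<^bsub>G\<^esub> (p ^ 2), \<mu> (a1 [^]\<^bsub>G\<^esub> (p ^ 2))), (a2, 1)}) \<and>
    (in_Phi10 p G \<longrightarrow>
      (let G' = derived_subgroup G;
           \<Psi> = {\<psi> \<in> Irr_over (G\<lparr>carrier := G'\<rparr>) (center G). restrict \<psi> (center G) = \<mu>}
       in \<Psi> \<noteq> {} \<and> (\<forall>\<psi> \<in> \<Psi>. required_pair G (chi_mu p G \<mu>) G' \<psi>)))"
proof -
  interpret group G by fact
  note p = \<open>Factorial_Ring.prime p\<close>
  have odd: "odd p" using p \<open>p \<ge> 5\<close> prime_odd_nat by force
  have character: "polarization_character G p H N \<mu>" if "polarization G p H N" for H N
    using that assms(6,7) by (simp add: polarization_character_def polarization_character_axioms_def)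
  have by_values: "required_pair_by_values G (chi_mu p G \<mu>) H V"
    if "polarization G p H N" "\<And>h c. (h, c) \<in> V \<Longrightarrow> h \<in> N \<and> c = 1 \<or> h \<in> center G \<and> c = \<mu> h"
      "H = generate G (fst ` V)" for H N V
    by (rule polarization_character.required_pair_by_valuesI[OF character[OF that(1)] that(2,3)])
  have r: "r \<noteq> 0 \<and> \<not> p dvd r" if "r \<in> {1, nu p}" for r
    using that nu_not_dvd[OF p odd] prime_gt_1_nat[OF p] by auto
  have by_values_beta: "required_pair_by_values G (chi_mu p G \<mu>) (generate G {a2, a3, b}) {(a2, 1),
      (a3, \<mu> a3), (b, 1)}"
    if "center G = generate G {a3}"
        "polarization G p (generate G {a2, a3, b}) (generate G {b, a2})" for a2 a3 b
    by (rule by_values[OF that(2)]) (auto simp: that(1) intro: generate.incl)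
  have by_values_alpha: "required_pair_by_values G (chi_mu p G \<mu>) (generate G {a1, a2, a3}) {(a1,
      1), (a2, 1), (a3, \<mu> a3)}"
    if "center G = generate G {a3}"
        "polarization G p (generate G {a1, a2, a3}) (generate G {a1, a2})" for a1 a2 a3
    by (rule by_values[OF that(2)]) (auto simp: that(1) intro: generate.incl)
  have Phi8: "required_pair_by_values G (chi_mu p G \<mu>) (generate G {z, a2}) {(z, \<mu> z), (a2, 1)}"
    if "center G = generate G {z}" "polarization G p (generate G {z, a2}) (generate G {a2})" for z a2
    by (rule by_values[OF that(2)]) (auto simp: that(1) intro: generate.incl)
  have Phi10: "\<exists>N. polarization G p (derived_subgroup G) N \<and> (\<forall>h\<in>derived_subgroup G. h [^]\<^bsub>G\<^esub> p = \<one>\<^bsub>G\<^esub>)"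
    if "in_Phi10 p G"
    by (rule Phi10_polarization[OF p that])
  \<comment> \<open>Irreducibility of \<open>chi_mu\<close> needs one polarization from whichever
    family contains \<open>G\<close>; each remaining conjunct brings its own presentation or
    isoclinism.\<close>
  have "\<exists>H N. polarization G p H N"
    using assms(5)
  proof (elim disjE)
    assume "in_Phi7 p G"
    then obtain a a1 a2 a3 b where "Phi7_2111a p G a a1 a2 a3 b \<or> (\<exists>r\<in>{1, nu p}. Phi7_2111b r p G a
        a1 a2 a3 b) \<or>
        Phi7_2111c p G a a1 a2 a3 b \<or> Phi7_1_5 p G a a1 a2 a3 b"
      unfolding in_Phi7_def by blast
    then show ?thesis
    proof (elim disjE bexE)
      show ?thesis if "Phi7_2111a p G a a1 a2 a3 b" using Phi7_2111a_polarization(2)[OF p that] by blast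
      show ?thesis if "r \<in> {1, nu p}" "Phi7_2111b r p G a a1 a2 a3 b" for r
        using Phi7_2111b_polarization(2)[OF p that(2)] r[OF that(1)] by blast
      show ?thesis if "Phi7_2111c p G a a1 a2 a3 b" using Phi7_2111c_polarization(2)[OF p that] by blast
      show ?thesis if "Phi7_1_5 p G a a1 a2 a3 b" using Phi7_1_5_polarization(2)[OF p that] by blast
    qed
  next
    assume "in_Phi8 p G"
    then obtain a1 a2 b where G: "Phi8_32 p G a1 a2 b" unfolding in_Phi8_def by blast
    show ?thesis using Phi8_polarization(2)[OF p odd G] by blast
  next
    assume "in_Phi10 p G"
    then show ?thesis using Phi10 by blast
  qed
  then have irr: "chi_mu p G \<mu> \<in> Irr G"
    using polarization_character.chi_mu_Irr[OF character] by blast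
  have 10: "let G' = derived_subgroup G;
           \<Psi> = {\<psi> \<in> Irr_over (G\<lparr>carrier := G'\<rparr>) (center G). restrict \<psi> (center G) = \<mu>}
       in \<Psi> \<noteq> {} \<and> (\<forall>\<psi> \<in> \<Psi>. required_pair G (chi_mu p G \<mu>) G' \<psi>)"
    if G: "in_Phi10 p G"
  proof -
    obtain N where N: "polarization G p (derived_subgroup G) N"
      and exponent: "\<And>h. h \<in> derived_subgroup G \<Longrightarrow> h [^]\<^bsub>G\<^esub> p = \<one>\<^bsub>G\<^esub>"
      using Phi10[OF G] by blast
    show ?thesis
      unfolding Let_def
      by (rule polarization_character.Irr_over_required_pairs[OF character[OF N] exponent])
  qed
  have n7a: "center G = generate G {a3}"
      "required_pair_by_values G (chi_mu p G \<mu>) (generate G {a2, a3, b})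
      {(a2, 1), (a3, \<mu> a3), (b, 1)}" if "Phi7_2111a p G a a1 a2 a3 b" for a a1 a2 a3 b
    using Phi7_2111a_polarization[OF p that] by_values_beta by blast+
  have n7b: "center G = generate G {a3}"
      "required_pair_by_values G (chi_mu p G \<mu>) (generate G {a2, a3, b})
      {(a2, 1), (a3, \<mu> a3), (b, 1)}" if "Phi7_2111b r p G a a1 a2 a3 b"
          "r \<in> {1, nu p}" for r a a1 a2 a3 b
    using Phi7_2111b_polarization[OF p that(1)] r[OF that(2)] by_values_beta by blast+
  have n7c: "center G = generate G {a3}"
      "required_pair_by_values G (chi_mu p G \<mu>) (generate G {a1, a2, a3})
      {(a1, 1), (a2, 1), (a3, \<mu> a3)}" if "Phi7_2111c p G a a1 a2 a3 b" for a a1 a2 a3 b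
    using Phi7_2111c_polarization[OF p that] by_values_alpha by blast+
  have n7d: "center G = generate G {a3}"
      "required_pair_by_values G (chi_mu p G \<mu>) (generate G {a2, a3, b})
      {(a2, 1), (a3, \<mu> a3), (b, 1)}" if "Phi7_1_5 p G a a1 a2 a3 b" for a a1 a2 a3 b
    using Phi7_1_5_polarization[OF p that] by_values_beta by blast+
  have n8: "center G = generate G {a1 [^]\<^bsub>G\<^esub> (p ^ 2)}"
      "required_pair_by_values G (chi_mu p G \<mu>) (generate G {a1 [^]\<^bsub>G\<^esub> (p ^ 2), a2})
        {(a1 [^]\<^bsub>G\<^esub> (p ^ 2), \<mu> (a1 [^]\<^bsub>G\<^esub> (p ^ 2))), (a2, 1)}" if "Phi8_32 p G a1 a2 b" for a1 a2 b
    using Phi8_polarization[OF p odd that] Phi8 by blast+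
  show ?thesis by (intro conjI allI impI ballI; (rule irr n7a n7b n7c n7d n8 10; assumption))
qed

end
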